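(* Assume the discrete inf-sup condition with constant $\gamma>0$ (see context), let $\eta\in(0,1)$ be such that $\gamma_1:=\gamma-2\eta>0$, and set $C(\eta,\gamma_1)=\frac{2\eta}{\gamma_1}$. Then $$\max_{v_h\in V_h\setminus\{0\}}\frac{\|P_1^{-1}Bv_h\|_{\mathcal H}}{\|v_h\|_{\mathcal H}}\le 1+C(\eta,\gamma_1).$$ Moreover, when $C(\eta,\gamma_1)<1$, $$\min_{v_h\in V_h\setminus\{0\}}\frac{|(v_h,P_1^{-1}Bv_h)_{\mathcal H}|}{\|v_h\|_{\mathcal H}^2}\ge 1-C(\eta,\gamma_1).$$ Here $P_1^{-1}$ is the preconditioner defined in the context.
   Context: Setting. $\Omega\subset\mathbb{R}^d$, $d\in\{2,3\}$, is a bounded convex polygonal/polyhedral domain, $k\ge k_0>0$, and $$b(u,v)=\int_\Omega\nabla u\cdot\nabla\overline v\,dx-k^2\int_\Omega u\overline v\,dx+ik\int_{\partial\Omega}u\overline v\,ds .$$ $\overline\Omega=\bigcup_{i=1}^N\overline\Omega_i$ is a decomposition into pairwise disjoint polygonal/polyhedral subdomains; each subdomain is a union of elements of a shape-regular mesh $\mathcal T_h$ of size $h$, and $V_h\subset H^1(\Omega)$ is the corresponding (complex) conforming finite element space with a real nodal basis. Functions in $V_h$ are identified with their nodal vectors; $B$ is the matrix of $b$ on $V_h$, i.e. $b(u,v)=v^HBu$. $\Gamma_i=\partial\Omega_i$, $\Gamma=\bigcup_i\Gamma_i$ (so $\partial\Omega\subset\Gamma$), $I_i=\Omega_i$ (interior),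 $I=\bigcup_i I_i$; the same symbols index the nodes in these sets, and $u_h=(u_\Gamma,u_I)$. $V_h(\Gamma)$, $V_h(\Gamma_i)$, $V_h(I_i)$ are the spaces of nodal vectors on these sets. $R_{\Gamma_i\Gamma}$ and $R_{I_iI}$ are the restriction matrices from nodal vectors on $\Gamma$ to $\Gamma_i$ and from $I$ to $I_i$; their transposes are the zero extensions. Superscripts $T$, $H$ are transpose and conjugate transpose; $\Re$, $\Im$ of a matrix are entrywise. Norm: $\|v\|_{\mathcal H}^2=|v|_{H^1(\Omega)}^2+k^2\|v\|_{L^2(\Omega)}^2$, with associated inner product $(u,v)_{\mathcal H}=\int_\Omega\nabla u\cdot\nabla\overline v\,dx+k^2\int_\Omega u\overline v\,dx$; $\|\cdot\|_{\mathcal H,\Omega_i}$ is the analogous norm on $\Omega_i$. Local matrices, in block form with respect to the nodes of $\Gamma_i$ and $I_i$: $$B^{(i)}=\begin{bmatrix}B^{(i)}_{\Gamma\Gamma}&B^{(i)}_{\Gamma I}\\ B^{(i)}_{I\Gamma}&B^{(i)}_{II}\end{bmatrix},\qquad H^{(i)}=\begin{bmatrix}H^{(i)}_{\Gamma\Gamma}&H^{(i)}_{\Gamma I}\\ H^{(i)}_{I\Gamma}&H^{(i)}_{II}\end{bmatrix}$$ are the matrices of $b^{(i)}(u,v)=\int_{\Omega_i}(\nabla u\cdot\nabla\overline v-k^2u\overline v)dx+ik\int_{\partial\Omega_i\cap\partial\Omega}u\overline v\,ds$ and of the inner product of $\|\cdot\|_{\mathcal H,\Omega_i}$ on $V_h(\overline\Omega_i)$.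 $B^{(i)}_{\Gamma I},B^{(i)}_{I\Gamma},B^{(i)}_{II}$ are real. Discrete inf-sup condition (standing assumption): there is $\gamma>0$ with $$\inf_{u\in V_h\setminus\{0\}}\sup_{v\in V_h\setminus\{0\}}\frac{|b(u,v)|}{\|u\|_{\mathcal H}\|v\|_{\mathcal H}}\ge\gamma .$$ Spaces. For each $i$ solve $B^{(i)}_{II}\phi^{(i)}_j=\mu^{(i)}_jH^{(i)}_{II}\phi^{(i)}_j$, $j=1,\dots,n_i$, with real eigenvectors orthonormal with respect to $H^{(i)}_{II}$. Given a fixed $\beta>0$, the columns of $Q_S^{(i)}$ are the $k_i$ eigenvectors with $|\mu_j^{(i)}|<\beta$ and the columns of $Q_L^{(i)}$ are the remaining ones. Set $B_i=Q_L^{(i)T}B_{II}^{(i)}Q_L^{(i)}$ and $$B_L^{(i)}=Q_L^{(i)}B_i^{-1}Q_L^{(i)T},\qquad H_L^{(i)}=Q_L^{(i)}\big(Q_L^{(i)T}H_{II}^{(i)}Q_L^{(i)}\big)^{-1}Q_L^{(i)T}.$$ $V_0$ is the space of vectors $u_0=(u_\Gamma,\alpha_S)$, $u_\Gamma\in V_h(\Gamma)$, $\alpha_S=(\alpha_S^{(1)},\dots,\alpha_S^{(N)})$, $\alpha_S^{(i)}\in\mathbb C^{k_i}$; $R_S^{(i)}\alpha_S=\alpha_S^{(i)}$; $V_0^{(i)}=V_h(\Gamma_i)\oplus\mathbb C^{k_i}$ and $R_{\Gamma,S}^{(i)}:V_0\to V_0^{(i)}$, $R_{\Gamma,S}^{(i)}(u_\Gamma,\alpha_S)=(R_{\Gamma_i\Gamma}u_\Gamma,\alpha_S^{(i)})$.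 The extension $R_0^T:V_0\to V_h$ is $$R_0^Tu_0=\begin{bmatrix}u_\Gamma\\ \sum_{i}R_{I_iI}^T\big(-B_L^{(i)}B_{I\Gamma}^{(i)}R_{\Gamma_i\Gamma}u_\Gamma+Q_S^{(i)}R_S^{(i)}\alpha_S\big)\end{bmatrix},$$ and $R_0$ is its (matrix) transpose. $R_i$ is the restriction of nodal vectors of $V_h$ to the nodes of $I_i$, and $R_i^T$ is zero extension from $I_i$. Local coarse matrices: $$B_0^{(i)}=\begin{bmatrix}B_{\Gamma\Gamma}^{(i)}-B_{\Gamma I}^{(i)}B_L^{(i)}B_{I\Gamma}^{(i)}&B_{\Gamma I}^{(i)}Q_S^{(i)}\\ Q_S^{(i)T}B_{I\Gamma}^{(i)}&Q_S^{(i)T}B_{II}^{(i)}Q_S^{(i)}\end{bmatrix},\quad H_0^{(i)}=\begin{bmatrix}\hat H_{\Gamma\Gamma}^{(i)}&H_{\Gamma I}^{(i)}Q_S^{(i)}\\ Q_S^{(i)T}H_{I\Gamma}^{(i)}&Q_S^{(i)T}H_{II}^{(i)}Q_S^{(i)}\end{bmatrix},$$ with $\hat H_{\Gamma\Gamma}^{(i)}=H_{\Gamma\Gamma}^{(i)}-H_{\Gamma I}^{(i)}H_L^{(i)}H_{I\Gamma}^{(i)}$, and $$C_0^{(i)}=\begin{bmatrix}\hat C_{\Gamma\Gamma}^{(i)}&0\\ 0&Q_S^{(i)T}H_{II}^{(i)}Q_S^{(i)}\end{bmatrix},$$ where $\hat C_{\Gamma\Gamma}^{(i)}$ is the block-diagonal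 part of $\hat H_{\Gamma\Gamma}^{(i)}$ obtained by setting to zero all entries coupling nodes of $\Gamma_i$ that belong to different subdomain vertices/edges (open edges; for $d=3$ also open faces). Both $H_0^{(i)}$ and $C_0^{(i)}$ are symmetric positive definite. Spectral selection with threshold $\eta\in(0,1)$. (1) Solve $\Re B_0^{(i)}\xi_j=\lambda_jH_0^{(i)}\xi_j$ with real eigenvectors orthonormal with respect to $H_0^{(i)}$; the columns of $Q_1^{(i)}$ are the eigenvectors with $\lambda_j<1-\eta$ or $\lambda_j>1+\eta$, and the columns of $Q_1^{(i)\perp}$ are the remaining ones. (2) Solve $(Q_1^{(i)\perp})^TC_0^{(i)}Q_1^{(i)\perp}\phi_j=\lambda_j(Q_1^{(i)\perp})^TH_0^{(i)}Q_1^{(i)\perp}\phi_j$ with eigenvectors orthonormal with respect to $(Q_1^{(i)\perp})^TH_0^{(i)}Q_1^{(i)\perp}$; the columns of $Q_2^{(i)}$ are the vectors $Q_1^{(i)\perp}\phi_j$ with $\lambda_j<1-\eta$ or $\lambda_j>1+\eta$. Put $Q_{Re}^{(i)}=[Q_1^{(i)},Q_2^{(i)}]$ and $\Pi_{Re}^{(i)}=Q_{Re}^{(i)}Q_{Re}^{(i)T}H_0^{(i)}$. Preconditioner: $B_{P_1}=\sum_{i=1}^N R_{\Gamma,S}^{(i)T}B_{P_1}^{(i)}R_{\Gamma,S}^{(i)}$ with $$B_{P_1}^{(i)}=\Re B_0^{(i)}+\mathbf i\,\Im B_0^{(i)}-(I-\Pi_{Re}^{(i)})^T\,\Re B_0^{(i)}\,(I-\Pi_{Re}^{(i)})+(I-\Pi_{Re}^{(i)})^TC_0^{(i)}(I-\Pi_{Re}^{(i)}),$$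 which is invertible when $\gamma-2\eta>0$, and $$P_1^{-1}=R_0^TB_{P_1}^{-1}R_0+\sum_{i=1}^NR_i^TQ_L^{(i)}B_i^{-1}Q_L^{(i)T}R_i .$$ *)

theory Defs
  imports
    "HOL-Analysis.Analysis"
    "Jordan_Normal_Form.Gauss_Jordan_Elimination"
begin

unbundle no vec_syntax and no inner_syntax

section \<open>Surface integrals over the boundary of a convex polytopal domain\<close>

text \<open>
  The surface measure of the hyperplane \<open>P\<close>: the \<open>(d-1)\<close>-dimensional volume of a subset of \<open>P\<close>
  is the \<open>d\<close>-dimensional volume of the right cylinder of height 1 erected on it (here: of all points
  at distance at most \<open>1/2\<close> from \<open>P\<close> whose orthogonal projection to \<open>P\<close> lies in the set).
\<close>

definition hyperplane_measure :: "'a::euclidean_space set \<Rightarrow> 'a measure" where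
  "hyperplane_measure P =
     distr (restrict_space lborel {x. infdist x P \<le> 1/2}) borel (closest_point P)"

text \<open>\<open>\<integral>\<^bsub>S\<^esub> f ds\<close> for a part \<open>S\<close> of the boundary of \<open>\<Omega>\<close>, facet by facet.\<close>

definition boundary_integral :: "'a::euclidean_space set \<Rightarrow> 'a set \<Rightarrow> ('a \<Rightarrow> complex) \<Rightarrow> complex" where
  "boundary_integral \<Omega> S f =
     (\<Sum>F\<in>{F. F facet_of closure \<Omega>}. LINT x:F \<inter> S|hyperplane_measure (affine hull F). f x)"


section \<open>Domain, mesh, subdomains and finite element space\<close>

text \<open>
  The nodes serve as indices of the nodal basis, and \<open>subdom\<close>, \<open>strata\<close> are relevant only at
  arguments below \<open>num_sub\<close>. \<open>strata i\<close> consists of the vertices, open edges and (for \<open>d = 3\<close>) open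
  faces of the \<open>i\<close>-th subdomain.
\<close>

record 'a helmholtz_fem =
  Omega :: "'a set"
  wavenumber :: real
  mesh :: "'a set set"
  num_sub :: nat
  subdom :: "nat \<Rightarrow> 'a set"
  strata :: "nat \<Rightarrow> 'a set set"
  nodes :: "'a list"
  basis_fun :: "'a \<Rightarrow> 'a \<Rightarrow> real"

definition convex_polytopal_domain :: "'a::euclidean_space set \<Rightarrow> bool" where
  "convex_polytopal_domain \<Omega> \<longleftrightarrow>
     open \<Omega> \<and> \<Omega> \<noteq> {} \<and> bounded \<Omega> \<and> convex \<Omega> \<and> polytope (closure \<Omega>)"

definition shape_regular_mesh ::
    "'a::euclidean_space set \<Rightarrow> 'a set set \<Rightarrow> real \<Rightarrow> real \<Rightarrow> bool" where
  "shape_regular_mesh \<Omega> T h \<sigma> \<longleftrightarrow>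
     finite T \<and> \<Union>T = closure \<Omega> \<and>
     (\<forall>K\<in>T. polytope K \<and> interior K \<noteq> {}) \<and>
     (\<forall>K\<in>T. \<forall>K'\<in>T. (K \<inter> K') face_of K \<and> (K \<inter> K') face_of K') \<and>
     h = Max (diameter ` T) \<and>
     (\<forall>K\<in>T. \<exists>x r. 0 < r \<and> ball x r \<subseteq> K \<and> diameter K \<le> \<sigma> * r)"

definition subdomain_decomposition ::
    "'a::euclidean_space set \<Rightarrow> 'a set set \<Rightarrow> nat \<Rightarrow> (nat \<Rightarrow> 'a set) \<Rightarrow> bool" where
  "subdomain_decomposition \<Omega> T N sub \<longleftrightarrow>
     closure \<Omega> = (\<Union>i<N. closure (sub i)) \<and>
     (\<forall>i<N. \<forall>j<N. i \<noteq> j \<longrightarrow> sub i \<inter> sub j = {}) \<and>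
     (\<forall>i<N. connected (sub i) \<and> sub i \<noteq> {} \<and> sub i = interior (closure (sub i)) \<and>
            (\<exists>K\<subseteq>T. closure (sub i) = \<Union>K))"

text \<open>
  A finite partition of \<open>\<Gamma>\<close> into connected pieces that are relatively open in their affine hull:
  pieces of dimension 0, 1 and 2 are the vertices, open edges and open faces. Adjacent coplanar
  (collinear) pieces may be distinguished, as happens where more than two subdomains meet.
\<close>

definition vertices_edges_faces :: "'a::euclidean_space set \<Rightarrow> 'a set set \<Rightarrow> bool" where
  "vertices_edges_faces \<Gamma> \<F> \<longleftrightarrow>
     finite \<F> \<and> \<Union>\<F> = \<Gamma> \<and> pairwise disjnt \<F> \<and>
     (\<forall>F\<in>\<F>. F \<noteq> {} \<and> connected F \<and> rel_open F \<and> aff_dim F < int DIM('a))"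

text \<open>
  A conforming nodal basis: continuous on the closed domain, continuously differentiable up to the
  boundary on each element (for instance polynomial there), and determined on every face of every
  element, the element itself included, by the nodes on that face, so that the basis function of a
  node vanishes on every face not containing the node. Continuity together with elementwise
  smoothness is what makes the span a subspace of \<open>H\<^sup>1(\<Omega>)\<close>.
\<close>

definition nodal_fe_basis ::
    "'a::euclidean_space set \<Rightarrow> 'a set set \<Rightarrow> 'a list \<Rightarrow> ('a \<Rightarrow> 'a \<Rightarrow> real) \<Rightarrow> bool" where
  "nodal_fe_basis \<Omega> T xs \<phi> \<longleftrightarrow>
     distinct xs \<and> set xs \<subseteq> closure \<Omega> \<and>
     (\<forall>x\<in>set xs. \<forall>y\<in>set xs. \<phi> x y = (if x = y then 1 else 0)) \<and>
     (\<forall>x\<in>set xs. continuous_on (closure \<Omega>) (\<phi> x)) \<and>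
     (\<forall>x\<in>set xs. \<forall>K\<in>T. \<exists>g (g' :: 'a \<Rightarrow> 'a \<Rightarrow>\<^sub>L real).
         (\<forall>y\<in>K. \<phi> x y = g y) \<and>
         (\<forall>y. (g has_derivative blinfun_apply (g' y)) (at y)) \<and> continuous_on UNIV g') \<and>
     (\<forall>x\<in>set xs. \<forall>K\<in>T. \<forall>F. F face_of K \<longrightarrow> x \<notin> F \<longrightarrow> (\<forall>y\<in>F. \<phi> x y = 0))"

definition helmholtz_setting :: "'a::euclidean_space helmholtz_fem \<Rightarrow> real \<Rightarrow> real \<Rightarrow> bool" where
  "helmholtz_setting D h \<sigma> \<longleftrightarrow>
     DIM('a) \<in> {2, 3} \<and>
     convex_polytopal_domain (Omega D) \<and>
     shape_regular_mesh (Omega D) (mesh D) h \<sigma> \<and>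
     subdomain_decomposition (Omega D) (mesh D) (num_sub D) (subdom D) \<and>
     (\<forall>i<num_sub D. vertices_edges_faces (frontier (subdom D i)) (strata D i)) \<and>
     nodal_fe_basis (Omega D) (mesh D) (nodes D) (basis_fun D)"


section \<open>Nodes and forms\<close>

definition nodes_Gamma :: "'a::euclidean_space helmholtz_fem \<Rightarrow> 'a list" where
  "nodes_Gamma D = filter (\<lambda>x. x \<in> (\<Union>i<num_sub D. frontier (subdom D i))) (nodes D)"

definition nodes_I :: "'a::euclidean_space helmholtz_fem \<Rightarrow> 'a list" where
  "nodes_I D = filter (\<lambda>x. x \<in> (\<Union>i<num_sub D. subdom D i)) (nodes D)"

definition nodes_Gamma_loc :: "'a::euclidean_space helmholtz_fem \<Rightarrow> nat \<Rightarrow> 'a list" where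
  "nodes_Gamma_loc D i = filter (\<lambda>x. x \<in> frontier (subdom D i)) (nodes D)"

definition nodes_I_loc :: "'a::euclidean_space helmholtz_fem \<Rightarrow> nat \<Rightarrow> 'a list" where
  "nodes_I_loc D i = filter (\<lambda>x. x \<in> subdom D i) (nodes D)"

text \<open>The nodal vectors of \<open>V\<^sub>h\<close> are ordered as \<open>(u\<^sub>\<Gamma>, u\<^sub>I)\<close>.\<close>

definition nodes_all :: "'a::euclidean_space helmholtz_fem \<Rightarrow> 'a list" where
  "nodes_all D = nodes_Gamma D @ nodes_I D"

definition dim_Vh :: "'a::euclidean_space helmholtz_fem \<Rightarrow> nat" where
  "dim_Vh D = length (nodes_all D)"

definition fe_fun :: "'a::euclidean_space helmholtz_fem \<Rightarrow> complex Matrix.vec \<Rightarrow> 'a \<Rightarrow> complex" where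
  "fe_fun D u x = (\<Sum>l<dim_Vh D. u $ l * complex_of_real (basis_fun D (nodes_all D ! l) x))"

text \<open>
  \<open>\<nabla>u \<cdot> \<nabla>(cnj v)\<close>. A finite element function is differentiable in the interior of every element, hence
  almost everywhere, and its classical gradient there is its weak gradient.
\<close>

definition grad_prod ::
    "('a::euclidean_space \<Rightarrow> complex) \<Rightarrow> ('a \<Rightarrow> complex) \<Rightarrow> 'a \<Rightarrow> complex" where
  "grad_prod u v x =
     (\<Sum>e\<in>Basis. frechet_derivative u (at x) e * cnj (frechet_derivative v (at x) e))"

definition b_form ::
    "'a::euclidean_space helmholtz_fem \<Rightarrow> ('a \<Rightarrow> complex) \<Rightarrow> ('a \<Rightarrow> complex) \<Rightarrow> complex" where
  "b_form D u v =
     (LINT x:Omega D|lebesgue. grad_prod u v x)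
     - complex_of_real ((wavenumber D)\<^sup>2) * (LINT x:Omega D|lebesgue. u x * cnj (v x))
     + \<i> * complex_of_real (wavenumber D)
         * boundary_integral (Omega D) (frontier (Omega D)) (\<lambda>x. u x * cnj (v x))"

definition b_form_loc ::
    "'a::euclidean_space helmholtz_fem \<Rightarrow> nat \<Rightarrow> ('a \<Rightarrow> complex) \<Rightarrow> ('a \<Rightarrow> complex) \<Rightarrow> complex" where
  "b_form_loc D i u v =
     (LINT x:subdom D i|lebesgue.
        grad_prod u v x - complex_of_real ((wavenumber D)\<^sup>2) * (u x * cnj (v x)))
     + \<i> * complex_of_real (wavenumber D)
         * boundary_integral (Omega D) (frontier (subdom D i) \<inter> frontier (Omega D))
             (\<lambda>x. u x * cnj (v x))"

text \<open>The energy inner product over the region \<open>W\<close> (the domain or a subdomain).\<close>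

definition h_inner ::
    "'a::euclidean_space helmholtz_fem \<Rightarrow> 'a set \<Rightarrow> ('a \<Rightarrow> complex) \<Rightarrow> ('a \<Rightarrow> complex) \<Rightarrow> complex" where
  "h_inner D W u v =
     (LINT x:W|lebesgue. grad_prod u v x)
     + complex_of_real ((wavenumber D)\<^sup>2) * (LINT x:W|lebesgue. u x * cnj (v x))"

definition h_norm :: "'a::euclidean_space helmholtz_fem \<Rightarrow> ('a \<Rightarrow> complex) \<Rightarrow> real" where
  "h_norm D v =
     sqrt ((LINT x:Omega D|lebesgue. (\<Sum>e\<in>Basis. (cmod (frechet_derivative v (at x) e))\<^sup>2))
           + (wavenumber D)\<^sup>2 * (LINT x:Omega D|lebesgue. (cmod (v x))\<^sup>2))"

text \<open>
  Stated in the extended reals, where \<open>INF\<close> and \<open>SUP\<close> are always meaningful.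
\<close>

definition discrete_inf_sup :: "'a::euclidean_space helmholtz_fem \<Rightarrow> real \<Rightarrow> bool" where
  "discrete_inf_sup D \<gamma> \<longleftrightarrow>
     (INF u\<in>carrier_vec (dim_Vh D) - {0\<^sub>v (dim_Vh D)}.
        SUP v\<in>carrier_vec (dim_Vh D) - {0\<^sub>v (dim_Vh D)}.
          ereal (cmod (b_form D (fe_fun D u) (fe_fun D v))
                 / (h_norm D (fe_fun D u) * h_norm D (fe_fun D v)))) \<ge> ereal \<gamma>"


section \<open>Matrices\<close>

text \<open>
  The block, with rows \<open>xs\<close> and columns \<open>ys\<close>, of the matrix \<open>A\<close> with \<open>a(u,v) = v\<^sup>H A u\<close>.
\<close>

definition form_mat ::
    "'a::euclidean_space helmholtz_fem \<Rightarrow> (('a \<Rightarrow> complex) \<Rightarrow> ('a \<Rightarrow> complex) \<Rightarrow> complex)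
       \<Rightarrow> 'a list \<Rightarrow> 'a list \<Rightarrow> complex mat" where
  "form_mat D a xs ys =
     mat (length xs) (length ys)
       (\<lambda>(r, c). a (\<lambda>x. complex_of_real (basis_fun D (ys ! c) x))
                   (\<lambda>x. complex_of_real (basis_fun D (xs ! r) x)))"

text \<open>Restriction of nodal vectors from \<open>ys\<close> to \<open>xs\<close>; its transpose is extension by zero.\<close>

definition restr_mat :: "'a list \<Rightarrow> 'a list \<Rightarrow> complex mat" where
  "restr_mat xs ys = mat (length xs) (length ys) (\<lambda>(r, c). if xs ! r = ys ! c then 1 else 0)"

definition mat_sum :: "nat \<Rightarrow> nat \<Rightarrow> nat \<Rightarrow> (nat \<Rightarrow> complex mat) \<Rightarrow> complex mat" where
  "mat_sum nr nc N A = mat nr nc (\<lambda>rc. \<Sum>i<N. A i $$ rc)"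

definition inv_mat :: "complex mat \<Rightarrow> complex mat" where
  "inv_mat A = the (mat_inverse A)"

definition re_mat :: "complex mat \<Rightarrow> complex mat" where
  "re_mat = map_mat (\<lambda>z. complex_of_real (Re z))"

definition im_mat :: "complex mat \<Rightarrow> complex mat" where
  "im_mat = map_mat (\<lambda>z. complex_of_real (Im z))"

definition select_cols :: "(nat \<Rightarrow> bool) \<Rightarrow> complex mat \<Rightarrow> complex mat" where
  "select_cols P A = mat_of_cols (dim_row A) (map (col A) (filter P [0..<dim_col A]))"

text \<open>
  The columns of \<open>X\<close> form a full system of real eigenvectors of \<open>A x = \<lambda> M x\<close>, orthonormal with
  respect to \<open>M\<close>.
\<close>

definition real_eigensystem ::
    "complex mat \<Rightarrow> complex mat \<Rightarrow> (nat \<Rightarrow> real) \<Rightarrow> complex mat \<Rightarrow> bool" where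
  "real_eigensystem A M lam X \<longleftrightarrow>
     (let n = dim_row M in
       X \<in> carrier_mat n n \<and> elements_mat X \<subseteq> \<real> \<and>
       (\<forall>j<n. A *\<^sub>v col X j = complex_of_real (lam j) \<cdot>\<^sub>v (M *\<^sub>v col X j)) \<and>
       (\<forall>i<n. \<forall>j<n. col X i \<bullet> (M *\<^sub>v col X j) = (if i = j then 1 else 0)))"

definition B_mat :: "'a::euclidean_space helmholtz_fem \<Rightarrow> complex mat" where
  "B_mat D = form_mat D (b_form D) (nodes_all D) (nodes_all D)"

definition B_GG :: "'a::euclidean_space helmholtz_fem \<Rightarrow> nat \<Rightarrow> complex mat" where
  "B_GG D i = form_mat D (b_form_loc D i) (nodes_Gamma_loc D i) (nodes_Gamma_loc D i)"

definition B_GI :: "'a::euclidean_space helmholtz_fem \<Rightarrow> nat \<Rightarrow> complex mat" where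
  "B_GI D i = form_mat D (b_form_loc D i) (nodes_Gamma_loc D i) (nodes_I_loc D i)"

definition B_IG :: "'a::euclidean_space helmholtz_fem \<Rightarrow> nat \<Rightarrow> complex mat" where
  "B_IG D i = form_mat D (b_form_loc D i) (nodes_I_loc D i) (nodes_Gamma_loc D i)"

definition B_II :: "'a::euclidean_space helmholtz_fem \<Rightarrow> nat \<Rightarrow> complex mat" where
  "B_II D i = form_mat D (b_form_loc D i) (nodes_I_loc D i) (nodes_I_loc D i)"

definition H_GG :: "'a::euclidean_space helmholtz_fem \<Rightarrow> nat \<Rightarrow> complex mat" where
  "H_GG D i = form_mat D (h_inner D (subdom D i)) (nodes_Gamma_loc D i) (nodes_Gamma_loc D i)"

definition H_GI :: "'a::euclidean_space helmholtz_fem \<Rightarrow> nat \<Rightarrow> complex mat" where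
  "H_GI D i = form_mat D (h_inner D (subdom D i)) (nodes_Gamma_loc D i) (nodes_I_loc D i)"

definition H_IG :: "'a::euclidean_space helmholtz_fem \<Rightarrow> nat \<Rightarrow> complex mat" where
  "H_IG D i = form_mat D (h_inner D (subdom D i)) (nodes_I_loc D i) (nodes_Gamma_loc D i)"

definition H_II :: "'a::euclidean_space helmholtz_fem \<Rightarrow> nat \<Rightarrow> complex mat" where
  "H_II D i = form_mat D (h_inner D (subdom D i)) (nodes_I_loc D i) (nodes_I_loc D i)"


section \<open>Coarse space\<close>

text \<open>
  The thresholds and, for each subdomain, the eigenvalues and the eigenvector matrices of the
  interior problem (\<open>ev_int\<close>, \<open>X_int\<close>) and of the two steps of the spectral selection.
\<close>

record spectral_data =
  beta :: real
  ev_int :: "nat \<Rightarrow> nat \<Rightarrow> real"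
  X_int :: "nat \<Rightarrow> complex mat"
  eta :: real
  ev_one :: "nat \<Rightarrow> nat \<Rightarrow> real"
  X_one :: "nat \<Rightarrow> complex mat"
  ev_two :: "nat \<Rightarrow> nat \<Rightarrow> real"
  X_two :: "nat \<Rightarrow> complex mat"

definition Q_S :: "spectral_data \<Rightarrow> nat \<Rightarrow> complex mat" where
  "Q_S S i = select_cols (\<lambda>j. \<bar>ev_int S i j\<bar> < beta S) (X_int S i)"

definition Q_L :: "spectral_data \<Rightarrow> nat \<Rightarrow> complex mat" where
  "Q_L S i = select_cols (\<lambda>j. \<not> \<bar>ev_int S i j\<bar> < beta S) (X_int S i)"

definition k_loc :: "spectral_data \<Rightarrow> nat \<Rightarrow> nat" where
  "k_loc S i = dim_col (Q_S S i)"

definition B_i :: "'a::euclidean_space helmholtz_fem \<Rightarrow> spectral_data \<Rightarrow> nat \<Rightarrow> complex mat" where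
  "B_i D S i = (Q_L S i)\<^sup>T * B_II D i * Q_L S i"

definition B_L :: "'a::euclidean_space helmholtz_fem \<Rightarrow> spectral_data \<Rightarrow> nat \<Rightarrow> complex mat" where
  "B_L D S i = Q_L S i * inv_mat (B_i D S i) * (Q_L S i)\<^sup>T"

definition H_L :: "'a::euclidean_space helmholtz_fem \<Rightarrow> spectral_data \<Rightarrow> nat \<Rightarrow> complex mat" where
  "H_L D S i = Q_L S i * inv_mat ((Q_L S i)\<^sup>T * H_II D i * Q_L S i) * (Q_L S i)\<^sup>T"

text \<open>
  Vectors of \<open>V\<^sub>0\<close> are ordered as \<open>(u\<^sub>\<Gamma>, \<alpha>\<^sub>S\<^bsup>(0)\<^esup>, \<alpha>\<^sub>S\<^bsup>(1)\<^esup>, \<dots>)\<close>.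
\<close>

definition dim_alpha :: "'a::euclidean_space helmholtz_fem \<Rightarrow> spectral_data \<Rightarrow> nat" where
  "dim_alpha D S = (\<Sum>i<num_sub D. k_loc S i)"

definition dim_V0 :: "'a::euclidean_space helmholtz_fem \<Rightarrow> spectral_data \<Rightarrow> nat" where
  "dim_V0 D S = length (nodes_Gamma D) + dim_alpha D S"

definition R_S :: "'a::euclidean_space helmholtz_fem \<Rightarrow> spectral_data \<Rightarrow> nat \<Rightarrow> complex mat" where
  "R_S D S i =
     mat (k_loc S i) (dim_alpha D S) (\<lambda>(r, c). if c = (\<Sum>j<i. k_loc S j) + r then 1 else 0)"

definition R_Gamma :: "'a::euclidean_space helmholtz_fem \<Rightarrow> nat \<Rightarrow> complex mat" where
  "R_Gamma D i = restr_mat (nodes_Gamma_loc D i) (nodes_Gamma D)"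

definition R_I :: "'a::euclidean_space helmholtz_fem \<Rightarrow> nat \<Rightarrow> complex mat" where
  "R_I D i = restr_mat (nodes_I_loc D i) (nodes_I D)"

definition R_loc :: "'a::euclidean_space helmholtz_fem \<Rightarrow> nat \<Rightarrow> complex mat" where
  "R_loc D i = restr_mat (nodes_I_loc D i) (nodes_all D)"

definition R_GammaS :: "'a::euclidean_space helmholtz_fem \<Rightarrow> spectral_data \<Rightarrow> nat \<Rightarrow> complex mat" where
  "R_GammaS D S i =
     four_block_mat
       (R_Gamma D i)                                 (0\<^sub>m (length (nodes_Gamma_loc D i)) (dim_alpha D S))
       (0\<^sub>m (k_loc S i) (length (nodes_Gamma D)))  (R_S D S i)"

text \<open>The extension \<open>R\<^sub>0\<^sup>T : V\<^sub>0 \<rightarrow> V\<^sub>h\<close>; \<open>R\<^sub>0\<close> is its transpose.\<close>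

definition R0T :: "'a::euclidean_space helmholtz_fem \<Rightarrow> spectral_data \<Rightarrow> complex mat" where
  "R0T D S =
     (let nG = length (nodes_Gamma D); nI = length (nodes_I D) in
      four_block_mat
        (1\<^sub>m nG)
        (0\<^sub>m nG (dim_alpha D S))
        (mat_sum nI nG (num_sub D)
           (\<lambda>i. (R_I D i)\<^sup>T * (- (B_L D S i * B_IG D i * R_Gamma D i))))
        (mat_sum nI (dim_alpha D S) (num_sub D)
           (\<lambda>i. (R_I D i)\<^sup>T * (Q_S S i * R_S D S i))))"

definition B0_loc :: "'a::euclidean_space helmholtz_fem \<Rightarrow> spectral_data \<Rightarrow> nat \<Rightarrow> complex mat" where
  "B0_loc D S i =
     four_block_mat
       (B_GG D i - B_GI D i * B_L D S i * B_IG D i)  (B_GI D i * Q_S S i)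
       ((Q_S S i)\<^sup>T * B_IG D i)                 ((Q_S S i)\<^sup>T * B_II D i * Q_S S i)"

definition H_hat :: "'a::euclidean_space helmholtz_fem \<Rightarrow> spectral_data \<Rightarrow> nat \<Rightarrow> complex mat" where
  "H_hat D S i = H_GG D i - H_GI D i * H_L D S i * H_IG D i"

definition H0_loc :: "'a::euclidean_space helmholtz_fem \<Rightarrow> spectral_data \<Rightarrow> nat \<Rightarrow> complex mat" where
  "H0_loc D S i =
     four_block_mat
       (H_hat D S i)                 (H_GI D i * Q_S S i)
       ((Q_S S i)\<^sup>T * H_IG D i)  ((Q_S S i)\<^sup>T * H_II D i * Q_S S i)"

definition C_hat :: "'a::euclidean_space helmholtz_fem \<Rightarrow> spectral_data \<Rightarrow> nat \<Rightarrow> complex mat" where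
  "C_hat D S i =
     (let xs = nodes_Gamma_loc D i in
      mat (length xs) (length xs)
        (\<lambda>(r, c). if \<exists>F\<in>strata D i. xs ! r \<in> F \<and> xs ! c \<in> F then H_hat D S i $$ (r, c) else 0))"

definition C0_loc :: "'a::euclidean_space helmholtz_fem \<Rightarrow> spectral_data \<Rightarrow> nat \<Rightarrow> complex mat" where
  "C0_loc D S i =
     four_block_mat
       (C_hat D S i)                                    (0\<^sub>m (length (nodes_Gamma_loc D i)) (k_loc S i))
       (0\<^sub>m (k_loc S i) (length (nodes_Gamma_loc D i)))  ((Q_S S i)\<^sup>T * H_II D i * Q_S S i)"


section \<open>Spectral selection and preconditioner\<close>

definition outside :: "real \<Rightarrow> real \<Rightarrow> bool" where
  "outside \<eta> l \<longleftrightarrow> l < 1 - \<eta> \<or> l > 1 + \<eta>"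

definition Q_one :: "spectral_data \<Rightarrow> nat \<Rightarrow> complex mat" where
  "Q_one S i = select_cols (\<lambda>j. outside (eta S) (ev_one S i j)) (X_one S i)"

definition Q_one_perp :: "spectral_data \<Rightarrow> nat \<Rightarrow> complex mat" where
  "Q_one_perp S i = select_cols (\<lambda>j. \<not> outside (eta S) (ev_one S i j)) (X_one S i)"

definition Q_two :: "spectral_data \<Rightarrow> nat \<Rightarrow> complex mat" where
  "Q_two S i = Q_one_perp S i * select_cols (\<lambda>j. outside (eta S) (ev_two S i j)) (X_two S i)"

definition Q_Re :: "spectral_data \<Rightarrow> nat \<Rightarrow> complex mat" where
  "Q_Re S i = mat_of_cols (dim_row (Q_one S i)) (cols (Q_one S i) @ cols (Q_two S i))"

definition Pi_Re :: "'a::euclidean_space helmholtz_fem \<Rightarrow> spectral_data \<Rightarrow> nat \<Rightarrow> complex mat" where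
  "Pi_Re D S i = Q_Re S i * (Q_Re S i)\<^sup>T * H0_loc D S i"

definition spectral_setting :: "'a::euclidean_space helmholtz_fem \<Rightarrow> spectral_data \<Rightarrow> bool" where
  "spectral_setting D S \<longleftrightarrow>
     0 < beta S \<and> 0 < eta S \<and> eta S < 1 \<and>
     (\<forall>i<num_sub D.
        real_eigensystem (B_II D i) (H_II D i) (ev_int S i) (X_int S i) \<and>
        real_eigensystem (re_mat (B0_loc D S i)) (H0_loc D S i) (ev_one S i) (X_one S i) \<and>
        real_eigensystem
          ((Q_one_perp S i)\<^sup>T * C0_loc D S i * Q_one_perp S i)
          ((Q_one_perp S i)\<^sup>T * H0_loc D S i * Q_one_perp S i)
          (ev_two S i) (X_two S i))"

definition BP1_loc :: "'a::euclidean_space helmholtz_fem \<Rightarrow> spectral_data \<Rightarrow> nat \<Rightarrow> complex mat" where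
  "BP1_loc D S i =
     (let B0 = B0_loc D S i; E = 1\<^sub>m (dim_row B0) - Pi_Re D S i in
      re_mat B0 + \<i> \<cdot>\<^sub>m im_mat B0 - E\<^sup>T * re_mat B0 * E + E\<^sup>T * C0_loc D S i * E)"

definition BP1 :: "'a::euclidean_space helmholtz_fem \<Rightarrow> spectral_data \<Rightarrow> complex mat" where
  "BP1 D S =
     mat_sum (dim_V0 D S) (dim_V0 D S) (num_sub D)
       (\<lambda>i. (R_GammaS D S i)\<^sup>T * BP1_loc D S i * R_GammaS D S i)"

definition P1_inv :: "'a::euclidean_space helmholtz_fem \<Rightarrow> spectral_data \<Rightarrow> complex mat" where
  "P1_inv D S =
     R0T D S * inv_mat (BP1 D S) * (R0T D S)\<^sup>T
     + mat_sum (dim_Vh D) (dim_Vh D) (num_sub D)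
         (\<lambda>i. (R_loc D i)\<^sup>T * (Q_L S i * inv_mat (B_i D S i) * (Q_L S i)\<^sup>T) * R_loc D i)"

definition C_stab :: "real \<Rightarrow> real \<Rightarrow> real" where
  "C_stab \<eta> \<gamma>1 = 2 * \<eta> / \<gamma>1"

end

theory Submission
  imports Defs "Jordan_Normal_Form.Determinant"
begin

text \<open>
  Every \<open>v \<in> V\<^sub>h\<close> is \<open>R\<^sub>0\<^sup>T v\<^sub>0 + \<Sum>\<^sub>i R\<^sub>i\<^sup>T Q\<^sub>L\<^bsup>(i)\<^esup> c\<^sub>i\<close> with unique \<open>v\<^sub>0\<close>, \<open>c\<^sub>i\<close>; the two parts are \<open>b\<close>-orthogonal and the local
  solves of the preconditioner reproduce the second one. Hence \<open>P\<^sub>1\<^sup>-\<^sup>1 B v = v + R\<^sub>0\<^sup>T x\<close>, where \<open>x\<close> solves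
  \<open>B\<^sub>P\<^sub>1 x = (B\<^sub>0 - B\<^sub>P\<^sub>1) v\<^sub>0\<close>. On each subdomain the spectral selection makes \<open>B\<^sub>0 - B\<^sub>P\<^sub>1\<close> bounded by \<open>2\<eta>\<close> in the
  norm of \<open>H\<^sub>0\<close>, and \<open>H\<^sub>0\<close>, being a Schur complement, satisfies \<open>\<parallel>v\<^sub>0\<parallel> \<le> \<parallel>v\<parallel>\<close>. The inf-sup condition at
  \<open>R\<^sub>0\<^sup>T x\<close> then yields \<open>(\<gamma> - 2\<eta>) \<parallel>R\<^sub>0\<^sup>T x\<parallel> \<le> 2\<eta> \<parallel>v\<parallel>\<close>, and both estimates follow by the triangle and the
  Cauchy-Schwarz inequality. The same argument with \<open>v = 0\<close> shows that \<open>B\<^sub>P\<^sub>1\<close> is invertible.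
\<close>

section \<open>The surface measure of a hyperplane\<close>

text \<open>The constant 2 \<eta> is \<eta> counted twice: on the eigenvectors that neither
  selection step picks, both \<open>re_mat (B0_loc D S i)\<close> and \<open>C0_loc D S i\<close>
  are within \<eta> of \<open>H0_loc D S i\<close>, and only there does the preconditioner exchange
  the first for the second; the imaginary part is kept exactly. The inf-sup condition can be used
  without loss because b(R0 x, w) is given by the coarse matrices for every w in V_h, not only for w
  in the range of \<open>R0\<close>: the components of w along Q_L do not see an extended function.
  The forms are integrals, whereas the argument is linear algebra on nodal vectors. The bridge is
  additivity over the subdomains, delicate only for the boundary term, since a boundary point may
  lie in several closed subdomains. Definiteness of the matrices H is read off from their
  orthonormal eigensystems, and definiteness of the energy norm on V_h from the inf-sup
  condition.\<close>

lemma closest_point_hyperplane: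
  fixes a :: "'a::euclidean_space"
  assumes "a \<noteq> 0"
  shows "closest_point {x. inner a x = b} x = x - ((inner a x - b) / inner a a) *\<^sub>R a"
proof (rule closest_point_unique[symmetric])
  let ?y = "x - ((inner a x - b) / inner a a) *\<^sub>R a"
  show "convex {x. inner a x = b}" "closed {x. inner a x = b}"
    by (simp_all add: convex_hyperplane closed_hyperplane)
  have aa: "inner a a \<noteq> 0" using assms by simp
  show y: "?y \<in> {x. inner a x = b}" using aa by (simp add: inner_diff_right)
  show "\<forall>z\<in>{x. inner a x = b}. dist x ?y \<le> dist x z"
  proof
    fix z assume z: "z \<in> {x. inner a x = b}"
    have "dist x ?y = \<bar>inner a x - b\<bar> / norm a"
      using assms by (simp add: dist_norm power2_norm_eq_inner[symmetric] power2_eq_square)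
    also have "\<dots> = \<bar>inner a (x - z)\<bar> / norm a" using z by (simp add: inner_diff_right)
    \<comment> \<open>Cauchy-Schwarz: any move from x to the hyperplane is at least as long as its
      component along the normal, and the candidate point is reached by a move along the
      normal.\<close>
    also have "\<dots> \<le> norm a * norm (x - z) / norm a"
      by (intro divide_right_mono Cauchy_Schwarz_ineq2) simp
    also have "\<dots> = dist x z" using assms by (simp add: dist_norm)
    finally show "dist x ?y \<le> dist x z" .
  qed
qed

lemma sets_hyperplane_measure [simp, measurable_cong]:
  "sets (hyperplane_measure P) = sets (borel :: 'a::euclidean_space measure)"
  by (simp add: hyperplane_measure_def)

lemma closed_infdist_le: "closed {x. infdist x P \<le> r}"
  by (intro closed_Collect_le continuous_intros)

text \<open>The nearest-point map of a closed convex set is continuous, hence Borel, so the surface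
  measure of a Borel set is the volume of a Borel cylinder.\<close>

lemma emeasure_hyperplane_measure:
  fixes P :: "'a::euclidean_space set"
  assumes "convex P" "closed P" "P \<noteq> {}" "A \<in> sets borel"
  shows "emeasure (hyperplane_measure P) A =
    emeasure lborel (closest_point P -` A \<inter> {x. infdist x P \<le> 1/2})"
    and "closest_point P -` A \<inter> {x. infdist x P \<le> 1/2} \<in> sets borel"
proof -
  let ?C = "{x. infdist x P \<le> 1/2}"
  have C: "?C \<in> sets borel" by (intro borel_closed closed_infdist_le)
  have cp: "closest_point P \<in> borel_measurable borel"
    by (intro borel_measurable_continuous_onI continuous_on_closest_point assms)
  have m: "closest_point P \<in> measurable (restrict_space lborel ?C) borel"
    by (intro measurable_restrict_space1) (use cp in simp)
  show 1: "closest_point P -` A \<inter> ?C \<in> sets borel"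
    using measurable_sets[OF cp assms(4)] C by (auto intro!: sets.Int)
  show "emeasure (hyperplane_measure P) A = emeasure lborel (closest_point P -` A \<inter> ?C)"
    unfolding hyperplane_measure_def
    using assms(4) C 1 by (subst emeasure_distr[OF m])
      (simp_all add: space_restrict_space emeasure_restrict_space)
qed

text \<open>Every point of the cylinder lies within 1/2 of its projection, so a bounded base has a
  bounded cylinder. Compact parts of facets therefore have finite measure.\<close>

lemma emeasure_hyperplane_measure_bounded:
  fixes P :: "'a::euclidean_space set"
  assumes P: "convex P" "closed P" "P \<noteq> {}" and A: "A \<in> sets borel" "bounded A"
  shows "emeasure (hyperplane_measure P) A < \<infinity>"
proof -
  obtain r where r: "\<And>x. x \<in> A \<Longrightarrow> norm x \<le> r" using A(2) bounded_iff by blast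
  have "bounded (closest_point P -` A \<inter> {x. infdist x P \<le> 1/2})"
    unfolding bounded_iff
  proof (intro exI ballI)
    fix x assume x: "x \<in> closest_point P -` A \<inter> {x. infdist x P \<le> 1/2}"
    have "infdist x P = dist x (closest_point P x)"
      using P setdist_closest_point[of P x] by (simp add: infdist_eq_setdist)
    then have "norm (x - closest_point P x) \<le> 1/2" using x by (simp add: dist_norm)
    moreover have "norm x \<le> norm (x - closest_point P x) + norm (closest_point P x)"
      using norm_triangle_ineq[of "x - closest_point P x" "closest_point P x"] by simp
    ultimately show "norm x \<le> 1/2 + r" using r[of "closest_point P x"] x by auto
  qed
  then show ?thesis
    using emeasure_hyperplane_measure[OF P A(1)] emeasure_bounded_finite by auto
qed

text \<open>If A does not affinely span the hyperplane, the cylinder over A lies in a proper affine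
  subspace of the whole space, which is Lebesgue null.\<close>

lemma hyperplane_measure_null:
  fixes a :: "'a::euclidean_space"
  assumes a: "a \<noteq> 0" and A: "A \<in> sets borel" "A \<subseteq> {x. inner a x = b}"
    and ne: "affine hull A \<noteq> {x. inner a x = b}"
  shows "A \<in> null_sets (hyperplane_measure {x. inner a x = b})"
proof -
  let ?P = "{x. inner a x = b}" and ?f = "\<lambda>x. x - ((inner a x - b) / inner a a) *\<^sub>R a"
  have aa: "inner a a \<noteq> 0" using a by simp
  have "(b / inner a a) *\<^sub>R a \<in> ?P" using aa by simp
  then have P: "convex ?P" "closed ?P" "?P \<noteq> {}"
    by (auto simp: convex_hyperplane closed_hyperplane simp del: mem_Collect_eq)
  have hull: "affine hull A \<subseteq> ?P" using A(2) by (intro hull_minimal) (auto simp: affine_hyperplane)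
  then obtain p where p: "inner a p = b" "p \<notin> affine hull A" using ne by blast
  let ?S = "?f -` (affine hull A)"
  \<comment> \<open>The projection \<open>?f\<close> is an affine map, so the preimage of an affine
    set is affine; the point \<open>p\<close> keeps it from being the whole space.\<close>
  have "affine ?S"
  proof (intro affine_def[THEN iffD2] ballI allI impI)
    fix x y u v assume *: "x \<in> ?S" "y \<in> ?S" and uv: "u + v = (1::real)"
    have "?f (u *\<^sub>R x + v *\<^sub>R y) = u *\<^sub>R ?f x + v *\<^sub>R ?f y"
    proof -
      have "b = u * b + v * b" using uv by (metis distrib_right mult_1)
      then have "inner a (u *\<^sub>R x + v *\<^sub>R y) - b = u * (inner a x - b) + v * (inner a y - b)"
        by (simp add: inner_add_right algebra_simps)
      then have "(inner a (u *\<^sub>R x + v *\<^sub>R y) - b) / inner a a =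
          u * ((inner a x - b) / inner a a) + v * ((inner a y - b) / inner a a)"
        by (simp add: add_divide_distrib)
      then show ?thesis by (simp add: scaleR_add_left scaleR_diff_right)
    qed
    moreover have "u *\<^sub>R ?f x + v *\<^sub>R ?f y \<in> affine hull A"
      using * uv mem_affine[OF affine_affine_hull[of A]] by auto
    ultimately show "u *\<^sub>R x + v *\<^sub>R y \<in> ?S" by simp
  qed
  moreover have "p \<notin> ?S" using p by simp
  ultimately have "interior ?S = {}"
    using affine_hull_nonempty_interior[of ?S] by (metis UNIV_I hull_same)
  then have "negligible ?S" using \<open>affine ?S\<close> negligible_convex_interior affine_imp_convex by blast
  moreover have "closest_point ?P -` A \<subseteq> ?S"
    using hull_subset[of A affine] closest_point_hyperplane[OF a] by auto
  ultimately have "negligible (closest_point ?P -` A \<inter> {x. infdist x ?P \<le> 1/2})"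
    by (meson Int_lower1 negligible_subset)
  then have "emeasure lborel (closest_point ?P -` A \<inter> {x. infdist x ?P \<le> 1/2}) = 0"
    using emeasure_hyperplane_measure(2)[OF P A(1)]
    by (metis negligible_iff_null_sets null_setsD1 null_sets_completion_iff sets_lborel)
  then show ?thesis
    using emeasure_hyperplane_measure(1)[OF P A(1)] A(1) by (auto intro: null_setsI)
qed

lemma set_integrable_compact_finite_measure:
  fixes f :: "'a::euclidean_space \<Rightarrow> real"
  assumes M: "sets M = sets borel" and C: "compact C" "emeasure M C < \<infinity>"
    and f: "continuous_on C f"
  shows "set_integrable M C f"
proof -
  have Cb: "C \<in> sets borel" using C(1) by (simp add: borel_compact)
  obtain r where r: "\<And>x. x \<in> C \<Longrightarrow> norm (f x) \<le> r"
    using compact_imp_bounded[OF compact_continuous_image[OF f C(1)]] unfolding bounded_iff by auto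
  have "(\<lambda>x. indicator C x *\<^sub>R f x) \<in> borel_measurable borel"
    using borel_measurable_continuous_on_indicator[OF Cb f] .
  then have "(\<lambda>x. indicator C x *\<^sub>R f x) \<in> borel_measurable M"
    using M measurable_cong_sets by blast
  then show ?thesis unfolding set_integrable_def
    using M Cb C(2) r
    by (intro integrableI_bounded_set[where A=C and B=r]) (auto simp: indicator_def)
qed

section \<open>Polytopes on one side of a hyperplane\<close>

text \<open>Start at a relative interior point z of A and move slightly towards an interior point p
  of K. The new point x is interior to K. The ray from an interior point q of L through x meets the
  hyperplane at a point y near z, hence in A and in L, so x is interior to L as well.\<close>

lemma interior_Int_of_common_facet_part:
  fixes a :: "'a::euclidean_space"
  assumes a: "a \<noteq> 0" and K: "convex K" "interior K \<noteq> {}" "K \<subseteq> {x. inner a x \<le> b}"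
    and L: "convex L" "interior L \<noteq> {}" "L \<subseteq> {x. inner a x \<le> b}"
    and A: "convex A" "A \<subseteq> K \<inter> L" "affine hull A = {x. inner a x = b}"
  shows "interior K \<inter> interior L \<noteq> {}"
proof -
  let ?P = "{x. inner a x = b}"
  have "A \<noteq> {}" using A(3) hyperplane_eq_empty[of a b] a by auto
  then obtain z where z: "z \<in> rel_interior A"
    using A(1) rel_interior_eq_empty by blast
  then obtain e where e: "e > 0" "ball z e \<inter> ?P \<subseteq> A" and zA: "z \<in> A"
    unfolding mem_rel_interior_ball A(3) by auto
  have za: "inner a z = b" using zA hull_subset[of A affine] A(3) by auto
  obtain p q where p: "p \<in> interior K" and q: "q \<in> interior L" using K(2) L(2) by auto
  have "interior K \<subseteq> {x. inner a x < b}" "interior L \<subseteq> {x. inner a x < b}"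
    using interior_mono[OF K(3)] interior_mono[OF L(3)] interior_halfspace_le[OF a] by auto
  then have pq: "inner a p < b" "inner a q < b" using p q by auto
  \<comment> \<open>The ratio of the depths of p and q below the hyperplane: moving by the fraction
    t towards p and by the fraction t * r towards q gains the same depth.\<close>
  define r where "r = (b - inner a p) / (b - inner a q)"
  have r: "r > 0" using pq by (simp add: r_def)
  define m where "m = 1 + 2 * (norm (p - z) + r * norm (q - z))"
  have m: "m > 0" using r by (simp add: m_def add_nonneg_nonneg add_pos_nonneg)
  \<comment> \<open>The three bounds serve, in turn, the convex combination of z and p, the estimate
    1 / (1 - t * r) \<le> 2, and the distance of y from z, which is at most t * (m - 1) and hence
    less than e.\<close>
  define t where "t = Min {1, 1 / (2 * r), e / m}"
  have t01: "t > 0" "t \<le> 1" using e(1) r m unfolding t_def by auto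
  have "t \<le> 1 / (2 * r)" "t \<le> e / m" unfolding t_def by auto
  then have t: "t > 0" "t \<le> 1" "t * r \<le> 1/2" "t * m \<le> e"
    using t01 r m by (simp_all add: field_simps)
  define s where "s = t * r"
  have s: "s > 0" "s \<le> 1/2" using t r by (simp_all add: s_def)
  define x where "x = z + t *\<^sub>R (p - z)"
  \<comment> \<open>The solution of x = y + s (q - y); by the choice of s it lies on the
    hyperplane.\<close>
  define y where "y = z + (1 / (1 - s)) *\<^sub>R (t *\<^sub>R (p - z) - s *\<^sub>R (q - z))"
  have xy: "x = y + s *\<^sub>R (q - y)"
  proof -
    have "(1 - s) *\<^sub>R y = (1 - s) *\<^sub>R z + (t *\<^sub>R (p - z) - s *\<^sub>R (q - z))"
      using s by (simp add: y_def scaleR_add_right)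
    then show ?thesis unfolding x_def by (simp add: algebra_simps)
  qed
  have "t * (inner a p - b) = s * (inner a q - b)"
    using pq unfolding s_def r_def by (simp add: field_simps)
  then have yP: "inner a y = b"
    by (simp add: y_def inner_add_right inner_diff_right za)
  have "norm (y - z) = (1 / (1 - s)) * norm (t *\<^sub>R (p - z) - s *\<^sub>R (q - z))"
    using s by (simp add: y_def)
  also have "\<dots> \<le> 2 * (t * norm (p - z) + s * norm (q - z))"
  proof (rule mult_mono)
    show "norm (t *\<^sub>R (p - z) - s *\<^sub>R (q - z)) \<le> t * norm (p - z) + s * norm (q - z)"
      using s t(1) norm_triangle_ineq4[of "t *\<^sub>R (p - z)" "s *\<^sub>R (q - z)"] by simp
  qed (use s in \<open>auto simp: field_simps\<close>)
  also have "\<dots> = t * (m - 1)" by (simp add: m_def s_def algebra_simps)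
  also have "\<dots> < e" using t by (simp add: algebra_simps)
  finally have "y \<in> ball z e" by (simp add: dist_norm norm_minus_commute)
  then have yA: "y \<in> A" using e(2) yP by auto
  have "x \<in> interior K"
    using mem_interior_convex_shrink[OF K(1) p, of z t] zA A(2) t
    by (simp add: x_def algebra_simps subset_iff)
  moreover have "x \<in> interior L"
    using mem_interior_convex_shrink[OF L(1) q, of y s] yA A(2) s
    by (simp add: xy algebra_simps subset_iff)
  ultimately show ?thesis by blast
qed

text \<open>Nonempty interior gives S full dimension, so a facet has the dimension of its supporting
  hyperplane and spans all of it.\<close>

lemma facet_of_hyperplane:
  fixes S :: "'a::euclidean_space set"
  assumes S: "polyhedron S" "interior S \<noteq> {}" and F: "F facet_of S"
  obtains a b where "a \<noteq> 0" "S \<subseteq> {x. inner a x \<le> b}" "F = S \<inter> {x. inner a x = b}"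
    "affine hull F = {x. inner a x = b}"
proof -
  obtain a b where ab: "a \<noteq> 0" "S \<subseteq> {x. inner a x \<le> b}" "F = S \<inter> {x. inner a x = b}"
    using facet_of_polyhedron[OF S(1) F] by blast
  have "affine hull F = {x. inner a x = b}"
  proof (rule affine_dim_equal)
    show "affine hull F \<noteq> {}" using F by (auto simp: facet_of_def)
    show "affine hull F \<subseteq> {x. inner a x = b}"
      using ab by (intro hull_minimal) (auto simp: affine_hyperplane)
    show "aff_dim (affine hull F) = aff_dim {x. inner a x = b}"
      using F ab(1) S(2) by (simp add: facet_of_def aff_dim_nonempty_interior)
  qed (auto simp: affine_hyperplane)
  with ab that show thesis by blast
qed

section \<open>Finite element functions\<close>

text \<open>Coefficients are indexed by nodes and not by positions, so that one coefficient function
  serves the global and all local orderings of the nodes.\<close>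

definition nodal_comb :: "'a::euclidean_space helmholtz_fem \<Rightarrow> ('a \<Rightarrow> complex) \<Rightarrow> 'a \<Rightarrow> complex" where
  "nodal_comb D c x = (\<Sum>y\<in>set (nodes_all D). c y * complex_of_real (basis_fun D y x))"

definition basis_grad_prod :: "'a::euclidean_space helmholtz_fem \<Rightarrow> 'a \<Rightarrow> 'a \<Rightarrow> 'a \<Rightarrow> real" where
  "basis_grad_prod D y z x = (\<Sum>e\<in>Basis. frechet_derivative (basis_fun D y) (at x) e *
     frechet_derivative (basis_fun D z) (at x) e)"

definition stiffness :: "'a::euclidean_space helmholtz_fem \<Rightarrow> 'a set \<Rightarrow> 'a \<Rightarrow> 'a \<Rightarrow> real" where
  "stiffness D W y z = (LINT x:W|lebesgue. basis_grad_prod D y z x)"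

definition mass :: "'a::euclidean_space helmholtz_fem \<Rightarrow> 'a set \<Rightarrow> 'a \<Rightarrow> 'a \<Rightarrow> real" where
  "mass D W y z = (LINT x:W|lebesgue. basis_fun D y x * basis_fun D z x)"

definition boundary_mass :: "'a::euclidean_space helmholtz_fem \<Rightarrow> 'a set \<Rightarrow> 'a \<Rightarrow> 'a \<Rightarrow> real" where
  "boundary_mass D S y z = (\<Sum>F\<in>{F. F facet_of closure (Omega D)}.
     LINT x:F \<inter> S|hyperplane_measure (affine hull F). basis_fun D y x * basis_fun D z x)"

text \<open>Region W and boundary part S are separate parameters, so the matrix of the global form
  and those of the local forms are instances of one formula. Since the basis is real, the result is
  complex symmetric, not Hermitian.\<close>

definition b_entry :: "'a::euclidean_space helmholtz_fem \<Rightarrow> 'a set \<Rightarrow> 'a set \<Rightarrow> 'a \<Rightarrow> 'a \<Rightarrow> complex" where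
  "b_entry D W S y z =
     complex_of_real (stiffness D W y z - (wavenumber D)\<^sup>2 * mass D W y z)
     + \<i> * complex_of_real (wavenumber D * boundary_mass D S y z)"

definition h_entry :: "'a::euclidean_space helmholtz_fem \<Rightarrow> 'a set \<Rightarrow> 'a \<Rightarrow> 'a \<Rightarrow> complex" where
  "h_entry D W y z = complex_of_real (stiffness D W y z + (wavenumber D)\<^sup>2 * mass D W y z)"

lemma basis_grad_prod_commute: "basis_grad_prod D y z x = basis_grad_prod D z y x"
  by (simp add: basis_grad_prod_def mult.commute)

lemma b_entry_commute: "b_entry D W S y z = b_entry D W S z y"
  by (simp add: b_entry_def stiffness_def mass_def boundary_mass_def
      basis_grad_prod_commute[of D y] mult.commute[of "basis_fun D y _"])

lemma h_entry_commute: "h_entry D W y z = h_entry D W z y"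
  by (simp add: h_entry_def stiffness_def mass_def
      basis_grad_prod_commute[of D y] mult.commute[of "basis_fun D y _"])

lemma set_integral_finite_combination:
  fixes q :: "'b \<Rightarrow> 'b \<Rightarrow> 'a \<Rightarrow> real" and c :: "'b \<Rightarrow> 'b \<Rightarrow> complex"
  assumes "\<And>y z. y \<in> Y \<Longrightarrow> z \<in> Y \<Longrightarrow> set_integrable M A (q y z)"
  shows "set_integrable M A (\<lambda>x. \<Sum>y\<in>Y. \<Sum>z\<in>Y. c y z * complex_of_real (q y z x))"
    and "(LINT x:A|M. (\<Sum>y\<in>Y. \<Sum>z\<in>Y. c y z * complex_of_real (q y z x))) =
      (\<Sum>y\<in>Y. \<Sum>z\<in>Y. c y z * complex_of_real (LINT x:A|M. q y z x))"
proof -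
  have eq: "(\<lambda>x. indicator A x *\<^sub>R (\<Sum>y\<in>Y. \<Sum>z\<in>Y. c y z * complex_of_real (q y z x))) =
      (\<lambda>x. \<Sum>y\<in>Y. \<Sum>z\<in>Y. c y z * complex_of_real (indicator A x *\<^sub>R q y z x))"
    by (simp add: sum_distrib_left scaleR_conv_of_real algebra_simps)
  have i: "integrable M (\<lambda>x. c y z * complex_of_real (indicator A x *\<^sub>R q y z x))"
    if "y \<in> Y" "z \<in> Y" for y z
    using assms[OF that] unfolding set_integrable_def
    by (intro integrable_mult_right integrable_of_real)
  show "set_integrable M A (\<lambda>x. \<Sum>y\<in>Y. \<Sum>z\<in>Y. c y z * complex_of_real (q y z x))"
    unfolding set_integrable_def eq
    by (intro Bochner_Integration.integrable_sum i)
  have "(LINT x:A|M. (\<Sum>y\<in>Y. \<Sum>z\<in>Y. c y z * complex_of_real (q y z x))) =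
      (\<Sum>y\<in>Y. (LINT x|M. (\<Sum>z\<in>Y. c y z * complex_of_real (indicator A x *\<^sub>R q y z x))))"
    unfolding set_lebesgue_integral_def eq
    by (intro Bochner_Integration.integral_sum Bochner_Integration.integrable_sum i)
  also have "\<dots> = (\<Sum>y\<in>Y. \<Sum>z\<in>Y. (LINT x|M. c y z * complex_of_real (indicator A x *\<^sub>R q y z x)))"
    by (intro sum.cong refl Bochner_Integration.integral_sum i)
  also have "\<dots> = (\<Sum>y\<in>Y. \<Sum>z\<in>Y. c y z * complex_of_real (LINT x:A|M. q y z x))"
    unfolding set_lebesgue_integral_def
    by (simp only: integral_mult_right_zero integral_complex_of_real)
  finally show "(LINT x:A|M. (\<Sum>y\<in>Y. \<Sum>z\<in>Y. c y z * complex_of_real (q y z x))) =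
      (\<Sum>y\<in>Y. \<Sum>z\<in>Y. c y z * complex_of_real (LINT x:A|M. q y z x))" .
qed

text \<open>Gradients of finite element functions are given by the elementwise formula only off a
  null set, so integrands have to be exchanged modulo null sets.\<close>

lemma set_integral_lebesgue_spike:
  fixes f g :: "'a::euclidean_space \<Rightarrow> complex"
  assumes "set_integrable lebesgue W f" "negligible Z" "\<And>x. x \<in> W - Z \<Longrightarrow> g x = f x"
  shows "set_integrable lebesgue W g" "set_lebesgue_integral lebesgue W g = set_lebesgue_integral lebesgue W f"
proof -
  show g: "set_integrable lebesgue W g"
    using absolutely_integrable_spike[OF assms] .
  show "set_lebesgue_integral lebesgue W g = set_lebesgue_integral lebesgue W f"
    unfolding set_lebesgue_integral_eq_integral(2)[OF g] set_lebesgue_integral_eq_integral(2)[OF assms(1)]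
    by (rule integral_spike[OF assms(2)]) (simp add: assms(3))
qed

lemma set_integrable_lebesgue_compact:
  fixes f :: "'a::euclidean_space \<Rightarrow> real"
  assumes "compact S" "continuous_on S f"
  shows "set_integrable lebesgue S f"
  using borel_integrable_compact[OF assms] unfolding set_integrable_def
  by (intro integrable_completion[THEN iffD2]) (auto simp: borel_measurable_integrable)

lemma of_real_grad_prod_self:
  "grad_prod v v = (\<lambda>x. complex_of_real (\<Sum>e\<in>Basis. (cmod (frechet_derivative v (at x) e))\<^sup>2))"
  by (rule ext) (simp add: grad_prod_def complex_norm_square del: of_real_power)

lemma h_inner_self: "h_inner D (Omega D) v v = complex_of_real ((h_norm D v)\<^sup>2)"
proof -
  have "h_inner D (Omega D) v v = complex_of_real
     ((LINT x:Omega D|lebesgue. (\<Sum>e\<in>Basis. (cmod (frechet_derivative v (at x) e))\<^sup>2))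
           + (wavenumber D)\<^sup>2 * (LINT x:Omega D|lebesgue. (cmod (v x))\<^sup>2))"
    unfolding h_inner_def of_real_grad_prod_self
    by (simp only: complex_norm_square[symmetric] set_integral_complex_of_real of_real_add of_real_mult)
  moreover have "0 \<le> (LINT x:Omega D|lebesgue. (\<Sum>e\<in>Basis. (cmod (frechet_derivative v (at x) e))\<^sup>2))
           + (wavenumber D)\<^sup>2 * (LINT x:Omega D|lebesgue. (cmod (v x))\<^sup>2)"
    unfolding set_lebesgue_integral_def
    by (intro add_nonneg_nonneg mult_nonneg_nonneg Bochner_Integration.integral_nonneg) (auto intro!: mult_nonneg_nonneg sum_nonneg)
  ultimately show ?thesis by (simp add: h_norm_def)
qed

lemma h_norm_nonneg: "0 \<le> h_norm D v"
  unfolding h_norm_def set_lebesgue_integral_def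
  by (intro real_sqrt_ge_zero add_nonneg_nonneg mult_nonneg_nonneg Bochner_Integration.integral_nonneg)
    (auto intro!: mult_nonneg_nonneg sum_nonneg)

section \<open>Geometry of mesh and subdomains, and smoothness of the basis off the skeleton\<close>

locale helmholtz =
  fixes D :: "'a::euclidean_space helmholtz_fem" and h \<sigma> :: real
  assumes setting: "helmholtz_setting D h \<sigma>"
begin

abbreviation "\<Omega> \<equiv> Omega D"
abbreviation "sub \<equiv> subdom D"
abbreviation "N \<equiv> num_sub D"
abbreviation "\<phi> \<equiv> basis_fun D"
abbreviation "Y \<equiv> set (nodes_all D)"
abbreviation "fe \<equiv> nodal_comb D"
abbreviation "\<phi>c y \<equiv> \<lambda>x. complex_of_real (\<phi> y x)"

abbreviation "b_sub i \<equiv> b_entry D (sub i) (frontier (sub i) \<inter> frontier \<Omega>)"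
abbreviation "h_sub i \<equiv> h_entry D (sub i)"
abbreviation "\<mu> F \<equiv> hyperplane_measure (affine hull F)"

definition elems :: "nat \<Rightarrow> 'a set set" where
  "elems i = {K \<in> mesh D. K \<subseteq> closure (sub i)}"

text \<open>The one exceptional null set: off it, every point of \<Omega> is interior to an element
  and lies in an open subdomain, and all basis functions are differentiable there.\<close>

definition skeleton :: "'a set" where
  "skeleton = (\<Union>K\<in>mesh D. frontier K)"

lemma domain: "open \<Omega>" "\<Omega> \<noteq> {}" "bounded \<Omega>" "convex \<Omega>" "polytope (closure \<Omega>)"
  using setting by (auto simp: helmholtz_setting_def convex_polytopal_domain_def)

lemma mesh: "finite (mesh D)" "\<Union>(mesh D) = closure \<Omega>"
  and element: "K \<in> mesh D \<Longrightarrow> polytope K" "K \<in> mesh D \<Longrightarrow> interior K \<noteq> {}"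
  using setting by (auto simp: helmholtz_setting_def shape_regular_mesh_def)

lemma element': assumes "K \<in> mesh D" shows "compact K" "convex K" "closed K"
  using element(1)[OF assms] by (auto simp: polytope_imp_compact polytope_imp_convex polytope_imp_closed)

lemma subdomains: "closure \<Omega> = (\<Union>i<N. closure (sub i))"
  and subdomain_disjoint: "i < N \<Longrightarrow> j < N \<Longrightarrow> i \<noteq> j \<Longrightarrow> sub i \<inter> sub j = {}"
  and subdomain_regular: "i < N \<Longrightarrow> sub i = interior (closure (sub i))"
  using setting unfolding helmholtz_setting_def subdomain_decomposition_def by blast+

lemma closure_subdomain:
  assumes "i < N" shows "closure (sub i) = \<Union>(elems i)"
proof -
  obtain \<K> where "\<K> \<subseteq> mesh D" "closure (sub i) = \<Union>\<K>"
    using setting assms unfolding helmholtz_setting_def subdomain_decomposition_def by metis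
  then show ?thesis unfolding elems_def by blast
qed

lemma in_element:
  assumes "i < N" "x \<in> closure (sub i)"
  obtains K where "K \<in> elems i" "K \<in> mesh D" "x \<in> K" "K \<subseteq> closure (sub i)"
proof -
  have "x \<in> \<Union>(elems i)" using closure_subdomain[OF assms(1)] assms(2) by simp
  then show thesis using that unfolding elems_def by blast
qed

lemma open_subdomain: assumes "i < N" shows "open (sub i)"
  by (subst subdomain_regular[OF assms]) simp

lemma interior_closure_Omega: "interior (closure \<Omega>) = \<Omega>"
  using convex_interior_closure[OF domain(4)] domain(1) by (simp add: interior_open)

text \<open>Both \<open>sub i\<close> and \<Omega> are the interiors of their closures, so the
  inclusion of the closures suffices.\<close>

lemma subdomain_subset: assumes "i < N" shows "sub i \<subseteq> \<Omega>"
proof -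
  have "interior (closure (sub i)) \<subseteq> interior (closure \<Omega>)"
    using subdomains assms by (intro interior_mono) auto
  then show ?thesis using subdomain_regular[OF assms, symmetric] interior_closure_Omega by simp
qed

lemma subdomain_Int_closure:
  assumes "i < N" "j < N" "i \<noteq> j" shows "sub i \<inter> closure (sub j) = {}"
  using open_Int_closure_eq_empty[OF open_subdomain[OF assms(1)]] subdomain_disjoint assms by blast

lemma fe_basis: "nodal_fe_basis \<Omega> (mesh D) (nodes D) \<phi>"
  using setting by (simp add: helmholtz_setting_def)

lemma nodes: "distinct (nodes D)" "set (nodes D) \<subseteq> closure \<Omega>"
  using fe_basis by (simp_all add: nodal_fe_basis_def)

lemma basis_continuous: "y \<in> set (nodes D) \<Longrightarrow> continuous_on (closure \<Omega>) (\<phi> y)"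
  using fe_basis by (simp add: nodal_fe_basis_def)

lemma basis_vanishes:
  assumes "y \<in> set (nodes D)" "K \<in> mesh D" "F face_of K" "y \<notin> F" "x \<in> F"
  shows "\<phi> y x = 0"
proof -
  have "\<forall>y\<in>set (nodes D). \<forall>K\<in>mesh D. \<forall>F. F face_of K \<longrightarrow> y \<notin> F \<longrightarrow> (\<forall>x\<in>F. \<phi> y x = 0)"
    using fe_basis unfolding nodal_fe_basis_def by (elim conjE)
  then show ?thesis using assms by blast
qed

lemma basis_smooth:
  assumes "y \<in> set (nodes D)" "K \<in> mesh D"
  shows "\<exists>g (g' :: 'a \<Rightarrow> 'a \<Rightarrow>\<^sub>L real).
         (\<forall>x\<in>K. \<phi> y x = g x) \<and>
         (\<forall>x. (g has_derivative blinfun_apply (g' x)) (at x)) \<and> continuous_on UNIV g'"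
proof -
  have "\<forall>y\<in>set (nodes D). \<forall>K\<in>mesh D. \<exists>g (g' :: 'a \<Rightarrow> 'a \<Rightarrow>\<^sub>L real).
         (\<forall>x\<in>K. \<phi> y x = g x) \<and>
         (\<forall>x. (g has_derivative blinfun_apply (g' x)) (at x)) \<and> continuous_on UNIV g'"
    using fe_basis unfolding nodal_fe_basis_def by (elim conjE)
  then show ?thesis using assms by simp
qed

lemma Y_subset: "Y \<subseteq> set (nodes D)"
  by (auto simp: nodes_all_def nodes_Gamma_def nodes_I_def)

lemma negligible_skeleton: "negligible skeleton"
  unfolding skeleton_def using mesh(1) element'(2)
  by (intro negligible_Union) (auto intro: negligible_convex_frontier)

lemma in_interior_element:
  assumes "x \<in> \<Omega> - skeleton" obtains K where "K \<in> mesh D" "x \<in> interior K"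
proof -
  have "x \<in> \<Union>(mesh D)" using assms closure_subset mesh(2) by blast
  then obtain K where K: "K \<in> mesh D" "x \<in> K" by blast
  then have "x \<in> interior K"
    using assms element'(3)[OF K(1)] by (auto simp: skeleton_def frontier_def)
  with K that show thesis by blast
qed

text \<open>A frontier point lies in an element K of the closed subdomain but not in its interior,
  since \<open>interior K\<close> is contained in \<open>interior (closure (sub i))\<close>, which
  is \<open>sub i\<close>.\<close>

lemma frontier_subdomain:
  assumes "i < N" shows "frontier (sub i) \<subseteq> skeleton"
proof
  fix x assume x: "x \<in> frontier (sub i)"
  then have "x \<in> closure (sub i)" "x \<notin> sub i"
    using open_subdomain[OF assms] by (auto simp: frontier_def interior_open)
  then obtain K where K: "K \<in> mesh D" "x \<in> K" "K \<subseteq> closure (sub i)"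
    using in_element[OF assms] by blast
  then have "x \<notin> interior K"
    using \<open>x \<notin> sub i\<close> interior_mono[OF K(3)] subdomain_regular[OF assms, symmetric] by auto
  then show "x \<in> skeleton" using K closure_subset by (auto simp: skeleton_def frontier_def)
qed

lemma Omega_minus_skeleton: "\<Omega> - skeleton \<subseteq> (\<Union>i<N. sub i)"
proof
  fix x assume x: "x \<in> \<Omega> - skeleton"
  then have "x \<in> (\<Union>i<N. closure (sub i))" using subdomains closure_subset by blast
  then obtain i where i: "i < N" "x \<in> closure (sub i)" by blast
  then have "x \<notin> frontier (sub i)" using frontier_subdomain x by blast
  then have "x \<in> sub i" using i open_subdomain by (simp add: frontier_def interior_open)
  with i show "x \<in> (\<Union>i<N. sub i)" by blast
qed

lemma basis_derivative:
  assumes "y \<in> set (nodes D)" "x \<in> \<Omega> - skeleton"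
  shows "(\<phi> y has_derivative frechet_derivative (\<phi> y) (at x)) (at x)"
proof -
  obtain K where K: "K \<in> mesh D" "x \<in> interior K" using in_interior_element assms(2) by blast
  obtain g g' where g: "\<And>x. x \<in> K \<Longrightarrow> \<phi> y x = g x"
      "(g has_derivative blinfun_apply (g' x)) (at x)"
    using basis_smooth[OF assms(1) K(1)] by blast
  have "(\<phi> y has_derivative blinfun_apply (g' x)) (at x)"
    using g interior_subset[of K]
    by (intro has_derivative_transform_within_open[OF g(2) open_interior K(2)]) auto
  then show ?thesis using frechet_derivative_at by metis
qed

text \<open>The derivative in the interior of an element extends continuously to the compact
  element, which makes it bounded and integrable.\<close>

lemma basis_derivative_element:
  assumes y: "y \<in> set (nodes D)" and K: "K \<in> mesh D"
  obtains G where "\<And>e. continuous_on UNIV (G e)"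
    "\<And>x e. x \<in> interior K \<Longrightarrow> frechet_derivative (\<phi> y) (at x) e = G e x"
proof -
  obtain g and g' :: "'a \<Rightarrow> 'a \<Rightarrow>\<^sub>L real" where g: "\<And>x. x \<in> K \<Longrightarrow> \<phi> y x = g x"
      "\<And>x. (g has_derivative blinfun_apply (g' x)) (at x)" "continuous_on UNIV g'"
    using basis_smooth[OF assms] by blast
  have "frechet_derivative (\<phi> y) (at x) e = g' x e" if x: "x \<in> interior K" for x e
  proof -
    have "(\<phi> y has_derivative blinfun_apply (g' x)) (at x)"
      using g(1) interior_subset[of K]
      by (intro has_derivative_transform_within_open[OF g(2) open_interior x]) auto
    then show ?thesis using frechet_derivative_at by metis
  qed
  moreover have "continuous_on UNIV (\<lambda>x. g' x e)" for e
    using g(3) by (intro continuous_intros)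
  ultimately show thesis using that[of "\<lambda>e x. g' x e"] by blast
qed

text \<open>On each element interior the integrand agrees with a continuous function on the compact
  element, and the finitely many interiors exhaust \<Omega> up to the skeleton.\<close>

lemma set_integrable_basis_grad_prod:
  assumes y: "y \<in> set (nodes D)" and z: "z \<in> set (nodes D)"
  shows "set_integrable lebesgue \<Omega> (basis_grad_prod D y z)"
proof -
  have K: "set_integrable lebesgue (interior K) (basis_grad_prod D y z)" if K: "K \<in> mesh D" for K
  proof -
    obtain G where G: "\<And>e. continuous_on UNIV (G e)"
      "\<And>x e. x \<in> interior K \<Longrightarrow> frechet_derivative (\<phi> y) (at x) e = G e x"
      using basis_derivative_element[OF y K] by blast
    obtain H where H: "\<And>e. continuous_on UNIV (H e)"
      "\<And>x e. x \<in> interior K \<Longrightarrow> frechet_derivative (\<phi> z) (at x) e = H e x"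
      using basis_derivative_element[OF z K] by blast
    have "continuous_on K (\<lambda>x. \<Sum>e\<in>Basis. G e x * H e x)"
      by (intro continuous_intros continuous_on_subset[OF G(1)] continuous_on_subset[OF H(1)]) auto
    then have "set_integrable lebesgue K (\<lambda>x. \<Sum>e\<in>Basis. G e x * H e x)"
      using set_integrable_lebesgue_compact element'[OF K] by blast
    then have "set_integrable lebesgue (interior K) (\<lambda>x. \<Sum>e\<in>Basis. G e x * H e x)"
      by (rule set_integrable_subset) (auto simp: interior_subset)
    moreover have "set_integrable lebesgue (interior K) (\<lambda>x. \<Sum>e\<in>Basis. G e x * H e x) =
        set_integrable lebesgue (interior K) (basis_grad_prod D y z)"
      by (intro set_integrable_cong refl) (simp add: basis_grad_prod_def G(2) H(2))
    ultimately show ?thesis by simp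
  qed
  have "set_integrable lebesgue (\<Union>K\<in>mesh D. interior K) (basis_grad_prod D y z)"
    using mesh(1) K by (intro set_integrable_UN) auto
  moreover have o: "open (\<Omega> \<inter> (\<Union>K\<in>mesh D. interior K))" using domain(1) by auto
  ultimately have *: "set_integrable lebesgue (\<Omega> \<inter> (\<Union>K\<in>mesh D. interior K)) (basis_grad_prod D y z)"
    by (elim set_integrable_subset) (use borel_open[OF o] in auto)
  have "negligible (\<Omega> - (\<Union>K\<in>mesh D. interior K))"
    using in_interior_element by (intro negligible_subset[OF negligible_skeleton]) blast
  then have "negligible {x \<in> \<Omega> - \<Omega> \<inter> (\<Union>K\<in>mesh D. interior K). basis_grad_prod D y z x \<noteq> 0}"
    by (rule negligible_subset) blast
  moreover have "{x \<in> \<Omega> \<inter> (\<Union>K\<in>mesh D. interior K) - \<Omega>. basis_grad_prod D y z x \<noteq> 0} = {}" by blast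
  ultimately show ?thesis
    by (intro absolutely_integrable_spike_set[OF *]) (simp_all only: negligible_empty)
qed

lemma set_integrable_basis_prod:
  assumes y: "y \<in> set (nodes D)" and z: "z \<in> set (nodes D)"
  shows "set_integrable lebesgue \<Omega> (\<lambda>x. \<phi> y x * \<phi> z x)"
proof (rule set_integrable_subset)
  show "set_integrable lebesgue (closure \<Omega>) (\<lambda>x. \<phi> y x * \<phi> z x)"
    using domain(3) basis_continuous[OF y] basis_continuous[OF z]
    by (intro set_integrable_lebesgue_compact continuous_on_mult) (simp_all only: compact_closure)
  show "\<Omega> \<in> sets lebesgue" using borel_open[OF domain(1)] by auto
qed (rule closure_subset)

lemma nodal_comb_derivative:
  assumes "x \<in> \<Omega> - skeleton"
  shows "frechet_derivative (fe c) (at x) e =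
    (\<Sum>y\<in>Y. c y * complex_of_real (frechet_derivative (\<phi> y) (at x) e))"
proof -
  have "(fe c has_derivative
     (\<lambda>e. \<Sum>y\<in>Y. c y * complex_of_real (frechet_derivative (\<phi> y) (at x) e))) (at x)"
    unfolding nodal_comb_def[abs_def]
  proof (rule has_derivative_sum)
    fix y assume "y \<in> Y"
    then have "(\<phi> y has_derivative frechet_derivative (\<phi> y) (at x)) (at x)"
      using basis_derivative[OF _ assms] Y_subset by blast
    then show "((\<lambda>x. c y * complex_of_real (\<phi> y x)) has_derivative
        (\<lambda>e. c y * complex_of_real (frechet_derivative (\<phi> y) (at x) e))) (at x)"
      by (rule has_derivative_mult_right[OF has_derivative_of_real])
  qed
  then show ?thesis by (rule fun_cong[OF frechet_derivative_at, symmetric])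
qed

lemma grad_prod_nodal_comb:
  assumes "x \<in> \<Omega> - skeleton"
  shows "grad_prod (fe c) (fe d) x =
    (\<Sum>y\<in>Y. \<Sum>z\<in>Y. c y * cnj (d z) * complex_of_real (basis_grad_prod D y z x))"
proof -
  have "grad_prod (fe c) (fe d) x = (\<Sum>e\<in>Basis. \<Sum>y\<in>Y. \<Sum>z\<in>Y.
     c y * cnj (d z) * complex_of_real (frechet_derivative (\<phi> y) (at x) e * frechet_derivative (\<phi> z) (at x) e))"
    unfolding grad_prod_def nodal_comb_derivative[OF assms] cnj_sum sum_product
    by (simp only: complex_cnj_mult complex_cnj_complex_of_real of_real_mult mult_ac)
  also have "\<dots> = (\<Sum>y\<in>Y. \<Sum>z\<in>Y. \<Sum>e\<in>Basis.
     c y * cnj (d z) * complex_of_real (frechet_derivative (\<phi> y) (at x) e * frechet_derivative (\<phi> z) (at x) e))"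
    by (rule trans[OF sum.swap], rule sum.cong[OF refl], rule sum.swap)
  finally show ?thesis by (simp only: basis_grad_prod_def sum_distrib_left of_real_sum)
qed

lemma nodal_comb_prod:
  "fe c x * cnj (fe d x) =
    (\<Sum>y\<in>Y. \<Sum>z\<in>Y. c y * cnj (d z) * complex_of_real (\<phi> y x * \<phi> z x))"
  unfolding nodal_comb_def cnj_sum sum_product
  by (simp only: complex_cnj_mult complex_cnj_complex_of_real of_real_mult mult_ac)

section \<open>The forms on finite element functions as double sums over nodes\<close>

context
  fixes W assumes W: "W \<in> sets lebesgue" "W \<subseteq> \<Omega>"
begin

lemma
  shows set_integrable_grad_prod: "set_integrable lebesgue W (grad_prod (fe c) (fe d))"
    and integral_grad_prod: "set_lebesgue_integral lebesgue W (grad_prod (fe c) (fe d)) =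
      (\<Sum>y\<in>Y. \<Sum>z\<in>Y. c y * cnj (d z) * complex_of_real (stiffness D W y z))"
proof -
  have i: "set_integrable lebesgue W (basis_grad_prod D y z)" if "y \<in> Y" "z \<in> Y" for y z
    using set_integrable_subset[OF set_integrable_basis_grad_prod W] that Y_subset by blast
  note c = set_integral_finite_combination[where q = "basis_grad_prod D" and Y = Y and A = W, OF i,
      where c = "\<lambda>y z. c y * cnj (d z)"]
  have e: "grad_prod (fe c) (fe d) x =
    (\<Sum>y\<in>Y. \<Sum>z\<in>Y. c y * cnj (d z) * complex_of_real (basis_grad_prod D y z x))" if "x \<in> W - skeleton" for x
    using grad_prod_nodal_comb that W by auto
  show "set_integrable lebesgue W (grad_prod (fe c) (fe d))"
    by (rule set_integral_lebesgue_spike(1)[OF c(1) negligible_skeleton e])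
  show "set_lebesgue_integral lebesgue W (grad_prod (fe c) (fe d)) =
      (\<Sum>y\<in>Y. \<Sum>z\<in>Y. c y * cnj (d z) * complex_of_real (stiffness D W y z))"
    unfolding stiffness_def
    by (rule trans[OF set_integral_lebesgue_spike(2)[OF c(1) negligible_skeleton e] c(2)])
qed

lemma
  shows set_integrable_comb_prod: "set_integrable lebesgue W (\<lambda>x. fe c x * cnj (fe d x))"
    and integral_comb_prod: "(LINT x:W|lebesgue. fe c x * cnj (fe d x)) =
      (\<Sum>y\<in>Y. \<Sum>z\<in>Y. c y * cnj (d z) * complex_of_real (mass D W y z))"
proof -
  have i: "set_integrable lebesgue W (\<lambda>x. \<phi> y x * \<phi> z x)" if "y \<in> Y" "z \<in> Y" for y z
    using set_integrable_subset[OF set_integrable_basis_prod W] that Y_subset by blast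
  note c = set_integral_finite_combination[where q = "\<lambda>y z x. \<phi> y x * \<phi> z x" and Y = Y and A = W, OF i,
      where c = "\<lambda>y z. c y * cnj (d z)"]
  show "set_integrable lebesgue W (\<lambda>x. fe c x * cnj (fe d x))"
    unfolding nodal_comb_prod using c(1) .
  show "(LINT x:W|lebesgue. fe c x * cnj (fe d x)) =
      (\<Sum>y\<in>Y. \<Sum>z\<in>Y. c y * cnj (d z) * complex_of_real (mass D W y z))"
    unfolding nodal_comb_prod mass_def using c(2) .
qed

lemma h_inner_nodal_comb:
  "h_inner D W (fe c) (fe d) = (\<Sum>y\<in>Y. \<Sum>z\<in>Y. c y * cnj (d z) * h_entry D W y z)"
  unfolding h_inner_def integral_grad_prod integral_comb_prod h_entry_def
  by (simp only: sum_distrib_left sum.distrib[symmetric]) (intro sum.cong refl, simp add: algebra_simps)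

end

lemma facet_hyperplane:
  assumes "F facet_of closure \<Omega>"
  obtains a b where "a \<noteq> 0" "closure \<Omega> \<subseteq> {x. inner a x \<le> b}" "F = closure \<Omega> \<inter> {x. inner a x = b}"
    "affine hull F = {x. inner a x = b}"
proof -
  have P: "polyhedron (closure \<Omega>)" using domain(5) by (rule polytope_imp_polyhedron)
  have I: "interior (closure \<Omega>) \<noteq> {}" using interior_closure_Omega domain(2) by simp
  show thesis by (rule facet_of_hyperplane[OF P I assms]) (rule that)
qed

lemma compact_facet: assumes "F facet_of closure \<Omega>" shows "compact F"
  using domain(3,4) by (intro face_of_imp_compact[OF _ _ facet_of_imp_face_of[OF assms]]) simp_all

lemma set_integrable_facet:
  assumes F: "F facet_of closure \<Omega>" and S: "closed S" and y: "y \<in> set (nodes D)" and z: "z \<in> set (nodes D)"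
  shows "set_integrable (\<mu> F) (F \<inter> S) (\<lambda>x. \<phi> y x * \<phi> z x)"
proof (rule set_integrable_compact_finite_measure)
  show c: "compact (F \<inter> S)" using compact_facet[OF F] S by (rule compact_Int_closed)
  have "affine hull F \<noteq> {}" using F by (simp add: facet_of_def)
  then show "emeasure (\<mu> F) (F \<inter> S) < \<infinity>"
    by (rule emeasure_hyperplane_measure_bounded[OF affine_imp_convex[OF affine_affine_hull] closed_affine_hull])
      (rule borel_compact[OF c], rule compact_imp_bounded[OF c])
  have "F \<inter> S \<subseteq> closure \<Omega>" using facet_of_imp_subset[OF F] by blast
  then show "continuous_on (F \<inter> S) (\<lambda>x. \<phi> y x * \<phi> z x)"
    by (intro continuous_on_mult continuous_on_subset[OF basis_continuous[OF y]]
        continuous_on_subset[OF basis_continuous[OF z]])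
qed simp

lemma boundary_integral_nodal_comb:
  assumes "closed S"
  shows "boundary_integral \<Omega> S (\<lambda>x. fe c x * cnj (fe d x)) =
    (\<Sum>y\<in>Y. \<Sum>z\<in>Y. c y * cnj (d z) * complex_of_real (boundary_mass D S y z))"
proof -
  have "boundary_integral \<Omega> S (\<lambda>x. fe c x * cnj (fe d x)) =
    (\<Sum>F\<in>{F. F facet_of closure \<Omega>}. \<Sum>y\<in>Y. \<Sum>z\<in>Y. c y * cnj (d z) *
      complex_of_real (LINT x:F \<inter> S|\<mu> F. \<phi> y x * \<phi> z x))"
    unfolding boundary_integral_def nodal_comb_prod
    by (intro sum.cong refl set_integral_finite_combination(2) set_integrable_facet assms)
      (use Y_subset in auto)
  also have "\<dots> = (\<Sum>y\<in>Y. \<Sum>z\<in>Y. \<Sum>F\<in>{F. F facet_of closure \<Omega>}. c y * cnj (d z) *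
      complex_of_real (LINT x:F \<inter> S|\<mu> F. \<phi> y x * \<phi> z x))"
    by (rule trans[OF sum.swap], rule sum.cong[OF refl], rule sum.swap)
  finally show ?thesis by (simp add: boundary_mass_def sum_distrib_left)
qed

lemma b_form_nodal_comb:
  "b_form D (fe c) (fe d) =
    (\<Sum>y\<in>Y. \<Sum>z\<in>Y. c y * cnj (d z) * b_entry D \<Omega> (frontier \<Omega>) y z)"
proof -
  have W: "\<Omega> \<in> sets lebesgue" using domain(1) by auto
  show ?thesis
    unfolding b_form_def integral_grad_prod[OF W order_refl] integral_comb_prod[OF W order_refl]
      boundary_integral_nodal_comb[OF frontier_closed] b_entry_def
    by (simp only: sum_distrib_left sum.distrib[symmetric] sum_subtractf[symmetric])
      (intro sum.cong refl, simp add: algebra_simps)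
qed

lemma b_form_loc_nodal_comb:
  assumes "i < N"
  shows "b_form_loc D i (fe c) (fe d) =
    (\<Sum>y\<in>Y. \<Sum>z\<in>Y. c y * cnj (d z) * b_sub i y z)"
proof -
  have W: "sub i \<in> sets lebesgue" "sub i \<subseteq> \<Omega>"
    using open_subdomain[OF assms] subdomain_subset[OF assms] by auto
  have c: "closed (frontier (sub i) \<inter> frontier \<Omega>)" by (intro closed_Int frontier_closed)
  show ?thesis
    \<comment> \<open>The local form integrates a difference, whereas \<open>b_form\<close> is
      written with two integrals; separating the terms here requires integrability of each.\<close>
    unfolding b_form_loc_def set_integral_diff(2)[OF set_integrable_grad_prod[OF W] set_integrable_mult_right[OF set_integrable_comb_prod[OF W]]]
      set_integral_mult_right integral_grad_prod[OF W] integral_comb_prod[OF W]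
      boundary_integral_nodal_comb[OF c] b_entry_def
    by (simp only: sum_distrib_left sum.distrib[symmetric] sum_subtractf[symmetric])
      (intro sum.cong refl, simp add: algebra_simps)
qed

section \<open>Additivity of volume and boundary integrals over the subdomains\<close>

lemma set_integral_Omega_split:
  fixes f :: "'a \<Rightarrow> real"
  assumes f: "set_integrable lebesgue \<Omega> f"
  shows "set_lebesgue_integral lebesgue \<Omega> f = (\<Sum>i<N. set_lebesgue_integral lebesgue (sub i) f)"
proof -
  have i: "set_integrable lebesgue (sub i) f" if "i < N" for i
    using open_subdomain[OF that] subdomain_subset[OF that] by (intro set_integrable_subset[OF f]) auto
  have U: "set_integrable lebesgue (\<Union>i\<in>{..<N}. sub i) f"
    using i open_subdomain by (intro set_integrable_UN) auto
  have "set_lebesgue_integral lebesgue \<Omega> f = set_lebesgue_integral lebesgue (\<Union>i\<in>{..<N}. sub i) f"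
    unfolding set_lebesgue_integral_eq_integral(2)[OF f] set_lebesgue_integral_eq_integral(2)[OF U]
    using subdomain_subset Omega_minus_skeleton
    by (intro integral_subset_negligible[symmetric] negligible_subset[OF negligible_skeleton]) auto
  also have "\<dots> = (\<Sum>i<N. set_lebesgue_integral lebesgue (sub i) f)"
  proof (rule set_integral_finite_UN_AE)
    fix j k assume "j \<in> {..<N}" "k \<in> {..<N}"
    then show "AE x in lebesgue. x \<in> sub j \<and> x \<in> sub k \<longrightarrow> j = k"
      using subdomain_disjoint[of j k] by (intro AE_I2) auto
  qed (use i open_subdomain in auto)
  finally show ?thesis .
qed

text \<open>
  If \<open>K \<inter> L \<inter> F\<close> had full dimension in the hyperplane of \<open>F\<close>, then \<open>K\<close> and \<open>L\<close>, both on the inner side of it,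
  would overlap. Hence the boundary integral splits over the subdomains.
\<close>

lemma facet_overlap_null:
  assumes F: "F facet_of closure \<Omega>" and ij: "i < N" "j < N" "i \<noteq> j"
    and K: "K \<in> elems i" and L: "L \<in> elems j"
  shows "K \<inter> L \<inter> F \<in> null_sets (\<mu> F)"
proof -
  obtain a b where ab: "a \<noteq> 0" "closure \<Omega> \<subseteq> {x. inner a x \<le> b}" "F = closure \<Omega> \<inter> {x. inner a x = b}"
    "affine hull F = {x. inner a x = b}" using facet_hyperplane[OF F] .
  have KT: "K \<in> mesh D" "L \<in> mesh D" "K \<subseteq> closure (sub i)" "L \<subseteq> closure (sub j)"
    using K L by (auto simp: elems_def)
  have KO: "K \<subseteq> closure \<Omega>" "L \<subseteq> closure \<Omega>" using KT mesh(2) by auto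
  have "interior K \<subseteq> sub i" "interior L \<subseteq> sub j"
    using interior_mono[OF KT(3)] interior_mono[OF KT(4)]
    by (simp_all add: subdomain_regular[symmetric] ij)
  then have disj: "interior K \<inter> interior L = {}" using subdomain_disjoint[OF ij] by blast
  have "affine hull (K \<inter> L \<inter> F) \<noteq> {x. inner a x = b}"
  proof
    assume "affine hull (K \<inter> L \<inter> F) = {x. inner a x = b}"
    then have "interior K \<inter> interior L \<noteq> {}"
      using ab KO element(2)[OF KT(1)] element(2)[OF KT(2)] element'(2)[OF KT(1)] element'(2)[OF KT(2)]
        face_of_imp_convex[OF facet_of_imp_face_of[OF F]]
      by (intro interior_Int_of_common_facet_part[OF ab(1), where A = "K \<inter> L \<inter> F"] convex_Int) auto
    then show False using disj by blast
  qed
  moreover have "K \<inter> L \<inter> F \<in> sets borel"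
    using element'(3)[OF KT(1)] element'(3)[OF KT(2)] compact_facet[OF F] compact_imp_closed
    by (intro borel_closed closed_Int) auto
  ultimately show ?thesis unfolding ab(4) using ab by (intro hyperplane_measure_null) auto
qed

lemma frontier_Omega_cover: "frontier \<Omega> = (\<Union>i<N. frontier (sub i) \<inter> frontier \<Omega>)"
proof -
  have "x \<in> (\<Union>i<N. frontier (sub i))" if "x \<in> frontier \<Omega>" for x
  proof -
    have x: "x \<in> closure \<Omega>" "x \<notin> \<Omega>" using that domain(1) by (auto simp: frontier_def interior_open)
    then obtain i where i: "i < N" "x \<in> closure (sub i)" using subdomains by blast
    then have "x \<notin> sub i" using x subdomain_subset by blast
    then have "x \<in> frontier (sub i)"
      using i open_subdomain[OF i(1)] by (simp add: frontier_def interior_open)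
    with i show ?thesis by blast
  qed
  then show ?thesis by blast
qed

lemma boundary_mass_split:
  assumes y: "y \<in> set (nodes D)" and z: "z \<in> set (nodes D)"
  shows "boundary_mass D (frontier \<Omega>) y z = (\<Sum>i<N. boundary_mass D (frontier (sub i) \<inter> frontier \<Omega>) y z)"
proof -
  have "(LINT x:F \<inter> frontier \<Omega>|\<mu> F. \<phi> y x * \<phi> z x) =
      (\<Sum>i<N. LINT x:F \<inter> (frontier (sub i) \<inter> frontier \<Omega>)|\<mu> F. \<phi> y x * \<phi> z x)"
    if F: "F facet_of closure \<Omega>" for F
  proof -
    let ?M = "\<mu> F" and ?A = "\<lambda>i. F \<inter> (frontier (sub i) \<inter> frontier \<Omega>)"
    have "F \<inter> frontier \<Omega> = (\<Union>i\<in>{..<N}. ?A i)" using frontier_Omega_cover by blast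
    moreover have "(LINT x:(\<Union>i\<in>{..<N}. ?A i)|?M. \<phi> y x * \<phi> z x) = (\<Sum>i\<in>{..<N}. LINT x:?A i|?M. \<phi> y x * \<phi> z x)"
    proof (rule set_integral_finite_UN_AE)
      fix i j assume ij: "i \<in> {..<N}" "j \<in> {..<N}"
      show "AE x in ?M. x \<in> ?A i \<and> x \<in> ?A j \<longrightarrow> i = j"
      proof (cases "i = j")
        case False
        have fin: "finite (elems k)" for k using mesh(1) by (auto simp: elems_def)
        \<comment> \<open>On F the two subdomain frontiers meet only inside finitely many
          intersections of an element of one with an element of the other, each of them
          null.\<close>
        have "(\<Union>K\<in>elems i. \<Union>L\<in>elems j. K \<inter> L \<inter> F) \<in> null_sets ?M"
          using facet_overlap_null[OF F] ij False fin
          by (intro null_sets.finite_UN) auto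
        moreover have "?A i \<inter> ?A j \<subseteq> (\<Union>K\<in>elems i. \<Union>L\<in>elems j. K \<inter> L \<inter> F)"
        proof
          fix x assume x: "x \<in> ?A i \<inter> ?A j"
          then have "x \<in> closure (sub i)" "x \<in> closure (sub j)" by (auto simp: frontier_def)
          then obtain K L where "K \<in> elems i" "x \<in> K" "L \<in> elems j" "x \<in> L"
            using in_element ij by (metis lessThan_iff)
          then show "x \<in> (\<Union>K\<in>elems i. \<Union>L\<in>elems j. K \<inter> L \<inter> F)" using x by blast
        qed
        ultimately show ?thesis by (intro AE_I'[where N="\<Union>K\<in>elems i. \<Union>L\<in>elems j. K \<inter> L \<inter> F"]) auto
      qed simp
    next
      fix i show "?A i \<in> sets ?M"
        using borel_closed[OF closed_Int[OF compact_imp_closed[OF compact_facet[OF F]] closed_Int[OF frontier_closed frontier_closed]]]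
        by simp
    next
      fix i show "set_integrable ?M (?A i) (\<lambda>x. \<phi> y x * \<phi> z x)"
        by (intro set_integrable_facet[OF F _ y z] closed_Int frontier_closed)
    qed simp
    ultimately show ?thesis by simp
  qed
  then show ?thesis unfolding boundary_mass_def by (subst sum.swap) simp
qed

lemma b_entry_split:
  assumes y: "y \<in> Y" and z: "z \<in> Y"
  shows "b_entry D \<Omega> (frontier \<Omega>) y z = (\<Sum>i<N. b_sub i y z)"
  and "h_entry D \<Omega> y z = (\<Sum>i<N. h_sub i y z)"
proof -
  have yz: "y \<in> set (nodes D)" "z \<in> set (nodes D)" using y z Y_subset by auto
  note s = set_integral_Omega_split[OF set_integrable_basis_grad_prod[OF yz], folded stiffness_def]
    set_integral_Omega_split[OF set_integrable_basis_prod[OF yz], folded mass_def]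
    boundary_mass_split[OF yz]
  show "b_entry D \<Omega> (frontier \<Omega>) y z = (\<Sum>i<N. b_sub i y z)"
    unfolding b_entry_def s by (simp add: sum.distrib sum_subtractf sum_distrib_left)
  show "h_entry D \<Omega> y z = (\<Sum>i<N. h_sub i y z)"
    unfolding h_entry_def s by (simp add: sum.distrib sum_distrib_left)
qed

section \<open>Locality and realness of the matrix entries\<close>

lemma basis_zero_closure_subdomain:
  assumes y: "y \<in> set (nodes D)" and i: "i < N" and "y \<notin> closure (sub i)" "x \<in> closure (sub i)"
  shows "\<phi> y x = 0"
proof -
  obtain K where K: "K \<in> mesh D" "x \<in> K" "K \<subseteq> closure (sub i)"
    using in_element[OF i assms(4)] by blast
  \<comment> \<open>The element counts as a face of itself, so the vanishing condition on faces
    applies to all of K.\<close>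
  then show ?thesis
    using basis_vanishes[OF y K(1), of K x] assms(3) face_of_refl[OF element'(2)[OF K(1)]] by auto
qed

text \<open>A facet of the domain cuts every element in a face of that element, and a node off the
  facet is off this face.\<close>

lemma basis_zero_facet:
  assumes y: "y \<in> set (nodes D)" and F: "F facet_of closure \<Omega>" and "y \<notin> F" "x \<in> F"
  shows "\<phi> y x = 0"
proof -
  have "x \<in> \<Union>(mesh D)" using facet_of_imp_subset[OF F] assms(4) mesh(2) by auto
  then obtain K where K: "K \<in> mesh D" "x \<in> K" by blast
  have "closure \<Omega> \<inter> K = K" using K mesh(2) by blast
  then have "(F \<inter> K) face_of K"
    using face_of_slice[OF facet_of_imp_face_of[OF F] element'(2)[OF K(1)]] by simp
  then show ?thesis using basis_vanishes[OF y K(1), of "F \<inter> K" x] assms K by auto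
qed

lemma facet_Int_Omega: assumes F: "F facet_of closure \<Omega>" shows "F \<inter> \<Omega> = {}"
proof -
  have "F \<noteq> closure \<Omega>" using F by (auto simp: facet_of_def)
  then have "F \<inter> rel_interior (closure \<Omega>) = {}"
    using face_of_disjoint_rel_interior[OF facet_of_imp_face_of[OF F]] by blast
  then show ?thesis
    using rel_interior_nonempty_interior[of "closure \<Omega>"] interior_closure_Omega domain(2) by simp
qed

text \<open>The basis function of a node inside \<Omega> vanishes on every boundary facet, so the
  impedance term, the only imaginary one, drops out.\<close>

lemma b_entry_real:
  assumes "y \<in> set (nodes D)" "y \<in> \<Omega>"
  shows "b_entry D W S y z \<in> \<real>"
proof -
  have "boundary_mass D S y z = 0"
    unfolding boundary_mass_def
  proof (rule sum.neutral, rule ballI)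
    fix F assume F: "F \<in> {F. F facet_of closure \<Omega>}"
    then have "y \<notin> F" using facet_Int_Omega assms by blast
    then have "\<phi> y x = 0" if "x \<in> F" for x using basis_zero_facet[OF assms(1)] F that by blast
    then show "(LINT x:F \<inter> S|\<mu> F. \<phi> y x * \<phi> z x) = 0"
      unfolding set_lebesgue_integral_def by (intro integral_eq_zero_AE AE_I2) (auto simp: indicator_def)
  qed
  then show ?thesis by (simp add: b_entry_def)
qed

lemma h_entry_real: "h_entry D W y z \<in> \<real>"
  by (simp add: h_entry_def)

text \<open>The basis function vanishes on the closed subdomain, hence its derivative vanishes on
  the open one; this kills the volume terms and the boundary term alike.\<close>

lemma entry_zero:
  assumes y: "y \<in> set (nodes D)" and i: "i < N" and n: "y \<notin> closure (sub i)"
  shows "b_sub i y z = 0" "h_sub i y z = 0"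
proof -
  have z0: "\<phi> y x = 0" if "x \<in> closure (sub i)" for x
    using basis_zero_closure_subdomain assms that by blast
  have d0: "frechet_derivative (\<phi> y) (at x) e = 0" if x: "x \<in> sub i" for x e
  proof -
    have "0 = \<phi> y x" if "x \<in> sub i" for x
      using z0 that closure_subset[of "sub i"] by (metis subsetD)
    then have "(\<phi> y has_derivative (\<lambda>e. 0)) (at x)"
      by (rule has_derivative_transform_within_open[OF has_derivative_const open_subdomain[OF i] x])
    then show ?thesis by (rule fun_cong[OF frechet_derivative_at, symmetric])
  qed
  have "(\<lambda>x. indicat_real (sub i) x *\<^sub>R basis_grad_prod D y z x) = (\<lambda>x. 0)"
    using d0 by (auto simp: fun_eq_iff indicator_def basis_grad_prod_def)
  then have "stiffness D (sub i) y z = 0"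
    by (simp only: stiffness_def set_lebesgue_integral_def integral_zero)
  moreover have "(\<lambda>x. indicat_real (sub i) x *\<^sub>R (\<phi> y x * \<phi> z x)) = (\<lambda>x. 0)"
    using z0 subsetD[OF closure_subset[of "sub i"]] by (auto simp: fun_eq_iff indicator_def)
  then have "mass D (sub i) y z = 0"
    by (simp only: mass_def set_lebesgue_integral_def integral_zero)
  moreover have "(\<lambda>x. indicat_real (F \<inter> (frontier (sub i) \<inter> frontier \<Omega>)) x *\<^sub>R (\<phi> y x * \<phi> z x)) = (\<lambda>x. 0)" for F
    using z0 by (auto simp: fun_eq_iff indicator_def frontier_def)
  then have "boundary_mass D (frontier (sub i) \<inter> frontier \<Omega>) y z = 0"
    by (simp only: boundary_mass_def set_lebesgue_integral_def integral_zero sum.neutral_const)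
  ultimately show "b_sub i y z = 0" "h_sub i y z = 0"
    by (simp_all add: b_entry_def h_entry_def)
qed

end

section \<open>Complex vectors and real matrices\<close>

type_synonym cvec = "complex Matrix.vec"

text \<open>Stated, like the rules after it, with equations between dimensions instead of carrier
  sets, so that the side conditions are settled by computing dimensions.\<close>

lemma mult_mat_mat_vec:
  fixes A B :: "complex mat"
  shows "dim_col A = dim_row B \<Longrightarrow> dim_col B = dim_vec v \<Longrightarrow> (A * B) *\<^sub>v v = A *\<^sub>v (B *\<^sub>v v)"
  by (rule assoc_mult_mat_vec[of A "dim_row A" "dim_col A" B "dim_col B"]) (auto intro: carrier_matI carrier_vecI)

lemma mult_mat_add_vec:
  fixes A :: "complex mat"
  shows "dim_vec x = dim_col A \<Longrightarrow> dim_vec y = dim_col A \<Longrightarrow> A *\<^sub>v (x + y) = A *\<^sub>v x + A *\<^sub>v y"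
  by (rule mult_add_distrib_mat_vec[of A "dim_row A" "dim_col A"]) (auto intro: carrier_matI carrier_vecI)

lemma mult_mat_minus_vec:
  fixes A :: "complex mat"
  shows "dim_vec x = dim_col A \<Longrightarrow> dim_vec y = dim_col A \<Longrightarrow> A *\<^sub>v (x - y) = A *\<^sub>v x - A *\<^sub>v y"
  by (rule mult_minus_distrib_mat_vec[of A "dim_row A" "dim_col A"]) (auto intro: carrier_matI carrier_vecI)

lemma add_mat_mult_vec:
  fixes A B :: "complex mat"
  shows "dim_row A = dim_row B \<Longrightarrow> dim_col A = dim_col B \<Longrightarrow> dim_vec v = dim_col B \<Longrightarrow> (A + B) *\<^sub>v v = A *\<^sub>v v + B *\<^sub>v v"
  by (rule add_mult_distrib_mat_vec[of A "dim_row A" "dim_col A"]) (auto intro: carrier_matI carrier_vecI)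

lemma minus_mat_mult_vec:
  fixes A B :: "complex mat"
  shows "dim_row A = dim_row B \<Longrightarrow> dim_col A = dim_col B \<Longrightarrow> dim_vec v = dim_col B \<Longrightarrow> (A - B) *\<^sub>v v = A *\<^sub>v v - B *\<^sub>v v"
  by (rule minus_mult_distrib_mat_vec[of A "dim_row A" "dim_col A"]) (auto intro: carrier_matI carrier_vecI)

lemma zero_vec_simps:
  fixes v :: "cvec"
  shows "dim_vec v = n \<Longrightarrow> v - 0\<^sub>v n = v" "dim_vec v = n \<Longrightarrow> v + 0\<^sub>v n = v" "dim_vec v = n \<Longrightarrow> 0\<^sub>v n + v = v"
  by (auto intro!: eq_vecI)

lemma mult_mat_uminus_vec:
  fixes A :: "complex mat"
  shows "dim_vec x = dim_col A \<Longrightarrow> A *\<^sub>v (- x) = - (A *\<^sub>v x)"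
  by (rule eq_vecI) (auto simp: scalar_prod_def sum_negf)

lemma four_block_mult_append:
  fixes A B C E :: "complex mat"
  assumes "dim_row A = dim_row B" "dim_row C = dim_row E" "dim_col A = dim_vec a" "dim_col C = dim_vec a"
    "dim_col B = dim_vec d" "dim_col E = dim_vec d"
  shows "four_block_mat A B C E *\<^sub>v (a @\<^sub>v d) = (A *\<^sub>v a + B *\<^sub>v d) @\<^sub>v (C *\<^sub>v a + E *\<^sub>v d)"
  by (rule four_block_mat_mult_vec[of A "dim_row A" "dim_col A" B "dim_col B" C "dim_row C" E])
    (use assms in \<open>auto intro!: carrier_matI carrier_vecI\<close>)

text \<open>The second factor is conjugated, so \<open>(A *\<^sub>v u) \<bullet>c w\<close> is the
  conjugate transpose of w times A u, in agreement with the argument order of the forms.\<close>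

lemma csp_eq_sum: "(v :: cvec) \<bullet>c w = (\<Sum>i<dim_vec w. v $ i * cnj (w $ i))"
  by (simp add: scalar_prod_def atLeast0LessThan conjugate_complex_def)

lemma csp_add_left:
  fixes x :: "cvec"
  shows "dim_vec x = dim_vec z \<Longrightarrow> dim_vec y = dim_vec z \<Longrightarrow> (x + y) \<bullet>c z = x \<bullet>c z + y \<bullet>c z"
  by (simp add: csp_eq_sum algebra_simps sum.distrib)

lemma csp_add_right:
  fixes x :: "cvec"
  shows "dim_vec y = dim_vec z \<Longrightarrow> x \<bullet>c (y + z) = x \<bullet>c y + x \<bullet>c z"
  by (simp add: csp_eq_sum algebra_simps sum.distrib)

lemma csp_minus_left:
  fixes x :: "cvec"
  shows "dim_vec x = dim_vec z \<Longrightarrow> dim_vec y = dim_vec z \<Longrightarrow> (x - y) \<bullet>c z = x \<bullet>c z - y \<bullet>c z"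
  by (simp add: csp_eq_sum algebra_simps sum_subtractf)

lemma csp_minus_right:
  fixes x :: "cvec"
  shows "dim_vec y = dim_vec z \<Longrightarrow> x \<bullet>c (y - z) = x \<bullet>c y - x \<bullet>c z"
  by (simp add: csp_eq_sum algebra_simps sum_subtractf)

lemma csp_append:
  fixes a :: "cvec"
  assumes "dim_vec a = dim_vec c" "dim_vec b = dim_vec d"
  shows "(a @\<^sub>v b) \<bullet>c (c @\<^sub>v d) = a \<bullet>c c + b \<bullet>c d"
proof -
  have "conjugate (c @\<^sub>v d) = conjugate c @\<^sub>v conjugate d"
    by (rule eq_vecI) auto
  moreover have "(a @\<^sub>v b) \<bullet> (conjugate c @\<^sub>v conjugate d) = a \<bullet> conjugate c + b \<bullet> conjugate d"
    by (rule scalar_prod_append[of a "dim_vec a" b "dim_vec b"]) (use assms in \<open>auto intro!: carrier_vecI\<close>)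
  ultimately show ?thesis by (simp only:)
qed

definition vnorm :: "cvec \<Rightarrow> real" where
  "vnorm v = L2_set (\<lambda>i. cmod (v $ i)) {..<dim_vec v}"

lemma vnorm_nonneg [simp]: "0 \<le> vnorm v"
  by (simp add: vnorm_def)

lemma csp_self: "v \<bullet>c v = complex_of_real ((vnorm v)\<^sup>2)"
  by (simp add: csp_eq_sum vnorm_def L2_set_def sum_nonneg complex_norm_square del: of_real_power)

lemma weighted_csp_le:
  assumes "\<And>i. i < dim_vec v \<Longrightarrow> cmod (d i) \<le> e" "dim_vec v = dim_vec w"
  shows "cmod (\<Sum>i<dim_vec v. d i * v $ i * cnj (w $ i)) \<le> e * vnorm v * vnorm w"
\<comment> \<open>For the empty vector the hypothesis leaves the sign of \<open>e\<close> open;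
  otherwise any index shows that it is nonnegative.\<close>
proof (cases "dim_vec v = 0")
  case True
  then show ?thesis by (simp add: vnorm_def)
next
  case False
  then have e: "0 \<le> e" using assms(1)[of 0] by (meson norm_ge_zero order_trans not_gr0)
  have "cmod (\<Sum>i<dim_vec v. d i * v $ i * cnj (w $ i)) \<le> (\<Sum>i<dim_vec v. e * (cmod (v $ i) * cmod (w $ i)))"
    using assms(1) by (intro sum_norm_le) (auto simp: norm_mult mult.assoc intro!: mult_right_mono)
  also have "\<dots> = e * (\<Sum>i<dim_vec v. \<bar>cmod (v $ i)\<bar> * \<bar>cmod (w $ i)\<bar>)"
    by (simp add: sum_distrib_left)
  also have "\<dots> \<le> e * (vnorm v * vnorm w)"
    unfolding vnorm_def assms(2) using e by (intro mult_left_mono L2_set_mult_ineq)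
  finally show ?thesis by (simp add: mult.assoc)
qed

definition real_mat :: "complex mat \<Rightarrow> bool" where
  "real_mat A \<longleftrightarrow> (\<forall>i<dim_row A. \<forall>j<dim_col A. A $$ (i,j) \<in> \<real>)"

text \<open>As a fixed point of entrywise conjugation, which is multiplicative, realness passes to
  products and inverses without computing entries.\<close>

lemma real_mat_iff_cnj: "real_mat A \<longleftrightarrow> map_mat cnj A = A"
  unfolding real_mat_def by (auto simp: mat_eq_iff Reals_cnj_iff)

lemma real_matI: "(\<And>i j. i < dim_row A \<Longrightarrow> j < dim_col A \<Longrightarrow> A $$ (i,j) \<in> \<real>) \<Longrightarrow> real_mat A"
  by (simp add: real_mat_def)

lemma map_cnj_mult:
  "dim_col A = dim_row B \<Longrightarrow> map_mat cnj (A * B) = map_mat cnj A * map_mat cnj B"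
  by (rule eq_matI) (auto simp: scalar_prod_def)

lemma real_mat_mult [simp]: "real_mat A \<Longrightarrow> real_mat B \<Longrightarrow> dim_col A = dim_row B \<Longrightarrow> real_mat (A * B)"
  by (simp add: real_mat_iff_cnj map_cnj_mult)

lemma real_mat_transpose [simp]: "real_mat (A\<^sup>T) \<longleftrightarrow> real_mat A"
  by (auto simp: real_mat_def)

lemma real_mat_one [simp]: "real_mat (1\<^sub>m n)"
  by (auto simp: real_mat_def)

lemma real_mat_zero [simp]: "real_mat (0\<^sub>m m n)"
  by (auto simp: real_mat_def)

lemma real_mat_add [simp]:
  "real_mat A \<Longrightarrow> real_mat B \<Longrightarrow> dim_row A = dim_row B \<Longrightarrow> dim_col A = dim_col B \<Longrightarrow> real_mat (A + B)"
  by (auto simp: real_mat_def)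

lemma real_mat_minus [simp]:
  "real_mat A \<Longrightarrow> real_mat B \<Longrightarrow> dim_row A = dim_row B \<Longrightarrow> dim_col A = dim_col B \<Longrightarrow> real_mat (A - B)"
  by (auto simp: real_mat_def)

lemma real_mat_uminus [simp]: "real_mat A \<Longrightarrow> real_mat (- A)"
  by (auto simp: real_mat_def)

lemma real_mat_four_block [simp]:
  assumes "real_mat A" "real_mat B" "real_mat C" "real_mat E"
    "dim_row A = dim_row B" "dim_row C = dim_row E" "dim_col A = dim_col C" "dim_col B = dim_col E"
  shows "real_mat (four_block_mat A B C E)"
  using assms by (auto simp: real_mat_def)

lemma real_mat_re_mat [simp]: "real_mat (re_mat A)"
  by (auto simp: real_mat_def re_mat_def)

lemma real_mat_sum [simp]:
  "(\<And>i. i < N \<Longrightarrow> real_mat (A i)) \<Longrightarrow> (\<And>i. i < N \<Longrightarrow> dim_row (A i) = nr) \<Longrightarrow>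
    (\<And>i. i < N \<Longrightarrow> dim_col (A i) = nc) \<Longrightarrow> real_mat (mat_sum nr nc N A)"
  by (auto simp: real_mat_def mat_sum_def intro!: sum_in_Reals)

text \<open>The conjugate of the inverse also inverts the real matrix A, and inverses are
  unique.\<close>

lemma real_mat_inverse:
  assumes "A \<in> carrier_mat n n" "B \<in> carrier_mat n n" "real_mat A" "A * B = 1\<^sub>m n" "B * A = 1\<^sub>m n"
  shows "real_mat B"
proof -
  let ?C = "map_mat cnj B"
  have C: "?C \<in> carrier_mat n n" using assms by auto
  have "map_mat cnj (B * A) = ?C * map_mat cnj A"
    by (rule map_cnj_mult) (use assms in auto)
  moreover have "map_mat cnj A = A" using assms(3) by (simp add: real_mat_iff_cnj)
  moreover have "map_mat cnj (B * A) = 1\<^sub>m n"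
    using real_mat_one[of n] unfolding assms(5) real_mat_iff_cnj .
  ultimately have "?C * A = 1\<^sub>m n" by simp
  note CA = this
  have "?C = ?C * (A * B)" using C assms(4) by simp
  also have "\<dots> = (?C * A) * B" using C assms by (simp add: assoc_mult_mat)
  also have "\<dots> = B" using CA assms(2) by simp
  finally show ?thesis by (simp add: real_mat_iff_cnj)
qed

text \<open>For real entries the plain transpose is the Hermitian adjoint. The preconditioner is
  built with transposes, which is why realness of the restriction and eigenvector matrices is
  tracked.\<close>

lemma csp_adjoint:
  assumes "real_mat A" "dim_vec v = dim_col A" "dim_vec w = dim_row A"
  shows "(A *\<^sub>v v) \<bullet>c w = v \<bullet>c (A\<^sup>T *\<^sub>v w)"
proof -
  have c: "cnj (A $$ (i,j)) = A $$ (i,j)" if "i < dim_row A" "j < dim_col A" for i j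
    using assms(1) that by (simp add: real_mat_def Reals_cnj_iff)
  have "(A *\<^sub>v v) \<bullet>c w = (\<Sum>i<dim_row A. \<Sum>j<dim_col A. A $$ (i,j) * v $ j * cnj (w $ i))"
    using assms by (auto simp: csp_eq_sum scalar_prod_def atLeast0LessThan sum_distrib_right intro!: sum.cong)
  also have "\<dots> = (\<Sum>j<dim_col A. \<Sum>i<dim_row A. A $$ (i,j) * v $ j * cnj (w $ i))"
    by (rule sum.swap)
  also have "\<dots> = v \<bullet>c (A\<^sup>T *\<^sub>v w)"
    using assms c by (auto simp: csp_eq_sum scalar_prod_def atLeast0LessThan sum_distrib_left intro!: sum.cong)
  finally show ?thesis .
qed

text \<open>\<open>inv_mat\<close> reads its value out of an option. A one-sided inverse of a square
  matrix is two-sided, so A is a unit and the option is filled.\<close>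

lemma inv_mat_works:
  assumes A: "A \<in> carrier_mat n n" and B: "B \<in> carrier_mat n n" "A * B = 1\<^sub>m n"
  shows "inv_mat A \<in> carrier_mat n n" "A * inv_mat A = 1\<^sub>m n" "inv_mat A * A = 1\<^sub>m n"
proof -
  have BA: "B * A = 1\<^sub>m n" using mat_mult_left_right_inverse[OF A B] .
  have "A \<in> Units (ring_mat TYPE(complex) n b)" for b :: unit
    using A B BA unfolding Units_def ring_mat_def by auto
  then obtain C where C: "mat_inverse A = Some C"
    using mat_inverse(1)[OF A, where b = "()"] by (cases "mat_inverse A") auto
  note * = mat_inverse(2)[OF A C]
  then show "inv_mat A \<in> carrier_mat n n" "A * inv_mat A = 1\<^sub>m n" "inv_mat A * A = 1\<^sub>m n"
    by (simp_all add: inv_mat_def C)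
qed

lemma inv_mat_of_injective:
  assumes A: "A \<in> carrier_mat n n"
    and inj: "\<And>x. x \<in> carrier_vec n \<Longrightarrow> A *\<^sub>v x = 0\<^sub>v n \<Longrightarrow> x = 0\<^sub>v n"
  shows "inv_mat A \<in> carrier_mat n n" "A * inv_mat A = 1\<^sub>m n" "inv_mat A * A = 1\<^sub>m n"
proof -
  have "Determinant.det A \<noteq> 0"
    using det_0_iff_vec_prod_zero_field[OF A] inj by blast
  then obtain B where "B \<in> carrier_mat n n" "A * B = 1\<^sub>m n"
    using det_non_zero_imp_unit[OF A, of b] unfolding Units_def ring_mat_def by auto
  then show "inv_mat A \<in> carrier_mat n n" "A * inv_mat A = 1\<^sub>m n" "inv_mat A * A = 1\<^sub>m n"
    using inv_mat_works[OF A] by blast+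
qed

section \<open>Generalized eigenvalue problems\<close>

definition cdiag :: "nat \<Rightarrow> (nat \<Rightarrow> real) \<Rightarrow> complex mat" where
  "cdiag n l = mat n n (\<lambda>(i,j). if i = j then complex_of_real (l i) else 0)"

lemma dim_cdiag [simp]: "dim_row (cdiag n l) = n" "dim_col (cdiag n l) = n"
  by (simp_all add: cdiag_def)

lemma cdiag_carrier [simp]: "cdiag n l \<in> carrier_mat n n"
  by (simp add: cdiag_def)

lemma real_mat_cdiag [simp]: "real_mat (cdiag n l)"
  by (auto simp: real_mat_def cdiag_def)

lemma transpose_cdiag [simp]: "(cdiag n l)\<^sup>T = cdiag n l"
  by (rule eq_matI) (auto simp: cdiag_def)

lemma cdiag_mult_vec: "dim_vec v = n \<Longrightarrow> cdiag n l *\<^sub>v v = Matrix.vec n (\<lambda>i. complex_of_real (l i) * v $ i)"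
  by (rule eq_vecI)
    (auto simp: cdiag_def scalar_prod_def if_distrib[where f="\<lambda>x. x * _"] cong: if_cong)

lemma cdiag_csp_le:
  assumes "\<And>i. i < dim_vec v \<Longrightarrow> \<bar>l i\<bar> \<le> e" "dim_vec v = dim_vec w"
  shows "cmod ((cdiag (dim_vec v) l *\<^sub>v v) \<bullet>c w) \<le> e * vnorm v * vnorm w"
proof -
  have "(cdiag (dim_vec v) l *\<^sub>v v) \<bullet>c w = (\<Sum>i<dim_vec v. complex_of_real (l i) * v $ i * cnj (w $ i))"
    using assms(2) by (simp add: csp_eq_sum cdiag_mult_vec)
  then show ?thesis using weighted_csp_le[of v "\<lambda>i. complex_of_real (l i)" e w] assms by simp
qed

lemma cdiag_inverse:
  assumes "\<And>i. i < n \<Longrightarrow> l i \<noteq> 0"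
  shows "cdiag n l * cdiag n (\<lambda>i. 1 / l i) = 1\<^sub>m n"
  by (rule eq_matI) (use assms in \<open>auto simp: cdiag_def scalar_prod_def if_distrib[where f="\<lambda>x. x * _"] cong: if_cong\<close>)

abbreviation selector :: "(nat \<Rightarrow> bool) \<Rightarrow> nat \<Rightarrow> complex mat" where
  "selector P n \<equiv> select_cols P (1\<^sub>m n)"

abbreviation picked :: "(nat \<Rightarrow> bool) \<Rightarrow> nat \<Rightarrow> nat list" where
  "picked P n \<equiv> filter P [0..<n]"

lemma select_cols_carrier: "select_cols P A \<in> carrier_mat (dim_row A) (length (filter P [0..<dim_col A]))"
  by (intro carrier_matI) (auto simp: select_cols_def)

text \<open>Column selection becomes multiplication by a 0-1 matrix, so orthogonality and
  completeness of selected eigenvectors reduce to statements about coordinates.\<close>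

lemma select_cols_mult:
  assumes "A \<in> carrier_mat m n"
  shows "select_cols P A = A * selector P n"
proof (rule eq_matI)
  have "set (picked P n) \<subseteq> {..<n}" by auto
  then have f: "picked P n ! j < n" if "j < length (picked P n)" for j
    using nth_mem[OF that] by blast
  fix i j assume "i < dim_row (A * selector P n)" "j < dim_col (A * selector P n)"
  then have ij: "i < m" "j < length (picked P n)" using assms by (auto simp: select_cols_def)
  have "col (selector P n) j = unit_vec n (picked P n ! j)"
    unfolding select_cols_def using ij f by (subst col_mat_of_cols) auto
  then show "select_cols P A $$ (i, j) = (A * selector P n) $$ (i, j)"
    using assms ij f select_cols_carrier[of P "1\<^sub>m n"]
    by (auto simp: select_cols_def mat_of_cols_index scalar_prod_right_unit)
qed (use assms in \<open>auto simp: select_cols_def\<close>)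

context
  fixes n :: nat and P :: "nat \<Rightarrow> bool"
begin

lemma filter_nth_less: "r < length (picked P n) \<Longrightarrow> picked P n ! r < n" and filter_nth_P: "r < length (picked P n) \<Longrightarrow> P (picked P n ! r)"
  using nth_mem[of r "picked P n"] by auto

lemma selector_index: "i < n \<Longrightarrow> r < length (picked P n) \<Longrightarrow> selector P n $$ (i,r) = (if i = picked P n ! r then 1 else 0)"
  using filter_nth_less[of r] by (auto simp: select_cols_def mat_of_cols_index)

lemma selector_dim [simp]: "dim_row (selector P n) = n" "dim_col (selector P n) = length (picked P n)"
  by (simp_all add: select_cols_def)

lemma real_mat_selector [simp]: "real_mat (selector P n)"
  by (rule real_matI) (auto simp: selector_index)

lemma selector_transpose_vec:
  assumes "dim_vec v = n"
  shows "(selector P n)\<^sup>T *\<^sub>v v = Matrix.vec (length (picked P n)) (\<lambda>r. v $ (picked P n ! r))"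
proof (rule eq_vecI)
  fix r assume r: "r < dim_vec (Matrix.vec (length (picked P n)) (\<lambda>r. v $ (picked P n ! r)))"
  then have "((selector P n)\<^sup>T *\<^sub>v v) $ r = (\<Sum>i = 0..<n. (if i = picked P n ! r then 1 else 0) * v $ i)"
    using assms by (auto simp: scalar_prod_def selector_index intro!: sum.cong)
  also have "\<dots> = v $ (picked P n ! r)"
    using filter_nth_less[of r] r by (simp add: if_distrib[where f="\<lambda>x. x * _"] cong: if_cong)
  finally show "((selector P n)\<^sup>T *\<^sub>v v) $ r = Matrix.vec (length (picked P n)) (\<lambda>r. v $ (picked P n ! r)) $ r" using r by simp
qed simp

lemma selector_vec_index:
  assumes "dim_vec a = length (picked P n)" "i < n"
  shows "(selector P n *\<^sub>v a) $ i = (\<Sum>r<length (picked P n). if i = picked P n ! r then a $ r else 0)"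
  using assms by (auto simp: scalar_prod_def selector_index atLeast0LessThan intro!: sum.cong)

lemma selector_vec_picked:
  assumes "dim_vec a = length (picked P n)" "r < length (picked P n)"
  shows "(selector P n *\<^sub>v a) $ (picked P n ! r) = a $ r"
proof -
  have "(selector P n *\<^sub>v a) $ (picked P n ! r) = (\<Sum>s<length (picked P n). if s = r then a $ s else 0)"
    unfolding selector_vec_index[OF assms(1) filter_nth_less[OF assms(2)]]
    using assms(2) by (intro sum.cong) (auto simp: nth_eq_iff_index_eq)
  then show ?thesis using assms(2) by (simp del: index_mult_mat_vec)
qed

lemma selector_vec_outside:
  assumes "dim_vec a = length (picked P n)" "i < n" "\<not> P i"
  shows "(selector P n *\<^sub>v a) $ i = 0"
  unfolding selector_vec_index[OF assms(1,2)] using assms(3) filter_nth_P by (intro sum.neutral) auto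

lemma selector_gram:
  assumes "dim_vec a = length (picked P n)"
  shows "(selector P n)\<^sup>T *\<^sub>v (selector P n *\<^sub>v a) = a"
  using assms by (subst selector_transpose_vec)
    (auto intro!: eq_vecI simp: selector_vec_picked simp del: index_mult_mat_vec)

lemma selector_diagonal:
  assumes "dim_vec a = length (picked P n)"
  shows "(selector P n)\<^sup>T *\<^sub>v (cdiag n l *\<^sub>v (selector P n *\<^sub>v a)) =
    cdiag (length (picked P n)) (\<lambda>r. l (picked P n ! r)) *\<^sub>v a"
  using assms filter_nth_less by (subst selector_transpose_vec)
    (auto intro!: eq_vecI simp: cdiag_mult_vec selector_vec_picked simp del: index_mult_mat_vec)

lemma selector_projection:
  assumes v: "dim_vec v = n" and i: "i < n"
  shows "(selector P n *\<^sub>v ((selector P n)\<^sup>T *\<^sub>v v)) $ i = (if P i then v $ i else 0)"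
proof -
  have "(selector P n *\<^sub>v ((selector P n)\<^sup>T *\<^sub>v v)) $ i = (\<Sum>r<length (picked P n). if i = picked P n ! r then v $ (picked P n ! r) else 0)"
    unfolding selector_transpose_vec[OF v] using i
    by (auto simp: scalar_prod_def selector_index atLeast0LessThan intro!: sum.cong)
  also have "\<dots> = (\<Sum>j\<in>set (picked P n). if i = j then v $ j else 0)"
    by (rule sum.reindex_bij_betw[OF bij_betw_nth]) auto
  also have "\<dots> = (if P i then v $ i else 0)" using i by simp
  finally show ?thesis .
qed

end

text \<open>Complementary selections have disjoint supports, and a diagonal matrix does not mix
  coordinates.\<close>

lemma selector_orthogonal:
  assumes "dim_vec a = length (picked (\<lambda>j. \<not> P j) n)"
  shows "(selector P n)\<^sup>T *\<^sub>v (cdiag n l *\<^sub>v (selector (\<lambda>j. \<not> P j) n *\<^sub>v a)) = 0\<^sub>v (length (picked P n))"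
    and "(selector P n)\<^sup>T *\<^sub>v (selector (\<lambda>j. \<not> P j) n *\<^sub>v a) = 0\<^sub>v (length (picked P n))"
proof -
  have z: "(selector (\<lambda>j. \<not> P j) n *\<^sub>v a) $ (picked P n ! r) = 0" if "r < length (picked P n)" for r
    using filter_nth_P[OF that] by (intro selector_vec_outside assms filter_nth_less[OF that]) simp
  show "(selector P n)\<^sup>T *\<^sub>v (cdiag n l *\<^sub>v (selector (\<lambda>j. \<not> P j) n *\<^sub>v a)) = 0\<^sub>v (length (picked P n))"
    by (subst selector_transpose_vec)
      (auto intro!: eq_vecI simp: cdiag_mult_vec z filter_nth_less simp del: index_mult_mat_vec)
  show "(selector P n)\<^sup>T *\<^sub>v (selector (\<lambda>j. \<not> P j) n *\<^sub>v a) = 0\<^sub>v (length (picked P n))"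
    by (subst selector_transpose_vec) (auto intro!: eq_vecI simp: z simp del: index_mult_mat_vec)
qed

lemma selector_complete:
  assumes v: "dim_vec v = n"
  shows "selector P n *\<^sub>v ((selector P n)\<^sup>T *\<^sub>v v)
    + selector (\<lambda>j. \<not> P j) n *\<^sub>v ((selector (\<lambda>j. \<not> P j) n)\<^sup>T *\<^sub>v v) = v"
  by (rule eq_vecI) (simp_all add: v selector_projection del: index_mult_mat_vec)

lemma mat_eq_of_mult_vec:
  fixes A B :: "complex mat"
  assumes "dim_row A = dim_row B" "dim_col A = dim_col B"
    and "\<And>v. dim_vec v = dim_col B \<Longrightarrow> A *\<^sub>v v = B *\<^sub>v v"
  shows "A = B"
proof (rule eq_matI)
  fix i j assume ij: "i < dim_row B" "j < dim_col B"
  have "(A *\<^sub>v unit_vec (dim_col B) j) $ i = A $$ (i,j)" "(B *\<^sub>v unit_vec (dim_col B) j) $ i = B $$ (i,j)"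
    using ij assms(1,2) by (simp_all add: scalar_prod_right_unit)
  then show "A $$ (i,j) = B $$ (i,j)" using assms(3)[of "unit_vec (dim_col B) j"] by simp
qed (use assms in auto)

lemma mult_mat_zero_vec:
  fixes A :: "complex mat"
  shows "dim_col A = n \<Longrightarrow> A *\<^sub>v 0\<^sub>v n = 0\<^sub>v (dim_row A)"
  by (rule eq_vecI) (auto simp: scalar_prod_def)

lemma cdiag_mult_cdiag:
  assumes "dim_vec v = n" "\<And>i. i < n \<Longrightarrow> l i \<noteq> 0"
  shows "cdiag n (\<lambda>i. 1 / l i) *\<^sub>v (cdiag n l *\<^sub>v v) = v" "cdiag n l *\<^sub>v (cdiag n (\<lambda>i. 1 / l i) *\<^sub>v v) = v"
  using assms by (auto intro!: eq_vecI simp: cdiag_mult_vec simp del: index_mult_mat_vec)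

lemma inv_mat_cdiag:
  assumes "\<And>i. i < n \<Longrightarrow> l i \<noteq> 0"
  shows "inv_mat (cdiag n l) = cdiag n (\<lambda>i. 1 / l i)"
proof -
  let ?A = "cdiag n l" and ?B = "cdiag n (\<lambda>i. 1 / l i)"
  have AB: "?A * ?B = 1\<^sub>m n" using cdiag_inverse assms by blast
  note inv = inv_mat_works[OF cdiag_carrier cdiag_carrier AB]
  have "inv_mat ?A = inv_mat ?A * (?A * ?B)" using inv(1) AB by simp
  also have "\<dots> = (inv_mat ?A * ?A) * ?B"
    by (rule assoc_mult_mat[symmetric, OF inv(1) cdiag_carrier cdiag_carrier])
  also have "\<dots> = ?B" unfolding inv(3) by simp
  finally show ?thesis .
qed

lemma cdiag_one: "cdiag n (\<lambda>_. 1) = 1\<^sub>m n"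
  by (rule eq_matI) (auto simp: cdiag_def)

lemma csp_zero_left [simp]: "(0\<^sub>v (dim_vec x) :: cvec) \<bullet>c x = 0"
  by (simp add: csp_eq_sum)

lemma csp_le: "dim_vec v = dim_vec w \<Longrightarrow> cmod (v \<bullet>c w) \<le> vnorm v * vnorm w"
  using weighted_csp_le[of v "\<lambda>_. 1" 1 w] by (simp add: csp_eq_sum)

text \<open>For \<open>Q_Re\<close>, whose columns are those of \<open>Q_one\<close> followed by
  those of \<open>Q_two\<close>: the product of \<open>Q_Re\<close> with its transpose is the sum of
  the two corresponding products.\<close>

lemma mat_of_cols_append_mult:
  fixes A B :: "complex mat"
  assumes "dim_row A = n" "dim_row B = n"
  defines "C \<equiv> mat_of_cols n (cols A @ cols B)"
  shows "dim_vec w = n \<Longrightarrow> C\<^sup>T *\<^sub>v w = (A\<^sup>T *\<^sub>v w) @\<^sub>v (B\<^sup>T *\<^sub>v w)"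
    and "dim_vec x = dim_col A \<Longrightarrow> dim_vec y = dim_col B \<Longrightarrow> C *\<^sub>v (x @\<^sub>v y) = A *\<^sub>v x + B *\<^sub>v y"
proof -
  have dC: "dim_row C = n" "dim_col C = dim_col A + dim_col B" by (simp_all add: C_def)
  have e: "C $$ (i,j) = (if j < dim_col A then A $$ (i,j) else B $$ (i, j - dim_col A))"
    if "i < n" "j < dim_col A + dim_col B" for i j
    using that assms(1,2) by (auto simp: C_def mat_of_cols_index nth_append)
  have c: "col C j = (if j < dim_col A then col A j else col B (j - dim_col A))" if "j < dim_col A + dim_col B" for j
    using that assms(1,2) e by (auto intro!: eq_vecI simp: dC)
  have r: "row C i = row A i @\<^sub>v row B i" if "i < n" for i
    using that assms(1,2) e by (auto intro!: eq_vecI simp: dC)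
  show "C\<^sup>T *\<^sub>v w = (A\<^sup>T *\<^sub>v w) @\<^sub>v (B\<^sup>T *\<^sub>v w)" if "dim_vec w = n"
    using that assms(1,2) c by (intro eq_vecI) (auto simp: dC)
  show "C *\<^sub>v (x @\<^sub>v y) = A *\<^sub>v x + B *\<^sub>v y" if "dim_vec x = dim_col A" "dim_vec y = dim_col B"
  proof (rule eq_vecI)
    fix i assume i: "i < dim_vec (A *\<^sub>v x + B *\<^sub>v y)"
    have "(row A i @\<^sub>v row B i) \<bullet> (x @\<^sub>v y) = row A i \<bullet> x + row B i \<bullet> y"
      by (rule scalar_prod_append[of _ "dim_col A" _ "dim_col B"])
        (use that in \<open>auto intro!: carrier_vecI\<close>)
    then show "(C *\<^sub>v (x @\<^sub>v y)) $ i = (A *\<^sub>v x + B *\<^sub>v y) $ i"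
      using i assms(1,2) by (simp add: dC r)
  qed (use assms(1,2) in \<open>simp add: dC\<close>)
qed

text \<open>A full system X of real eigenvectors, orthonormal with respect to M, carries all
  structural information: invertibility of X and the symmetry, realness and positive definiteness of
  M follow from it.\<close>

locale eigensystem =
  fixes A M X :: "complex mat" and lam :: "nat \<Rightarrow> real" and n :: nat
  assumes eigensystem: "real_eigensystem A M lam X" and A: "A \<in> carrier_mat n n" and M: "M \<in> carrier_mat n n"
begin

lemma X: "X \<in> carrier_mat n n"
  using eigensystem M by (simp add: real_eigensystem_def)

lemma dims [simp]: "dim_row A = n" "dim_col A = n" "dim_row M = n" "dim_col M = n" "dim_row X = n" "dim_col X = n"
  using A M X by auto

lemma real_X [simp]: "real_mat X"
proof (rule real_matI)
  fix i j assume "i < dim_row X" "j < dim_col X"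
  then have "X $$ (i,j) \<in> elements_mat X" by (intro elements_matI[OF X]) simp_all
  moreover have "elements_mat X \<subseteq> \<real>"
    using eigensystem unfolding real_eigensystem_def Let_def by (elim conjE)
  ultimately show "X $$ (i,j) \<in> \<real>" by (rule subsetD[rotated])
qed

lemma gram: "X\<^sup>T * (M * X) = 1\<^sub>m n"
proof (rule eq_matI)
  fix i j assume ij: "i < dim_row (1\<^sub>m n :: complex mat)" "j < dim_col (1\<^sub>m n :: complex mat)"
  then have "(X\<^sup>T * (M * X)) $$ (i,j) = col X i \<bullet> (M *\<^sub>v col X j)"
    by (simp add: col_mult2[OF M X])
  then show "(X\<^sup>T * (M * X)) $$ (i,j) = 1\<^sub>m n $$ (i,j)"
    using eigensystem ij by (simp add: real_eigensystem_def)
qed auto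

lemma diagonal: "X\<^sup>T * (A * X) = cdiag n lam"
proof (rule eq_matI)
  fix i j assume ij: "i < dim_row (cdiag n lam)" "j < dim_col (cdiag n lam)"
  then have "(X\<^sup>T * (A * X)) $$ (i,j) = col X i \<bullet> (A *\<^sub>v col X j)"
    by (simp add: col_mult2[OF A X])
  also have "A *\<^sub>v col X j = complex_of_real (lam j) \<cdot>\<^sub>v (M *\<^sub>v col X j)"
    using eigensystem ij by (simp add: real_eigensystem_def)
  also have "col X i \<bullet> \<dots> = complex_of_real (lam j) * (col X i \<bullet> (M *\<^sub>v col X j))"
    by (rule scalar_prod_smult_distrib[of _ n]) (auto intro!: carrier_vecI)
  also have "col X i \<bullet> (M *\<^sub>v col X j) = (if i = j then 1 else 0)"
    using eigensystem ij by (simp add: real_eigensystem_def)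
  finally show "(X\<^sup>T * (A * X)) $$ (i,j) = cdiag n lam $$ (i,j)"
    using ij by (simp add: cdiag_def)
qed auto

lemma inverse_X: "X * (X\<^sup>T * M) = 1\<^sub>m n" "(X\<^sup>T * M) * X = 1\<^sub>m n"
proof -
  show 1: "(X\<^sup>T * M) * X = 1\<^sub>m n"
    using gram assoc_mult_mat[of "X\<^sup>T" n n M n X n] M X by simp
  show "X * (X\<^sup>T * M) = 1\<^sub>m n"
    using mat_mult_left_right_inverse[of "X\<^sup>T * M" n X] 1 M X by simp
qed

text \<open>The inverse of X is \<open>X\<^sup>T * M\<close>. Transposing
  \<open>X * (X\<^sup>T * M) = 1\<^sub>m n\<close> and multiplying by M on the right gives the
  factorization, which exhibits M as a Gram matrix.\<close>

lemma M_eq: "M = (X\<^sup>T * M)\<^sup>T * (X\<^sup>T * M)"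
proof -
  have XM: "X\<^sup>T * M \<in> carrier_mat n n" using M X by simp
  have "(X * (X\<^sup>T * M))\<^sup>T = (X\<^sup>T * M)\<^sup>T * X\<^sup>T" by (rule transpose_mult[OF X XM])
  then have 1: "(X\<^sup>T * M)\<^sup>T * X\<^sup>T = 1\<^sub>m n" unfolding inverse_X by simp
  have "(X\<^sup>T * M)\<^sup>T * (X\<^sup>T * M) = ((X\<^sup>T * M)\<^sup>T * X\<^sup>T) * M"
    by (rule assoc_mult_mat[symmetric, of _ n n _ n _ n]) (use M X XM in auto)
  then show ?thesis unfolding 1 using M by simp
qed

lemma real_M [simp]: "real_mat M"
proof -
  have "real_mat (X\<^sup>T * M)"
    by (rule real_mat_inverse[OF X _ real_X inverse_X]) (use M X in simp)
  then show ?thesis by (subst M_eq) simp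
qed

lemma gram_vec: assumes v: "dim_vec v = n" shows "X\<^sup>T *\<^sub>v (M *\<^sub>v (X *\<^sub>v v)) = v"
proof -
  have "X\<^sup>T *\<^sub>v (M *\<^sub>v (X *\<^sub>v v)) = (X\<^sup>T * (M * X)) *\<^sub>v v" by (simp add: mult_mat_mat_vec v)
  also have "\<dots> = v" unfolding gram using v by (intro one_mult_mat_vec carrier_vecI)
  finally show ?thesis .
qed

lemma diagonal_vec: assumes v: "dim_vec v = n" shows "X\<^sup>T *\<^sub>v (A *\<^sub>v (X *\<^sub>v v)) = cdiag n lam *\<^sub>v v"
  unfolding diagonal[symmetric] by (simp add: mult_mat_mat_vec v)

lemma expand_vec: assumes v: "dim_vec v = n" shows "X *\<^sub>v (X\<^sup>T *\<^sub>v (M *\<^sub>v v)) = v"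
proof -
  have "X *\<^sub>v (X\<^sup>T *\<^sub>v (M *\<^sub>v v)) = (X * (X\<^sup>T * M)) *\<^sub>v v" by (simp add: mult_mat_mat_vec v)
  also have "\<dots> = v" unfolding inverse_X using v by (intro one_mult_mat_vec carrier_vecI)
  finally show ?thesis .
qed

text \<open>\<open>X\<^sup>T * M\<close> maps a vector to its coordinates in the eigenbasis, and in
  these coordinates the inner product of M is Euclidean.\<close>

lemma energy_expand: "dim_vec v = n \<Longrightarrow> dim_vec w = n \<Longrightarrow>
  (M *\<^sub>v v) \<bullet>c w = (X\<^sup>T *\<^sub>v (M *\<^sub>v v)) \<bullet>c (X\<^sup>T *\<^sub>v (M *\<^sub>v w))"
  using csp_adjoint[of "X\<^sup>T" "M *\<^sub>v v" "X\<^sup>T *\<^sub>v (M *\<^sub>v w)"] by (simp add: expand_vec)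

context
  fixes P :: "nat \<Rightarrow> bool"
begin

lemma dim_select [simp]: "dim_row (select_cols P X) = n"
  "dim_col (select_cols P X) = length (picked P n)"
  by (simp_all add: select_cols_def)

lemma select_vec:
  assumes "dim_vec a = length (picked P n)"
  shows "select_cols P X *\<^sub>v a = X *\<^sub>v (selector P n *\<^sub>v a)"
  unfolding select_cols_mult[OF X] by (rule mult_mat_mat_vec) (simp_all add: assms)

lemma select_transpose_vec:
  assumes "dim_vec v = n"
  shows "(select_cols P X)\<^sup>T *\<^sub>v v = (selector P n)\<^sup>T *\<^sub>v (X\<^sup>T *\<^sub>v v)"
proof -
  have "(X * selector P n)\<^sup>T = (selector P n)\<^sup>T * X\<^sup>T"
    by (rule transpose_mult[OF X, of _ "length (picked P n)"]) (auto intro!: carrier_matI)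
  then show ?thesis unfolding select_cols_mult[OF X] using assms by (simp add: mult_mat_mat_vec)
qed

lemma real_select [simp]: "real_mat (select_cols P X)"
  unfolding select_cols_mult[OF X] by (rule real_mat_mult) simp_all

lemma select_diagonal_vec:
  assumes "dim_vec a = length (picked P n)"
  shows "(select_cols P X)\<^sup>T *\<^sub>v (A *\<^sub>v (select_cols P X *\<^sub>v a)) =
    cdiag (length (picked P n)) (\<lambda>r. lam (picked P n ! r)) *\<^sub>v a"
  using assms by (simp add: select_vec select_transpose_vec diagonal_vec selector_diagonal)

lemma select_gram_vec:
  assumes "dim_vec a = length (picked P n)"
  shows "(select_cols P X)\<^sup>T *\<^sub>v (M *\<^sub>v (select_cols P X *\<^sub>v a)) = a"
  using assms by (simp add: select_vec select_transpose_vec gram_vec selector_gram)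

end

context
  fixes P :: "nat \<Rightarrow> bool"
begin

lemma select_orthogonal_vec:
  assumes "dim_vec a = length (picked (\<lambda>j. \<not> P j) n)"
  shows "(select_cols P X)\<^sup>T *\<^sub>v (A *\<^sub>v (select_cols (\<lambda>j. \<not> P j) X *\<^sub>v a)) = 0\<^sub>v (length (picked P n))"
    and "(select_cols P X)\<^sup>T *\<^sub>v (M *\<^sub>v (select_cols (\<lambda>j. \<not> P j) X *\<^sub>v a)) = 0\<^sub>v (length (picked P n))"
  using assms selector_orthogonal[OF assms]
  by (simp_all add: select_vec select_transpose_vec diagonal_vec gram_vec)

lemma select_expand_vec:
  assumes "dim_vec v = n"
  shows "select_cols P X *\<^sub>v ((select_cols P X)\<^sup>T *\<^sub>v (M *\<^sub>v v)) +
    select_cols (\<lambda>j. \<not> P j) X *\<^sub>v ((select_cols (\<lambda>j. \<not> P j) X)\<^sup>T *\<^sub>v (M *\<^sub>v v)) = v"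
proof -
  have "X *\<^sub>v (selector P n *\<^sub>v ((selector P n)\<^sup>T *\<^sub>v (X\<^sup>T *\<^sub>v (M *\<^sub>v v)))
    + selector (\<lambda>j. \<not> P j) n *\<^sub>v ((selector (\<lambda>j. \<not> P j) n)\<^sup>T *\<^sub>v (X\<^sup>T *\<^sub>v (M *\<^sub>v v)))) = v"
    using assms by (subst selector_complete) (simp_all add: expand_vec)
  then show ?thesis
    using assms by (simp add: select_vec select_transpose_vec mult_mat_add_vec)
qed

end

end

section \<open>The matrices of one subdomain\<close>

lemma dim_form_mat [simp]: "dim_row (form_mat D a xs ys) = length xs" "dim_col (form_mat D a xs ys) = length ys"
  by (simp_all add: form_mat_def)

text \<open>Isolates what the linear algebra of one subdomain takes from the integrals: the coupling
  blocks are real and mutually transposed. Definiteness of the H-blocks enters through the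
  eigensystems.\<close>

locale local_problem =
  fixes D :: "'a::euclidean_space helmholtz_fem" and S :: spectral_data and i :: nat
  assumes B_GI: "B_GI D i = (B_IG D i)\<^sup>T" and real_B_IG: "real_mat (B_IG D i)"
    and H_GI: "H_GI D i = (H_IG D i)\<^sup>T" and real_H_IG: "real_mat (H_IG D i)"
    and beta: "0 < beta S" and eta: "0 < eta S"
    and eig_int: "real_eigensystem (B_II D i) (H_II D i) (ev_int S i) (X_int S i)"
    and eig_one: "real_eigensystem (re_mat (B0_loc D S i)) (H0_loc D S i) (ev_one S i) (X_one S i)"
    and eig_two: "real_eigensystem
          ((Q_one_perp S i)\<^sup>T * C0_loc D S i * Q_one_perp S i)
          ((Q_one_perp S i)\<^sup>T * H0_loc D S i * Q_one_perp S i)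
          (ev_two S i) (X_two S i)"
begin

abbreviation "BGG \<equiv> B_GG D i"
abbreviation "BGI \<equiv> B_GI D i"
abbreviation "BIG \<equiv> B_IG D i"
abbreviation "BII \<equiv> B_II D i"
abbreviation "HGG \<equiv> H_GG D i"
abbreviation "HGI \<equiv> H_GI D i"
abbreviation "HIG \<equiv> H_IG D i"
abbreviation "HII \<equiv> H_II D i"
abbreviation "BL \<equiv> B_L D S i"
abbreviation "HL \<equiv> H_L D S i"
abbreviation "B0 \<equiv> B0_loc D S i"
abbreviation "H0 \<equiv> H0_loc D S i"
abbreviation "C0 \<equiv> C0_loc D S i"
abbreviation "P0 \<equiv> BP1_loc D S i"
abbreviation "ReB0 \<equiv> re_mat B0"
abbreviation "nG \<equiv> length (nodes_Gamma_loc D i)"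
abbreviation "nI \<equiv> length (nodes_I_loc D i)"
abbreviation "nS \<equiv> k_loc S i"
abbreviation "nL \<equiv> dim_col (Q_L S i)"
abbreviation "QS \<equiv> Q_S S i"
abbreviation "QL \<equiv> Q_L S i"

lemma dim_blocks [simp]:
  "dim_row BGG = nG" "dim_col BGG = nG" "dim_row BIG = nI" "dim_col BIG = nG"
  "dim_row HGG = nG" "dim_col HGG = nG" "dim_row HIG = nI" "dim_col HIG = nG"
  by (simp_all add: B_GG_def B_IG_def H_GG_def H_IG_def)

sublocale int: eigensystem "BII" "HII" "X_int S i" "ev_int S i" nI
  by unfold_locales (rule eig_int, auto simp: B_II_def H_II_def intro!: carrier_matI)

definition "evL r = ev_int S i (filter (\<lambda>j. \<not> \<bar>ev_int S i j\<bar> < beta S) [0..<nI] ! r)"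

lemma dim_QS [simp]: "dim_row QS = nI" "dim_col QS = nS"
  by (simp_all add: k_loc_def) (simp add: Q_S_def)

lemma dim_QL [simp]: "dim_row QL = nI"
  by (simp add: Q_L_def)

lemma QL_carrier: "QL \<in> carrier_mat nI nL"
  by (rule carrier_matI) simp_all

lemma nS_eq: "nS = length (filter (\<lambda>j. \<bar>ev_int S i j\<bar> < beta S) [0..<nI])"
  by (simp add: k_loc_def Q_S_def)

lemma nL_eq: "nL = length (filter (\<lambda>j. \<not> \<bar>ev_int S i j\<bar> < beta S) [0..<nI])"
  by (simp add: Q_L_def)

lemma real_Q [simp]: "real_mat QS" "real_mat QL"
  by (simp_all add: Q_S_def Q_L_def)

lemma QS_H_QS: "dim_vec a = nS \<Longrightarrow> QS\<^sup>T *\<^sub>v (HII *\<^sub>v (QS *\<^sub>v a)) = a"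
  unfolding nS_eq Q_S_def by (rule int.select_gram_vec)

lemma QL_H_QL: "dim_vec a = nL \<Longrightarrow> QL\<^sup>T *\<^sub>v (HII *\<^sub>v (QL *\<^sub>v a)) = a"
  unfolding nL_eq unfolding Q_L_def by (rule int.select_gram_vec)

lemma QS_QL:
  assumes "dim_vec a = nL"
  shows "QS\<^sup>T *\<^sub>v (BII *\<^sub>v (QL *\<^sub>v a)) = 0\<^sub>v nS" "QS\<^sup>T *\<^sub>v (HII *\<^sub>v (QL *\<^sub>v a)) = 0\<^sub>v nS"
  using int.select_orthogonal_vec[of a "\<lambda>j. \<bar>ev_int S i j\<bar> < beta S"] assms
  by (simp_all only: nS_eq nL_eq Q_S_def[symmetric] Q_L_def[symmetric])

lemma QL_B_QS:
  assumes "dim_vec a = nS"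
  shows "QL\<^sup>T *\<^sub>v (BII *\<^sub>v (QS *\<^sub>v a)) = 0\<^sub>v nL"
  using int.select_orthogonal_vec(1)[of a "\<lambda>j. \<not> \<bar>ev_int S i j\<bar> < beta S"] assms
  by (simp only: nS_eq nL_eq Q_S_def[symmetric] Q_L_def[symmetric] not_not)

lemma QL_B_QL: "dim_vec a = nL \<Longrightarrow> QL\<^sup>T *\<^sub>v (BII *\<^sub>v (QL *\<^sub>v a)) = cdiag nL evL *\<^sub>v a"
  using int.select_diagonal_vec[of a "\<lambda>j. \<not> \<bar>ev_int S i j\<bar> < beta S"]
  by (simp only: nL_eq Q_L_def[symmetric] evL_def[abs_def])

lemma expand: "dim_vec u = nI \<Longrightarrow> QS *\<^sub>v (QS\<^sup>T *\<^sub>v (HII *\<^sub>v u)) + QL *\<^sub>v (QL\<^sup>T *\<^sub>v (HII *\<^sub>v u)) = u"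
  unfolding Q_S_def Q_L_def by (rule int.select_expand_vec)

text \<open>Unselected eigenvalues are at least \<open>beta S\<close> in modulus, and the threshold
  is positive; hence \<open>B_i\<close> is invertible.\<close>

lemma evL_nonzero: assumes "r < nL" shows "evL r \<noteq> 0"
proof -
  have "\<not> \<bar>evL r\<bar> < beta S"
    using nth_mem[of r "filter (\<lambda>j. \<not> \<bar>ev_int S i j\<bar> < beta S) [0..<nI]"] assms
    unfolding evL_def nL_eq by simp
  then show ?thesis using beta by auto
qed

lemma B_i_eq: "B_i D S i = cdiag nL evL"
  by (rule mat_eq_of_mult_vec) (simp_all add: B_i_def mult_mat_mat_vec QL_B_QL)

lemma inv_B_i: "inv_mat (B_i D S i) = cdiag nL (\<lambda>r. 1 / evL r)"
  unfolding B_i_eq using evL_nonzero by (rule inv_mat_cdiag)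

lemma B_L_eq: "BL = QL * cdiag nL (\<lambda>r. 1 / evL r) * QL\<^sup>T"
  by (simp add: B_L_def inv_B_i)

text \<open>The columns of Q_L are orthonormal with respect to H_II, so the matrix inverted in
  \<open>H_L\<close> is the identity.\<close>

lemma H_L_eq: "HL = QL * QL\<^sup>T"
proof -
  have 1: "QL\<^sup>T * HII * QL = cdiag nL (\<lambda>_. 1)"
    unfolding cdiag_one
    by (rule mat_eq_of_mult_vec)
      (simp_all add: mult_mat_mat_vec QL_H_QL one_mult_mat_vec[OF carrier_vecI])
  have "inv_mat (QL\<^sup>T * HII * QL) = 1\<^sub>m nL"
    unfolding 1 by (subst inv_mat_cdiag) (simp_all add: cdiag_one)
  then have "HL = QL * 1\<^sub>m nL * QL\<^sup>T" by (simp only: H_L_def)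
  then show ?thesis by (simp only: right_mult_one_mat[OF QL_carrier])
qed

lemma dim_L [simp]: "dim_row BL = nI" "dim_col BL = nI" "dim_row HL = nI" "dim_col HL = nI"
  by (simp_all add: B_L_eq H_L_eq)

lemma B_L_vec: "dim_vec w = nI \<Longrightarrow> BL *\<^sub>v w = QL *\<^sub>v (cdiag nL (\<lambda>r. 1 / evL r) *\<^sub>v (QL\<^sup>T *\<^sub>v w))"
  by (simp add: B_L_eq mult_mat_mat_vec)

lemma H_L_vec: "dim_vec w = nI \<Longrightarrow> HL *\<^sub>v w = QL *\<^sub>v (QL\<^sup>T *\<^sub>v w)"
  by (simp add: H_L_eq mult_mat_mat_vec)

lemma real_B_L [simp]: "real_mat BL"
  by (simp add: B_L_eq)

lemma transpose_B_L: "BL\<^sup>T = BL"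
proof -
  let ?C = "cdiag nL (\<lambda>r. 1 / evL r)"
  have C: "QL * ?C \<in> carrier_mat nI nL" by (rule mult_carrier_mat[OF QL_carrier cdiag_carrier])
  have T: "QL\<^sup>T \<in> carrier_mat nL nI" using QL_carrier by (simp only: transpose_carrier_mat)
  have "(QL * ?C * QL\<^sup>T)\<^sup>T = QL * (?C * QL\<^sup>T)"
    by (simp only: transpose_mult[OF C T] transpose_mult[OF QL_carrier cdiag_carrier]
        Matrix.transpose_transpose transpose_cdiag)
  also have "\<dots> = QL * ?C * QL\<^sup>T"
    by (rule assoc_mult_mat[symmetric, OF QL_carrier cdiag_carrier T])
  finally show ?thesis unfolding B_L_eq .
qed

definition extend :: "cvec \<Rightarrow> cvec \<Rightarrow> cvec" where
  "extend uG \<alpha> = QS *\<^sub>v \<alpha> - BL *\<^sub>v (BIG *\<^sub>v uG)"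

text \<open>By orthonormality of the eigenvectors, the second block consists of the Q_S-coordinates
  of \<open>uI\<close>; the Q_L-coordinates are discarded. The result is the local coarse vector of
  an arbitrary local function.\<close>

definition coarse :: "cvec \<Rightarrow> cvec \<Rightarrow> cvec" where
  "coarse uG uI = uG @\<^sub>v (QS\<^sup>T *\<^sub>v (HII *\<^sub>v uI))"

definition b_loc :: "cvec \<Rightarrow> cvec \<Rightarrow> cvec \<Rightarrow> cvec \<Rightarrow> complex" where
  "b_loc uG uI wG wI = (BGG *\<^sub>v uG + BGI *\<^sub>v uI) \<bullet>c wG + (BIG *\<^sub>v uG + BII *\<^sub>v uI) \<bullet>c wI"

definition h_loc :: "cvec \<Rightarrow> cvec \<Rightarrow> cvec \<Rightarrow> cvec \<Rightarrow> complex" where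
  "h_loc uG uI wG wI = (HGG *\<^sub>v uG + HGI *\<^sub>v uI) \<bullet>c wG + (HIG *\<^sub>v uG + HII *\<^sub>v uI) \<bullet>c wI"

lemma dim_extend [simp]: "dim_vec (extend uG \<alpha>) = nI"
  by (simp add: extend_def)

lemma dim_coarse [simp]: "dim_vec (coarse uG uI) = dim_vec uG + nS"
  by (simp add: coarse_def)

text \<open>The range of B_L lies in the span of Q_L, which is H-orthogonal to Q_S, so the
  harmonic-like part of the extension leaves no trace in the coordinates.\<close>

lemma coarse_extend:
  assumes "dim_vec uG = nG" "dim_vec \<alpha> = nS"
  shows "coarse uG (extend uG \<alpha>) = uG @\<^sub>v \<alpha>"
  using assms QS_QL(2)
  by (simp add: coarse_def extend_def mult_mat_minus_vec QS_H_QS B_L_vec zero_vec_simps)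

lemma dim_B0 [simp]: "dim_row B0 = nG + nS" "dim_col B0 = nG + nS"
  by (simp_all add: B0_loc_def B_GI)

lemma dim_H0 [simp]: "dim_row H0 = nG + nS" "dim_col H0 = nG + nS"
  by (simp_all add: H0_loc_def H_hat_def H_GI)

lemma dim_C0 [simp]: "dim_row C0 = nG + nS" "dim_col C0 = nG + nS"
  by (simp_all add: C0_loc_def C_hat_def Let_def)

text \<open>The form of \<open>B0\<close> multiplied out; it is the common target of the
  computations with an extension in the first and in the second argument.\<close>

definition coarse_form ::
    "cvec \<Rightarrow> cvec \<Rightarrow> cvec \<Rightarrow> cvec \<Rightarrow> complex" where
  "coarse_form uG \<alpha> wG \<alpha>' =
    (BGG *\<^sub>v uG) \<bullet>c wG - (BGI *\<^sub>v (BL *\<^sub>v (BIG *\<^sub>v uG))) \<bullet>c wG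
    + (BGI *\<^sub>v (QS *\<^sub>v \<alpha>)) \<bullet>c wG
    + (QS\<^sup>T *\<^sub>v (BIG *\<^sub>v uG)) \<bullet>c \<alpha>' + (QS\<^sup>T *\<^sub>v (BII *\<^sub>v (QS *\<^sub>v \<alpha>))) \<bullet>c \<alpha>'"

lemma B0_csp:
  assumes "dim_vec uG = nG" "dim_vec \<alpha> = nS" "dim_vec wG = nG" "dim_vec \<alpha>' = nS"
  shows "(B0 *\<^sub>v (uG @\<^sub>v \<alpha>)) \<bullet>c (wG @\<^sub>v \<alpha>') = coarse_form uG \<alpha> wG \<alpha>'"
  unfolding B0_loc_def coarse_form_def using assms
  by (subst four_block_mult_append, simp_all add: B_GI, subst csp_append,
      simp_all add: csp_add_left csp_minus_left minus_mat_mult_vec mult_mat_mat_vec)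

lemma H0_csp:
  assumes "dim_vec uG = nG" "dim_vec \<alpha> = nS" "dim_vec wG = nG" "dim_vec \<alpha>' = nS"
  shows "(H0 *\<^sub>v (uG @\<^sub>v \<alpha>)) \<bullet>c (wG @\<^sub>v \<alpha>') =
    (HGG *\<^sub>v uG) \<bullet>c wG - (HGI *\<^sub>v (QL *\<^sub>v (QL\<^sup>T *\<^sub>v (HIG *\<^sub>v uG)))) \<bullet>c wG
    + (HGI *\<^sub>v (QS *\<^sub>v \<alpha>)) \<bullet>c wG
    + (QS\<^sup>T *\<^sub>v (HIG *\<^sub>v uG)) \<bullet>c \<alpha>' + \<alpha> \<bullet>c \<alpha>'"
  unfolding H0_loc_def H_hat_def using assms
  by (subst four_block_mult_append, simp_all add: H_GI, subst csp_append,
      simp_all add: csp_add_left csp_minus_left minus_mat_mult_vec mult_mat_mat_vec H_L_vec QS_H_QS)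

text \<open>B_L annihilates the Q_S-part of B_II \<open>uI\<close> and inverts the Q_L-part, so the
  local solver recovers exactly what separates \<open>uI\<close> from the extension of its coarse
  coordinates.\<close>

lemma B_L_residual:
  assumes "dim_vec uG = nG" "dim_vec uI = nI"
  shows "BL *\<^sub>v (BIG *\<^sub>v uG + BII *\<^sub>v uI) = uI - extend uG (QS\<^sup>T *\<^sub>v (HII *\<^sub>v uI))"
proof -
  define \<alpha> c where "\<alpha> = QS\<^sup>T *\<^sub>v (HII *\<^sub>v uI)" and "c = QL\<^sup>T *\<^sub>v (HII *\<^sub>v uI)"
  have d: "dim_vec \<alpha> = nS" "dim_vec c = nL" by (simp_all add: \<alpha>_def c_def)
  have uI: "uI = QS *\<^sub>v \<alpha> + QL *\<^sub>v c" using expand[OF assms(2)] by (simp add: \<alpha>_def c_def)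
  have "QL\<^sup>T *\<^sub>v (BII *\<^sub>v uI) = cdiag nL evL *\<^sub>v c"
    unfolding uI using d by (simp add: mult_mat_add_vec QL_B_QS QL_B_QL zero_vec_simps)
  then have "BL *\<^sub>v (BII *\<^sub>v uI) = QL *\<^sub>v c"
    using d evL_nonzero by (simp add: B_L_vec cdiag_mult_cdiag)
  then have "BL *\<^sub>v (BIG *\<^sub>v uG + BII *\<^sub>v uI) = BL *\<^sub>v (BIG *\<^sub>v uG) + QL *\<^sub>v c"
    using assms by (simp add: mult_mat_add_vec)
  also have "\<dots> = uI - extend uG \<alpha>"
    unfolding uI extend_def by (rule eq_vecI) auto
  finally show ?thesis by (simp add: \<alpha>_def)
qed

text \<open>The Q_L-components of \<open>uI\<close> enter twice, through the boundary row and
  through the B_L-part of the extended test function, with opposite signs. They cancel, and only the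
  coarse coordinates of u remain.\<close>

lemma b_loc_extend_right:
  assumes "dim_vec uG = nG" "dim_vec uI = nI" "dim_vec wG = nG" "dim_vec \<alpha>' = nS"
  shows "b_loc uG uI wG (extend wG \<alpha>') = (B0 *\<^sub>v coarse uG uI) \<bullet>c (wG @\<^sub>v \<alpha>')"
proof -
  define \<alpha> c where "\<alpha> = QS\<^sup>T *\<^sub>v (HII *\<^sub>v uI)" and "c = QL\<^sup>T *\<^sub>v (HII *\<^sub>v uI)"
  have d: "dim_vec \<alpha> = nS" "dim_vec c = nL" by (simp_all add: \<alpha>_def c_def)
  have uI: "uI = QS *\<^sub>v \<alpha> + QL *\<^sub>v c" using expand[OF assms(2)] by (simp add: \<alpha>_def c_def)
  define x where "x = BIG *\<^sub>v uG + BII *\<^sub>v uI"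
  have dx: "dim_vec x = nI" by (simp add: x_def)
  have "BL *\<^sub>v x = uI - extend uG \<alpha>"
    using B_L_residual[OF assms(1,2)] by (simp add: x_def \<alpha>_def)
  then have BLx: "BL *\<^sub>v x = BL *\<^sub>v (BIG *\<^sub>v uG) + QL *\<^sub>v c"
    unfolding uI extend_def by (auto intro!: eq_vecI)
  have QSx: "QS\<^sup>T *\<^sub>v x = QS\<^sup>T *\<^sub>v (BIG *\<^sub>v uG) + QS\<^sup>T *\<^sub>v (BII *\<^sub>v (QS *\<^sub>v \<alpha>))"
    unfolding x_def uI using d assms by (simp add: mult_mat_add_vec QS_QL zero_vec_simps)
  have "x \<bullet>c (QS *\<^sub>v \<alpha>') = (QS\<^sup>T *\<^sub>v x) \<bullet>c \<alpha>'"
    using csp_adjoint[of "QS\<^sup>T" x \<alpha>'] assms dx by simp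
  moreover have "x \<bullet>c (BL *\<^sub>v (BIG *\<^sub>v wG)) = (BL *\<^sub>v x) \<bullet>c (BIG *\<^sub>v wG)"
    using csp_adjoint[of "BL" x "BIG *\<^sub>v wG"] dx by (simp add: transpose_B_L)
  moreover have "(BL *\<^sub>v x) \<bullet>c (BIG *\<^sub>v wG) = (BGI *\<^sub>v (BL *\<^sub>v x)) \<bullet>c wG"
    using csp_adjoint[of "BIG\<^sup>T" "BL *\<^sub>v x" wG] assms real_B_IG by (simp add: B_GI)
  ultimately have "x \<bullet>c extend wG \<alpha>' = (QS\<^sup>T *\<^sub>v x) \<bullet>c \<alpha>' - (BGI *\<^sub>v (BL *\<^sub>v x)) \<bullet>c wG"
    unfolding extend_def using dx assms by (simp add: csp_minus_right)
  \<comment> \<open>The last term here and the last term of the next equation are the two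
    contributions that cancel.\<close>
  moreover have "BGI *\<^sub>v (BL *\<^sub>v x) =
      BGI *\<^sub>v (BL *\<^sub>v (BIG *\<^sub>v uG)) + BGI *\<^sub>v (QL *\<^sub>v c)"
    unfolding BLx using d by (simp add: mult_mat_add_vec B_GI)
  moreover have "BGI *\<^sub>v uI = BGI *\<^sub>v (QS *\<^sub>v \<alpha>) + BGI *\<^sub>v (QL *\<^sub>v c)"
    unfolding uI using d by (simp add: mult_mat_add_vec B_GI)
  ultimately have "b_loc uG uI wG (extend wG \<alpha>') = coarse_form uG \<alpha> wG \<alpha>'"
    unfolding b_loc_def coarse_form_def x_def[symmetric] using assms dx d
    by (simp add: QSx csp_add_left B_GI)
  then show ?thesis using B0_csp[OF assms(1) d(1) assms(3,4)] by (simp add: coarse_def \<alpha>_def)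
qed

text \<open>The interior residual of an extended function is orthogonal to Q_L, so an arbitrary test
  function is seen only through its boundary values and Q_S-coordinates.\<close>

lemma b_loc_extend_left:
  assumes "dim_vec uG = nG" "dim_vec \<alpha> = nS" "dim_vec wG = nG" "dim_vec wI = nI"
  shows "b_loc uG (extend uG \<alpha>) wG wI = (B0 *\<^sub>v (uG @\<^sub>v \<alpha>)) \<bullet>c coarse wG wI"
proof -
  define \<alpha>' c' where "\<alpha>' = QS\<^sup>T *\<^sub>v (HII *\<^sub>v wI)" and "c' = QL\<^sup>T *\<^sub>v (HII *\<^sub>v wI)"
  have d: "dim_vec \<alpha>' = nS" "dim_vec c' = nL" by (simp_all add: \<alpha>'_def c'_def)
  have wI: "wI = QS *\<^sub>v \<alpha>' + QL *\<^sub>v c'" using expand[OF assms(4)] by (simp add: \<alpha>'_def c'_def)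
  define x where "x = BIG *\<^sub>v uG + BII *\<^sub>v extend uG \<alpha>"
  have dx: "dim_vec x = nI" by (simp add: x_def)
  have "QL\<^sup>T *\<^sub>v x = QL\<^sup>T *\<^sub>v (BIG *\<^sub>v uG) + (0\<^sub>v nL - QL\<^sup>T *\<^sub>v (BIG *\<^sub>v uG))"
    unfolding x_def extend_def using assms evL_nonzero
    by (simp add: mult_mat_add_vec mult_mat_minus_vec QL_B_QS B_L_vec QL_B_QL cdiag_mult_cdiag)
  also have "\<dots> = 0\<^sub>v nL" by (rule eq_vecI) auto
  finally have QLx: "QL\<^sup>T *\<^sub>v x = 0\<^sub>v nL" .
  have "QS\<^sup>T *\<^sub>v x = QS\<^sup>T *\<^sub>v (BIG *\<^sub>v uG) + (QS\<^sup>T *\<^sub>v (BII *\<^sub>v (QS *\<^sub>v \<alpha>)) - 0\<^sub>v nS)"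
    unfolding x_def extend_def using assms
    by (simp add: mult_mat_add_vec mult_mat_minus_vec B_L_vec QS_QL)
  also have "\<dots> = QS\<^sup>T *\<^sub>v (BIG *\<^sub>v uG) + QS\<^sup>T *\<^sub>v (BII *\<^sub>v (QS *\<^sub>v \<alpha>))"
    by (rule eq_vecI) auto
  finally have QSx: "QS\<^sup>T *\<^sub>v x = QS\<^sup>T *\<^sub>v (BIG *\<^sub>v uG) + QS\<^sup>T *\<^sub>v (BII *\<^sub>v (QS *\<^sub>v \<alpha>))" .
  have "x \<bullet>c wI = (QS\<^sup>T *\<^sub>v x) \<bullet>c \<alpha>' + (QL\<^sup>T *\<^sub>v x) \<bullet>c c'"
    unfolding wI using csp_adjoint[of "QS\<^sup>T" x \<alpha>'] csp_adjoint[of "QL\<^sup>T" x c'] dx d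
    by (simp add: csp_add_right)
  also have "\<dots> = (QS\<^sup>T *\<^sub>v x) \<bullet>c \<alpha>'" unfolding QLx using d csp_zero_left[of c'] by simp
  finally have "b_loc uG (extend uG \<alpha>) wG wI = coarse_form uG \<alpha> wG \<alpha>'"
    unfolding b_loc_def coarse_form_def x_def[symmetric] using assms dx d
    by (simp add: QSx csp_add_left csp_minus_left extend_def mult_mat_minus_vec B_GI)
  then show ?thesis using B0_csp[OF assms(1-3) d(1)] by (simp add: coarse_def \<alpha>'_def)
qed

text \<open>Completing the square in the \<open>Q\<^sub>L\<close>-coordinates of \<open>u\<^sub>I\<close>.\<close>

lemma h_loc_energy:
  assumes "dim_vec uG = nG" "dim_vec uI = nI"
  shows "Re ((H0 *\<^sub>v coarse uG uI) \<bullet>c coarse uG uI) \<le> Re (h_loc uG uI uG uI)"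
proof -
  define \<alpha> c where "\<alpha> = QS\<^sup>T *\<^sub>v (HII *\<^sub>v uI)" and "c = QL\<^sup>T *\<^sub>v (HII *\<^sub>v uI)"
  define p where "p = QL\<^sup>T *\<^sub>v (HIG *\<^sub>v uG)"
  have d: "dim_vec \<alpha> = nS" "dim_vec c = nL" "dim_vec p = nL" by (simp_all add: \<alpha>_def c_def p_def)
  have uI: "uI = QS *\<^sub>v \<alpha> + QL *\<^sub>v c" using expand[OF assms(2)] by (simp add: \<alpha>_def c_def)
  have GI: "(HGI *\<^sub>v (QL *\<^sub>v y)) \<bullet>c uG = y \<bullet>c p" if "dim_vec y = nL" for y
    using csp_adjoint[of "HIG\<^sup>T" "QL *\<^sub>v y" uG] csp_adjoint[of QL y "HIG *\<^sub>v uG"] that assms real_H_IG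
    by (simp add: H_GI p_def)
  have 1: "(HGI *\<^sub>v uI) \<bullet>c uG = (HGI *\<^sub>v (QS *\<^sub>v \<alpha>)) \<bullet>c uG + c \<bullet>c p"
  proof -
    have "HGI *\<^sub>v uI = HGI *\<^sub>v (QS *\<^sub>v \<alpha>) + HGI *\<^sub>v (QL *\<^sub>v c)"
      unfolding uI using d by (simp add: mult_mat_add_vec H_GI)
    then show ?thesis using assms d GI[of c] by (simp add: csp_add_left H_GI)
  qed
  have split: "x \<bullet>c uI = (QS\<^sup>T *\<^sub>v x) \<bullet>c \<alpha> + (QL\<^sup>T *\<^sub>v x) \<bullet>c c" if "dim_vec x = nI" for x
    using csp_adjoint[of "QS\<^sup>T" x \<alpha>] csp_adjoint[of "QL\<^sup>T" x c] d that
      csp_add_right[of "QS *\<^sub>v \<alpha>" "QL *\<^sub>v c" x]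
    by (simp flip: uI)
  have 2: "(HIG *\<^sub>v uG) \<bullet>c uI = (QS\<^sup>T *\<^sub>v (HIG *\<^sub>v uG)) \<bullet>c \<alpha> + p \<bullet>c c"
    using split[of "HIG *\<^sub>v uG"] by (simp add: p_def)
  have 3: "(HII *\<^sub>v uI) \<bullet>c uI = \<alpha> \<bullet>c \<alpha> + c \<bullet>c c"
    using split[of "HII *\<^sub>v uI"] by (simp add: \<alpha>_def c_def)
  have "h_loc uG uI uG uI = (H0 *\<^sub>v (uG @\<^sub>v \<alpha>)) \<bullet>c (uG @\<^sub>v \<alpha>) + (c + p) \<bullet>c (c + p)"
    unfolding h_loc_def H0_csp[OF assms(1) d(1) assms(1) d(1)] p_def[symmetric]
    using assms d GI[of p] 1 2 3
    by (simp add: csp_add_left csp_add_right H_GI)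
  then show ?thesis by (simp add: coarse_def \<alpha>_def csp_self)
qed

end

section \<open>Spectral selection and the perturbation of the local coarse matrix\<close>

context local_problem
begin

abbreviation "m \<equiv> nG + nS"
abbreviation "Q1 \<equiv> Q_one S i"
abbreviation "Qp \<equiv> Q_one_perp S i"
abbreviation "np \<equiv> dim_col Qp"
abbreviation "\<Phi>2 \<equiv> select_cols (\<lambda>j. outside (eta S) (ev_two S i j)) (X_two S i)"
abbreviation "\<Phi>3 \<equiv> select_cols (\<lambda>j. \<not> outside (eta S) (ev_two S i j)) (X_two S i)"

sublocale one: eigensystem "ReB0" "H0" "X_one S i" "ev_one S i" m
  by unfold_locales (rule eig_one, rule carrier_matI, simp_all add: re_mat_def, rule carrier_matI, simp_all)

lemma dim_Q1 [simp]: "dim_row Q1 = m" "dim_row Qp = m"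
  by (simp_all add: Q_one_def Q_one_perp_def)

lemma real_Q1 [simp]: "real_mat Q1" "real_mat Qp"
  by (simp_all add: Q_one_def Q_one_perp_def)

sublocale two: eigensystem "Qp\<^sup>T * C0 * Qp" "Qp\<^sup>T * H0 * Qp" "X_two S i" "ev_two S i" np
  by unfold_locales (rule eig_two, (rule carrier_matI, simp_all)+)

lemma np_eq: "np = length (filter (\<lambda>j. \<not> outside (eta S) (ev_one S i j)) [0..<m])"
  by (simp add: Q_one_perp_def)

lemma Qp_gram: "dim_vec w = np \<Longrightarrow> Qp\<^sup>T *\<^sub>v (H0 *\<^sub>v (Qp *\<^sub>v w)) = w"
  unfolding np_eq unfolding Q_one_perp_def by (rule one.select_gram_vec)

text \<open>The first-step eigenvectors are \<open>H0\<close>-orthonormal, so the second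
  eigenproblem has the identity on its right side and its eigenvectors are orthonormal in the
  Euclidean sense.\<close>

lemma two_M_vec: "dim_vec w = np \<Longrightarrow> (Qp\<^sup>T * H0 * Qp) *\<^sub>v w = w"
  by (simp add: mult_mat_mat_vec Qp_gram)

definition "ev1 r = ev_one S i (filter (\<lambda>j. \<not> outside (eta S) (ev_one S i j)) [0..<m] ! r)"
definition "ev2 r = ev_two S i (filter (\<lambda>j. \<not> outside (eta S) (ev_two S i j)) [0..<np] ! r)"

lemma ev1_near_one: "r < np \<Longrightarrow> \<bar>ev1 r - 1\<bar> \<le> eta S"
  using nth_mem[of r "filter (\<lambda>j. \<not> outside (eta S) (ev_one S i j)) [0..<m]"]
  unfolding np_eq by (auto simp: ev1_def outside_def)

lemma ev2_near_one: "r < dim_col \<Phi>3 \<Longrightarrow> \<bar>ev2 r - 1\<bar> \<le> eta S"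
  using nth_mem[of r "filter (\<lambda>j. \<not> outside (eta S) (ev_two S i j)) [0..<np]"]
  by (auto simp: ev2_def outside_def)

lemma Qp_diagonal: "dim_vec w = np \<Longrightarrow> Qp\<^sup>T *\<^sub>v (ReB0 *\<^sub>v (Qp *\<^sub>v w)) = cdiag np ev1 *\<^sub>v w"
  using one.select_diagonal_vec[of w "\<lambda>j. \<not> outside (eta S) (ev_one S i j)"]
  by (simp only: np_eq Q_one_perp_def[symmetric] ev1_def[abs_def])

lemma Phi3_diagonal:
  assumes "dim_vec b = dim_col \<Phi>3"
  shows "\<Phi>3\<^sup>T *\<^sub>v (Qp\<^sup>T *\<^sub>v (C0 *\<^sub>v (Qp *\<^sub>v (\<Phi>3 *\<^sub>v b)))) = cdiag (dim_col \<Phi>3) ev2 *\<^sub>v b"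
  using two.select_diagonal_vec[of b "\<lambda>j. \<not> outside (eta S) (ev_two S i j)"] assms
  by (simp add: mult_mat_mat_vec ev2_def[abs_def])

lemma Phi3_gram: "dim_vec b = dim_col \<Phi>3 \<Longrightarrow> \<Phi>3\<^sup>T *\<^sub>v (\<Phi>3 *\<^sub>v b) = b"
  using two.select_gram_vec[of b "\<lambda>j. \<not> outside (eta S) (ev_two S i j)"]
  by (simp add: two_M_vec)

lemma Phi_expand: "dim_vec w = np \<Longrightarrow> \<Phi>2 *\<^sub>v (\<Phi>2\<^sup>T *\<^sub>v w) + \<Phi>3 *\<^sub>v (\<Phi>3\<^sup>T *\<^sub>v w) = w"
  using two.select_expand_vec[of w "\<lambda>j. outside (eta S) (ev_two S i j)"]
  by (simp add: two_M_vec)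

definition "complement = 1\<^sub>m m - Pi_Re D S i"

text \<open>The coordinates of (I - Pi_Re) x with respect to the vectors that neither selection step
  picks.\<close>

definition "perp_coeff x = \<Phi>3\<^sup>T *\<^sub>v (Qp\<^sup>T *\<^sub>v (H0 *\<^sub>v x))"

text \<open>The norm induced by \<open>H0\<close>, written as the Euclidean norm of the coordinates
  in the first eigensystem.\<close>

definition "h0_norm x = vnorm ((X_one S i)\<^sup>T *\<^sub>v (H0 *\<^sub>v x))"

lemma dim_Q_two [simp]: "dim_row (Q_two S i) = m" "dim_col (Q_two S i) = dim_col \<Phi>2"
  by (simp_all add: Q_two_def)

lemma real_Q_two [simp]: "real_mat (Q_two S i)"
  by (simp add: Q_two_def)

lemma dim_Pi [simp]: "dim_row (Q_Re S i) = m" "dim_row (Pi_Re D S i) = m" "dim_col (Pi_Re D S i) = m"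
  by (simp_all add: Pi_Re_def Q_Re_def)

lemma dim_complement [simp]: "dim_row complement = m" "dim_col complement = m"
  by (simp_all add: complement_def)

lemma real_complement [simp]: "real_mat complement"
proof -
  have "real_mat (Q_Re S i)"
  proof (rule real_matI)
    fix r c assume "r < dim_row (Q_Re S i)" "c < dim_col (Q_Re S i)"
    then have rc: "r < m" "c < dim_col Q1 + dim_col (Q_two S i)" by (simp_all add: Q_Re_def)
    have "Q_Re S i $$ (r,c) = (if c < dim_col Q1 then Q1 $$ (r,c) else Q_two S i $$ (r, c - dim_col Q1))"
      unfolding Q_Re_def using rc by (subst mat_of_cols_index) (auto simp: nth_append)
    then show "Q_Re S i $$ (r,c) \<in> \<real>"
      using real_Q1(1) real_Q_two rc by (auto simp: real_mat_def)
  qed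
  then show ?thesis by (simp add: complement_def Pi_Re_def)
qed

text \<open>The identity is split first by the two column groups of step one, then Qp by the two
  column groups of step two; Pi_Re accounts for all but the last of the three parts.\<close>

lemma complement_vec:
  assumes x: "dim_vec x = m"
  shows "complement *\<^sub>v x = Qp *\<^sub>v (\<Phi>3 *\<^sub>v perp_coeff x)"
proof -
  define w y where "w = Qp\<^sup>T *\<^sub>v (H0 *\<^sub>v x)" and "y = Q1\<^sup>T *\<^sub>v (H0 *\<^sub>v x)"
  have d: "dim_vec w = np" "dim_vec y = dim_col Q1" by (simp_all add: w_def y_def)
  have "Q_two S i *\<^sub>v ((Q_two S i)\<^sup>T *\<^sub>v (H0 *\<^sub>v x)) = Qp *\<^sub>v (\<Phi>2 *\<^sub>v (\<Phi>2\<^sup>T *\<^sub>v w))"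
  proof -
    have "(Q_two S i)\<^sup>T = \<Phi>2\<^sup>T * Qp\<^sup>T"
      unfolding Q_two_def by (rule transpose_mult[of _ m np _ "dim_col \<Phi>2"]; rule carrier_matI) simp_all
    then show ?thesis by (simp add: Q_two_def mult_mat_mat_vec w_def)
  qed
  then have Pi: "Pi_Re D S i *\<^sub>v x = Q1 *\<^sub>v y + Qp *\<^sub>v (\<Phi>2 *\<^sub>v (\<Phi>2\<^sup>T *\<^sub>v w))"
    using mat_of_cols_append_mult[of Q1 m "Q_two S i"] x
    by (simp add: Pi_Re_def mult_mat_mat_vec Q_Re_def y_def)
  have "Q1 *\<^sub>v y + Qp *\<^sub>v w = x"
    using one.select_expand_vec[of x "\<lambda>j. outside (eta S) (ev_one S i j)"] x
    by (simp add: w_def y_def Q_one_def Q_one_perp_def)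
  moreover have "Qp *\<^sub>v w = Qp *\<^sub>v (\<Phi>2 *\<^sub>v (\<Phi>2\<^sup>T *\<^sub>v w)) + Qp *\<^sub>v (\<Phi>3 *\<^sub>v (\<Phi>3\<^sup>T *\<^sub>v w))"
    by (subst Phi_expand[OF d(1), symmetric], subst mult_mat_add_vec) (simp_all add: d)
  moreover have aux: "x - (a + b) = c"
    if "x = a + (b + c)" "dim_vec a = m" "dim_vec b = m" "dim_vec c = m" for a b c
    unfolding that(1) using that(2-4) by (intro eq_vecI) auto
  ultimately have "x = Q1 *\<^sub>v y + (Qp *\<^sub>v (\<Phi>2 *\<^sub>v (\<Phi>2\<^sup>T *\<^sub>v w)) + Qp *\<^sub>v (\<Phi>3 *\<^sub>v perp_coeff x))"
    by (simp add: perp_coeff_def w_def)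
  then have "x - Pi_Re D S i *\<^sub>v x = Qp *\<^sub>v (\<Phi>3 *\<^sub>v perp_coeff x)"
    unfolding Pi by (rule aux) simp_all
  then show ?thesis
    using x one_mult_mat_vec[OF carrier_vecI[OF x]] by (simp add: complement_def minus_mat_mult_vec)
qed

lemma h0_norm_square:
  "dim_vec x = m \<Longrightarrow> (H0 *\<^sub>v x) \<bullet>c x = complex_of_real ((h0_norm x)\<^sup>2)"
  by (subst one.energy_expand) (simp_all add: csp_self h0_norm_def)

lemma h0_norm_nonneg [simp]: "0 \<le> h0_norm x"
  by (simp add: h0_norm_def)

text \<open>Bessel's inequality twice, for the orthonormal columns of \<Phi>3 and for the
  \<open>H0\<close>-orthonormal columns of Qp. Each time the squared norm of the coefficients is an
  inner product, and Cauchy-Schwarz allows one factor to be cancelled.\<close>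

lemma perp_coeff_le: assumes x: "dim_vec x = m" shows "vnorm (perp_coeff x) \<le> h0_norm x"
proof -
  define w where "w = Qp\<^sup>T *\<^sub>v (H0 *\<^sub>v x)"
  have dw: "dim_vec w = np" by (simp add: w_def)
  have le: "a \<le> b" if "a\<^sup>2 \<le> b * a" "0 \<le> b" for a b :: real
    using that by (cases "a \<le> 0") (auto simp: power2_eq_square)
  define b where "b = perp_coeff x"
  have db: "dim_vec b = dim_col \<Phi>3" by (simp add: b_def perp_coeff_def)
  have "(\<Phi>3 *\<^sub>v b) \<bullet>c (\<Phi>3 *\<^sub>v b) = b \<bullet>c b"
    using csp_adjoint[of \<Phi>3 b "\<Phi>3 *\<^sub>v b"] db by (simp add: Phi3_gram)
  then have n3: "vnorm (\<Phi>3 *\<^sub>v b) = vnorm b"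
    unfolding csp_self of_real_eq_iff by (simp add: power2_eq_iff_nonneg)
  have "b \<bullet>c b = w \<bullet>c (\<Phi>3 *\<^sub>v b)"
    using csp_adjoint[of "\<Phi>3\<^sup>T" w b] dw db by (simp add: b_def perp_coeff_def w_def)
  then have "(vnorm b)\<^sup>2 = cmod (w \<bullet>c (\<Phi>3 *\<^sub>v b))" by (metis csp_self norm_of_real abs_power2)
  also have "\<dots> \<le> vnorm w * vnorm (\<Phi>3 *\<^sub>v b)" by (rule csp_le) (simp add: dw)
  finally have 1: "vnorm b \<le> vnorm w" unfolding n3 by (rule le) simp
  have "(h0_norm (Qp *\<^sub>v w))\<^sup>2 = (vnorm w)\<^sup>2"
  proof -
    have "(H0 *\<^sub>v (Qp *\<^sub>v w)) \<bullet>c (Qp *\<^sub>v w) = w \<bullet>c w"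
      using csp_adjoint[of "Qp\<^sup>T" "H0 *\<^sub>v (Qp *\<^sub>v w)" w] dw by (simp add: Qp_gram)
    then show ?thesis using h0_norm_square[of "Qp *\<^sub>v w"] unfolding csp_self
      by (simp del: of_real_power add: of_real_power[symmetric])
  qed
  then have n: "h0_norm (Qp *\<^sub>v w) = vnorm w" by (simp add: power2_eq_iff_nonneg)
  have "w \<bullet>c w = (H0 *\<^sub>v x) \<bullet>c (Qp *\<^sub>v w)"
    using csp_adjoint[of "Qp\<^sup>T" "H0 *\<^sub>v x" w] dw by (simp add: w_def)
  also have "\<dots> = ((X_one S i)\<^sup>T *\<^sub>v (H0 *\<^sub>v x)) \<bullet>c ((X_one S i)\<^sup>T *\<^sub>v (H0 *\<^sub>v (Qp *\<^sub>v w)))"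
    by (rule one.energy_expand) (simp_all add: x)
  finally have "(vnorm w)\<^sup>2 = cmod \<dots>" by (metis csp_self norm_of_real abs_power2)
  also have "\<dots> \<le> h0_norm x * h0_norm (Qp *\<^sub>v w)" unfolding h0_norm_def by (rule csp_le) simp
  finally have "vnorm w \<le> h0_norm x" unfolding n by (rule le) simp
  with 1 show ?thesis by (simp add: b_def)
qed

lemma re_im_mat: "re_mat A + \<i> \<cdot>\<^sub>m im_mat A = A"
  by (rule eq_matI) (auto simp: re_mat_def im_mat_def complex_eq_iff)

lemma dim_BP1 [simp]: "dim_row P0 = m" "dim_col P0 = m"
  by (simp_all add: BP1_loc_def Let_def)

text \<open>The imaginary part of \<open>B0\<close> is retained in the preconditioner and cancels,
  so the difference lives on the range of I - Pi_Re.\<close>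

lemma B0_minus_BP1:
  assumes "dim_vec x = m" "dim_vec y = m"
  shows "(B0 *\<^sub>v x) \<bullet>c y - (P0 *\<^sub>v x) \<bullet>c y =
    (ReB0 *\<^sub>v (complement *\<^sub>v x)) \<bullet>c (complement *\<^sub>v y)
    - (C0 *\<^sub>v (complement *\<^sub>v x)) \<bullet>c (complement *\<^sub>v y)"
proof -
  have E: "(complement\<^sup>T *\<^sub>v z) \<bullet>c y = z \<bullet>c (complement *\<^sub>v y)" if "dim_vec z = m" for z
    using csp_adjoint[of "complement\<^sup>T" z y] that assms by simp
  have "P0 = B0 - complement\<^sup>T * ReB0 * complement
      + complement\<^sup>T * C0 * complement"
    by (simp only: BP1_loc_def Let_def re_im_mat dim_B0 complement_def)
  then have "P0 *\<^sub>v x = B0 *\<^sub>v x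
      - complement\<^sup>T *\<^sub>v (ReB0 *\<^sub>v (complement *\<^sub>v x))
      + complement\<^sup>T *\<^sub>v (C0 *\<^sub>v (complement *\<^sub>v x))"
    using assms by (simp add: add_mat_mult_vec minus_mat_mult_vec mult_mat_mat_vec)
  then show ?thesis using assms by (simp add: csp_add_left csp_minus_left E)
qed

text \<open>In suitable coordinates the real part of \<open>B0\<close> and the matrix
  \<open>C0\<close> are diagonal with entries within \<eta> of 1, where 1 stands for
  \<open>H0\<close>. Comparing both with \<open>H0\<close> costs \<eta> each.\<close>

lemma B0_minus_BP1_le:
  assumes "dim_vec x = m" "dim_vec y = m"
  shows "cmod ((B0 *\<^sub>v x) \<bullet>c y - (P0 *\<^sub>v x) \<bullet>c y) \<le> 2 * eta S * h0_norm x * h0_norm y"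
proof -
  define b c where "b = perp_coeff x" and "c = perp_coeff y"
  have d: "dim_vec b = dim_col \<Phi>3" "dim_vec c = dim_col \<Phi>3" by (simp_all add: b_def c_def perp_coeff_def)
  define u v where "u = \<Phi>3 *\<^sub>v b" and "v = \<Phi>3 *\<^sub>v c"
  have dv: "dim_vec u = np" "dim_vec v = np" by (simp_all add: u_def v_def)
  have iso: "(\<Phi>3 *\<^sub>v p) \<bullet>c (\<Phi>3 *\<^sub>v q) = p \<bullet>c q" if "dim_vec p = dim_col \<Phi>3" "dim_vec q = dim_col \<Phi>3" for p q
    using csp_adjoint[of \<Phi>3 p "\<Phi>3 *\<^sub>v q"] that by (simp add: Phi3_gram)
  have n: "vnorm u = vnorm b" "vnorm v = vnorm c"
    using iso[OF d(1) d(1)] iso[OF d(2) d(2)] unfolding u_def v_def csp_self of_real_eq_iff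
    by (simp_all add: power2_eq_iff_nonneg)
  \<comment> \<open>The real part of \<open>B0\<close> is diagonal in the Qp-coordinates u, v, while
    \<open>C0\<close> is diagonal in the \<Phi>3-coordinates b, c. As \<Phi>3 is an isometry, the
    same number can be subtracted from both forms.\<close>
  have uv: "u \<bullet>c v = b \<bullet>c c" unfolding u_def v_def using iso d by simp
  have r: "(ReB0 *\<^sub>v (Qp *\<^sub>v u)) \<bullet>c (Qp *\<^sub>v v) = (cdiag np ev1 *\<^sub>v u) \<bullet>c v"
    using csp_adjoint[of "Qp\<^sup>T" "ReB0 *\<^sub>v (Qp *\<^sub>v u)" v] dv by (simp add: Qp_diagonal)
  have q: "(C0 *\<^sub>v (Qp *\<^sub>v u)) \<bullet>c (Qp *\<^sub>v v) = (cdiag (dim_col \<Phi>3) ev2 *\<^sub>v b) \<bullet>c c"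
    using csp_adjoint[of "Qp\<^sup>T" "C0 *\<^sub>v (Qp *\<^sub>v u)" v]
      csp_adjoint[of "\<Phi>3\<^sup>T" "Qp\<^sup>T *\<^sub>v (C0 *\<^sub>v (Qp *\<^sub>v u))" c] dv d
    by (simp add: Phi3_diagonal u_def v_def)
  have shift: "(cdiag k l *\<^sub>v p) \<bullet>c q - p \<bullet>c q = (cdiag k (\<lambda>r. l r - 1) *\<^sub>v p) \<bullet>c q"
    if "dim_vec p = k" "dim_vec q = k" for k l p q
    using that by (simp add: cdiag_mult_vec csp_eq_sum algebra_simps flip: sum_subtractf del: index_mult_mat_vec)
  have "(B0 *\<^sub>v x) \<bullet>c y - (P0 *\<^sub>v x) \<bullet>c y =
      (cdiag np (\<lambda>r. ev1 r - 1) *\<^sub>v u) \<bullet>c v - (cdiag (dim_col \<Phi>3) (\<lambda>r. ev2 r - 1) *\<^sub>v b) \<bullet>c c"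
    unfolding B0_minus_BP1[OF assms] complement_vec[OF assms(1)] complement_vec[OF assms(2)]
      b_def[symmetric] c_def[symmetric] u_def[symmetric] v_def[symmetric]
    unfolding r q shift[OF dv, of ev1, symmetric] shift[OF d, of ev2, symmetric] uv by simp
  also have "cmod \<dots> \<le> eta S * vnorm u * vnorm v + eta S * vnorm b * vnorm c"
    using cdiag_csp_le[of u "\<lambda>r. ev1 r - 1" "eta S" v] cdiag_csp_le[of b "\<lambda>r. ev2 r - 1" "eta S" c]
      ev1_near_one ev2_near_one dv d
    by (intro order_trans[OF norm_triangle_ineq4] add_mono) simp_all
  also have "\<dots> = 2 * eta S * (vnorm b * vnorm c)" by (simp add: n)
  also have "\<dots> \<le> 2 * eta S * (h0_norm x * h0_norm y)"
    using eta perp_coeff_le[OF assms(1)] perp_coeff_le[OF assms(2)]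
    by (intro mult_left_mono mult_mono) (simp_all add: b_def c_def)
  finally show ?thesis by (simp add: mult.assoc)
qed

end

section \<open>Nodal vectors\<close>

definition gather :: "'b list \<Rightarrow> ('b \<Rightarrow> complex) \<Rightarrow> cvec" where
  "gather xs c = Matrix.vec (length xs) (\<lambda>r. c (xs ! r))"

text \<open>Zero at nodes outside \<open>xs\<close>, so gathering the values on another list
  performs restriction and extension by zero in one formula.\<close>

definition nodal_val :: "'b list \<Rightarrow> cvec \<Rightarrow> 'b \<Rightarrow> complex" where
  "nodal_val xs v y = (\<Sum>r<length xs. if xs ! r = y then v $ r else 0)"

lemma dim_gather [simp]: "dim_vec (gather xs c) = length xs"
  by (simp add: gather_def)

lemma gather_index [simp]: "r < length xs \<Longrightarrow> gather xs c $ r = c (xs ! r)"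
  by (simp add: gather_def)

lemma gather_cong: "(\<And>y. y \<in> set xs \<Longrightarrow> c y = d y) \<Longrightarrow> gather xs c = gather xs d"
  by (auto simp: gather_def)

lemma gather_add: "gather xs (\<lambda>y. c y + d y) = gather xs c + gather xs d"
  by (auto simp: gather_def)

lemma sum_nth_distinct: "distinct xs \<Longrightarrow> (\<Sum>r<length xs. f (xs ! r)) = (\<Sum>y\<in>set xs. f y)"
  by (rule sum.reindex_bij_betw[OF bij_betw_nth]) auto

lemma nodal_val_notin: "y \<notin> set xs \<Longrightarrow> nodal_val xs v y = 0"
  unfolding nodal_val_def by (rule sum.neutral) auto

lemma nodal_val_nth:
  assumes "distinct xs" "r < length xs" shows "nodal_val xs v (xs ! r) = v $ r"
proof -
  have "nodal_val xs v (xs ! r) = (\<Sum>s<length xs. if s = r then v $ s else 0)"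
    unfolding nodal_val_def using assms by (intro sum.cong) (auto simp: nth_eq_iff_index_eq)
  then show ?thesis using assms(2) by simp
qed

lemma nodal_val_gather:
  assumes "distinct xs" "y \<in> set xs" shows "nodal_val xs (gather xs c) y = c y"
proof -
  obtain r where "r < length xs" "y = xs ! r" using assms(2) by (auto simp: in_set_conv_nth)
  then show ?thesis using nodal_val_nth[OF assms(1)] by simp
qed

lemma gather_nodal_val: "distinct xs \<Longrightarrow> dim_vec v = length xs \<Longrightarrow> gather xs (nodal_val xs v) = v"
  by (rule eq_vecI) (simp_all add: nodal_val_nth)

lemma nodal_val_append:
  assumes "dim_vec u = length xs" "dim_vec v = length ys"
  shows "nodal_val (xs @ ys) (u @\<^sub>v v) y = nodal_val xs u y + nodal_val ys v y"
proof -
  have split: "(\<Sum>r<a + b. f r) = (\<Sum>r<a. f r) + (\<Sum>r<b. f (a + r))" for a b and f :: "nat \<Rightarrow> complex"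
    by (induction b) (auto simp: ac_simps)
  show ?thesis
    unfolding nodal_val_def length_append split using assms
    by (intro arg_cong2[where f="(+)"] sum.cong) (auto simp: nth_append)
qed

lemma nodal_val_add:
  "dim_vec u = length xs \<Longrightarrow> dim_vec v = length xs \<Longrightarrow> nodal_val xs (u + v) y = nodal_val xs u y + nodal_val xs v y"
  unfolding nodal_val_def sum.distrib[symmetric] by (rule sum.cong) auto

lemma nodal_val_zero [simp]: "nodal_val xs (0\<^sub>v (length xs)) y = 0"
  unfolding nodal_val_def by (rule sum.neutral) auto

lemma restr_mat_vec: "dim_vec v = length ys \<Longrightarrow> restr_mat xs ys *\<^sub>v v = gather xs (nodal_val ys v)"
  by (rule eq_vecI)
    (auto simp: restr_mat_def nodal_val_def scalar_prod_def atLeast0LessThan if_distrib[where f="\<lambda>x. x * _"]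
      intro!: sum.cong)

lemma restr_mat_transpose_vec: "dim_vec v = length xs \<Longrightarrow> (restr_mat xs ys)\<^sup>T *\<^sub>v v = gather ys (nodal_val xs v)"
  by (rule eq_vecI)
    (auto simp: restr_mat_def nodal_val_def scalar_prod_def atLeast0LessThan if_distrib[where f="\<lambda>x. x * _"]
      intro!: sum.cong)

lemma dim_restr_mat [simp]: "dim_row (restr_mat xs ys) = length xs" "dim_col (restr_mat xs ys) = length ys"
  by (simp_all add: restr_mat_def)

lemma real_restr_mat [simp]: "real_mat (restr_mat xs ys)"
  by (auto simp: real_mat_def restr_mat_def)

lemma csp_gather: "distinct xs \<Longrightarrow> gather xs f \<bullet>c gather xs g = (\<Sum>z\<in>set xs. f z * cnj (g z))"
  using sum_nth_distinct[of xs "\<lambda>z. f z * cnj (g z)"] by (simp add: csp_eq_sum)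

lemma form_mat_gather:
  assumes "distinct ys"
  shows "form_mat D a xs ys *\<^sub>v gather ys c = gather xs (\<lambda>z. \<Sum>y\<in>set ys.
    a (\<lambda>x. complex_of_real (basis_fun D y x)) (\<lambda>x. complex_of_real (basis_fun D z x)) * c y)"
proof (rule eq_vecI)
  fix r assume "r < dim_vec (gather xs (\<lambda>z. \<Sum>y\<in>set ys.
    a (\<lambda>x. complex_of_real (basis_fun D y x)) (\<lambda>x. complex_of_real (basis_fun D z x)) * c y))"
  then have r: "r < length xs" by simp
  then have "(form_mat D a xs ys *\<^sub>v gather ys c) $ r = (\<Sum>s<length ys.
    a (\<lambda>x. complex_of_real (basis_fun D (ys ! s) x)) (\<lambda>x. complex_of_real (basis_fun D (xs ! r) x)) * c (ys ! s))"
    by (auto simp: form_mat_def scalar_prod_def atLeast0LessThan intro!: sum.cong)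
  also have "\<dots> = (\<Sum>y\<in>set ys.
    a (\<lambda>x. complex_of_real (basis_fun D y x)) (\<lambda>x. complex_of_real (basis_fun D (xs ! r) x)) * c y)"
    using assms by (rule sum_nth_distinct)
  finally show "(form_mat D a xs ys *\<^sub>v gather ys c) $ r = gather xs (\<lambda>z. \<Sum>y\<in>set ys.
    a (\<lambda>x. complex_of_real (basis_fun D y x)) (\<lambda>x. complex_of_real (basis_fun D z x)) * c y) $ r"
    using r by simp
qed simp

lemma dim_mat_sum [simp]: "dim_row (mat_sum nr nc N A) = nr" "dim_col (mat_sum nr nc N A) = nc"
  by (simp_all add: mat_sum_def)

lemma mat_sum_vec_index:
  assumes "\<And>i. i < N \<Longrightarrow> dim_row (A i) = nr" "\<And>i. i < N \<Longrightarrow> dim_col (A i) = nc" "dim_vec x = nc" "r < nr"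
  shows "(mat_sum nr nc N A *\<^sub>v x) $ r = (\<Sum>i<N. (A i *\<^sub>v x) $ r)"
proof -
  have "(mat_sum nr nc N A *\<^sub>v x) $ r = (\<Sum>c<nc. \<Sum>i<N. A i $$ (r,c) * x $ c)"
    using assms by (auto simp: mat_sum_def scalar_prod_def atLeast0LessThan sum_distrib_right intro!: sum.cong)
  also have "\<dots> = (\<Sum>i<N. \<Sum>c<nc. A i $$ (r,c) * x $ c)" by (rule sum.swap)
  also have "\<dots> = (\<Sum>i<N. (A i *\<^sub>v x) $ r)"
    using assms by (auto simp: scalar_prod_def atLeast0LessThan intro!: sum.cong)
  finally show ?thesis .
qed

lemma mat_sum_csp:
  assumes "\<And>i. i < N \<Longrightarrow> dim_row (A i) = nr" "\<And>i. i < N \<Longrightarrow> dim_col (A i) = nc" "dim_vec x = nc" "dim_vec w = nr"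
  shows "(mat_sum nr nc N A *\<^sub>v x) \<bullet>c w = (\<Sum>i<N. (A i *\<^sub>v x) \<bullet>c w)"
proof -
  have "(mat_sum nr nc N A *\<^sub>v x) \<bullet>c w = (\<Sum>r<nr. \<Sum>i<N. (A i *\<^sub>v x) $ r * cnj (w $ r))"
    unfolding csp_eq_sum assms(4) using assms(1-3)
    by (intro sum.cong refl, subst mat_sum_vec_index) (auto simp: sum_distrib_right simp del: index_mult_mat_vec)
  also have "\<dots> = (\<Sum>i<N. \<Sum>r<nr. (A i *\<^sub>v x) $ r * cnj (w $ r))" by (rule sum.swap)
  finally show ?thesis by (simp only: csp_eq_sum assms(4))
qed

section \<open>The energy norm on finite element functions\<close>

context helmholtz
begin

lemma Omega_lebesgue: "\<Omega> \<in> sets lebesgue"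
  using borel_open[OF domain(1)] by auto

abbreviation "hip c d \<equiv> h_inner D \<Omega> (fe c) (fe d)"
abbreviation "hnm c \<equiv> h_norm D (fe c)"

lemma h_inner_comb: "hip c d = (\<Sum>y\<in>Y. \<Sum>z\<in>Y. c y * cnj (d z) * h_entry D \<Omega> y z)"
  by (rule h_inner_nodal_comb[OF Omega_lebesgue order_refl])

lemma h_inner_commute: "hip d c = cnj (hip c d)"
proof -
  have r: "cnj (h_entry D \<Omega> y z) = h_entry D \<Omega> z y" for y z
    using h_entry_real[of \<Omega> y z] h_entry_commute[of D \<Omega> y z] by (simp add: Reals_cnj_iff)
  show ?thesis
    unfolding h_inner_comb cnj_sum complex_cnj_mult complex_cnj_cnj r
    by (subst sum.swap) (simp only: mult_ac)
qed

lemma h_inner_add_right: "hip c (\<lambda>y. d y + e y) =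
    hip c d + hip c e"
  unfolding h_inner_comb sum.distrib[symmetric] by (intro sum.cong refl) (simp add: algebra_simps)

lemma h_inner_scale_right: "hip c (\<lambda>y. a * d y) =
    cnj a * hip c d"
  unfolding h_inner_comb sum_distrib_left by (intro sum.cong refl) (simp add: algebra_simps)

lemma h_norm_square_add: "(hnm (\<lambda>y. c y + d y))\<^sup>2 =
   (hnm c)\<^sup>2 + 2 * Re (hip c d) + (hnm d)\<^sup>2"
proof -
  let ?H = "\<lambda>c d. hip c d"
  have sq: "(hnm c)\<^sup>2 = Re (?H c c)" for c by (simp add: h_inner_self)
  have l: "?H (\<lambda>y. c y + d y) e = ?H c e + ?H d e" for e
  proof -
    have "?H (\<lambda>y. c y + d y) e = cnj (?H e (\<lambda>y. c y + d y))" by (rule h_inner_commute)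
    also have "\<dots> = cnj (?H e c) + cnj (?H e d)" by (simp only: h_inner_add_right complex_cnj_add)
    finally show ?thesis by (simp only: h_inner_commute[symmetric])
  qed
  have "?H d c = cnj (?H c d)" by (rule h_inner_commute)
  then show ?thesis unfolding sq h_inner_add_right l by simp
qed

lemma h_norm_scale: "(hnm (\<lambda>y. a * d y))\<^sup>2 = (cmod a)\<^sup>2 * (hnm d)\<^sup>2"
proof -
  let ?H = "\<lambda>c d. hip c d"
  have "?H (\<lambda>y. a * d y) (\<lambda>y. a * d y) = cnj a * ?H (\<lambda>y. a * d y) d"
    by (rule h_inner_scale_right)
  also have "\<dots> = cnj a * cnj (?H d (\<lambda>y. a * d y))"
    by (rule arg_cong[OF h_inner_commute])
  also have "\<dots> = complex_of_real ((cmod a)\<^sup>2 * (hnm d)\<^sup>2)"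
    unfolding h_inner_scale_right h_inner_self complex_cnj_mult complex_cnj_cnj complex_cnj_complex_of_real
      of_real_mult[of "(cmod a)\<^sup>2"] complex_norm_square
    by (simp only: mult_ac)
  finally show ?thesis unfolding h_inner_self of_real_eq_iff .
qed

text \<open>The discriminant argument for a seminorm: c is perturbed by the real multiples t of s *
  d, which makes the cross term real, and a direction d of zero energy is treated
  separately.\<close>

lemma h_inner_Cauchy_Schwarz:
  "cmod (hip c d) \<le> hnm c * hnm d"
proof -
  define s where "s = hip c d"
  define p q r where "p = (hnm c)\<^sup>2" and "q = (hnm d)\<^sup>2" and "r = (cmod s)\<^sup>2"
  have pq: "0 \<le> p" "0 \<le> q" "0 \<le> r" by (simp_all add: p_def q_def r_def)
  have quad: "0 \<le> p + 2 * t * r + t\<^sup>2 * r * q" for t :: real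
  proof -
    have "0 \<le> (h_norm D (fe (\<lambda>y. c y + (complex_of_real t * s) * d y)))\<^sup>2" by simp
    also have "\<dots> = p + 2 * Re (cnj (complex_of_real t * s) * s) + (cmod (complex_of_real t * s))\<^sup>2 * q"
      unfolding h_norm_square_add h_norm_scale h_inner_scale_right s_def p_def q_def ..
    also have "Re (cnj (complex_of_real t * s) * s) = t * r"
      unfolding r_def cmod_power2 by (simp add: power2_eq_square algebra_simps)
    also have "(cmod (complex_of_real t * s))\<^sup>2 = t\<^sup>2 * r"
      by (simp add: r_def norm_mult power_mult_distrib)
    finally show ?thesis by (simp add: mult_ac)
  qed
  have "r \<le> p * q"
  proof (cases "q = 0 \<or> r = 0")
    case True
    then show ?thesis
    proof
      assume q: "q = 0"
      have "r = 0"
      proof (rule ccontr)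
        assume "r \<noteq> 0"
        \<comment> \<open>With q = 0 the expression is affine in t; this t gives it the value
          -1.\<close>
        then show False using quad[of "- (p + 1) / (2 * r)"] pq q by (simp add: field_simps)
      qed
      then show ?thesis using q by simp
    qed (use pq in simp)
  next
    case False
    then have pos: "q > 0" "r > 0" using pq by auto
    \<comment> \<open>The value t = - 1 / q minimizes the quadratic.\<close>
    have "0 \<le> p - r / q"
      using quad[of "- 1 / q"] pos by (simp add: power2_eq_square field_simps)
    then show ?thesis using pos by (simp add: field_simps)
  qed
  then have "(cmod s)\<^sup>2 \<le> (hnm c * hnm d)\<^sup>2"
    by (simp add: r_def p_def q_def power_mult_distrib)
  then show ?thesis unfolding s_def by (rule power2_le_imp_le) (simp add: h_norm_nonneg)
qed

lemma h_norm_triangle: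
  "hnm (\<lambda>y. c y + d y) \<le> hnm c + hnm d"
proof (rule power2_le_imp_le)
  have "Re (hip c d) \<le> hnm c * hnm d"
    using h_inner_Cauchy_Schwarz complex_Re_le_cmod order_trans by blast
  then show "(hnm (\<lambda>y. c y + d y))\<^sup>2 \<le> (hnm c + hnm d)\<^sup>2"
    unfolding h_norm_square_add by (simp add: power2_sum)
qed (simp add: h_norm_nonneg)

section \<open>Nodes and subdomains\<close>

abbreviation "GL \<equiv> nodes_Gamma_loc D"
abbreviation "IL \<equiv> nodes_I_loc D"
abbreviation "nGam \<equiv> nodes_Gamma D"
abbreviation "nInt \<equiv> nodes_I D"

lemma distinct_lists [simp]: "distinct (GL i)" "distinct (IL i)" "distinct nGam" "distinct nInt"
  using nodes(1) by (simp_all add: nodes_Gamma_loc_def nodes_I_loc_def nodes_Gamma_def nodes_I_def)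

lemma subdomain_Int_frontier: assumes "i < N" "j < N" shows "sub i \<inter> frontier (sub j) = {}"
proof (cases "i = j")
  case True
  then show ?thesis using open_subdomain[OF assms(1)] by (auto simp: frontier_def interior_open)
next
  case False
  then show ?thesis using subdomain_Int_closure[OF assms False] by (auto simp: frontier_def)
qed

text \<open>An open subdomain meets no subdomain frontier; this is what keeps the concatenated list
  \<open>nodes_all D\<close> free of repetitions.\<close>

lemma node_sets_disjoint: "set nGam \<inter> set nInt = {}"
  using subdomain_Int_frontier by (fastforce simp: nodes_Gamma_def nodes_I_def)

lemma distinct_nodes_all [simp]: "distinct (nodes_all D)"
  using node_sets_disjoint by (simp add: nodes_all_def)

lemma GL_subset: "i < N \<Longrightarrow> set (GL i) \<subseteq> set nGam" and IL_subset: "i < N \<Longrightarrow> set (IL i) \<subseteq> set nInt"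
  by (auto simp: nodes_Gamma_loc_def nodes_I_loc_def nodes_Gamma_def nodes_I_def)

lemma Y_eq: "Y = set nGam \<union> set nInt"
  by (simp add: nodes_all_def)

lemma nInt_cover: "z \<in> set nInt \<Longrightarrow> \<exists>i<N. z \<in> set (IL i)"
  by (auto simp: nodes_I_loc_def nodes_I_def)

lemma IL_disjoint: "i < N \<Longrightarrow> j < N \<Longrightarrow> i \<noteq> j \<Longrightarrow> z \<in> set (IL i) \<Longrightarrow> z \<notin> set (IL j)"
  using subdomain_disjoint by (fastforce simp: nodes_I_loc_def)

lemma GL_IL_disjoint: "i < N \<Longrightarrow> set (GL i) \<inter> set (IL i) = {}"
  using GL_subset IL_subset node_sets_disjoint by blast

lemma not_local_node: 
  assumes "i < N" "y \<in> Y" "y \<notin> set (GL i)" "y \<notin> set (IL i)" shows "y \<notin> closure (sub i)"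
proof -
  have "y \<in> set (nodes D)" using assms(2) Y_subset by blast
  then have "y \<notin> frontier (sub i)" "y \<notin> sub i" using assms by (auto simp: nodes_Gamma_loc_def nodes_I_loc_def)
  then show ?thesis using open_subdomain[OF assms(1)] by (simp add: frontier_def interior_open)
qed

text \<open>A basis function is the combination with delta coefficients, so the entries of the form
  matrices can be read off from the double sums.\<close>

lemma basis_as_comb: assumes "y \<in> Y"
  shows "(\<phi>c y) = fe (\<lambda>w. if w = y then 1 else 0)"
  using assms by (auto simp: nodal_comb_def fun_eq_iff if_distrib[where f="\<lambda>x. x * _"] cong: if_cong)

lemma sum_delta2:
  assumes "finite A" "y \<in> A" "z \<in> A"
  shows "(\<Sum>v\<in>A. \<Sum>w\<in>A. (if v = y then 1 else 0) * cnj (if w = z then 1 else 0) * f v w) = (f y z :: complex)"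
proof -
  have "(\<Sum>w\<in>A. (if v = y then 1 else 0) * cnj (if w = z then 1 else 0) * f v w) = (if v = y then f v z else 0)" for v
    using assms by (simp add: if_distrib[where f=cnj] if_distrib[where f="\<lambda>x. x * _"] if_distrib[where f="\<lambda>x. _ * x"] cong: if_cong)
  then show ?thesis using assms by simp
qed

lemma form_basis:
  assumes "y \<in> Y" "z \<in> Y"
  shows "i < N \<Longrightarrow> b_form_loc D i (\<phi>c y) (\<phi>c z) = b_sub i y z"
    and "i < N \<Longrightarrow> h_inner D (sub i) (\<phi>c y) (\<phi>c z) = h_sub i y z"
    and "b_form D (\<phi>c y) (\<phi>c z) = b_entry D \<Omega> (frontier \<Omega>) y z"
proof -
  show "b_form_loc D i (\<phi>c y) (\<phi>c z) = b_sub i y z" if "i < N"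
    unfolding basis_as_comb[OF assms(1)] basis_as_comb[OF assms(2)] b_form_loc_nodal_comb[OF that]
    by (rule sum_delta2) (use assms in auto)
  show "h_inner D (sub i) (\<phi>c y) (\<phi>c z) = h_sub i y z" if "i < N"
  proof -
    have W: "sub i \<in> sets lebesgue" "sub i \<subseteq> \<Omega>"
      using borel_open[OF open_subdomain[OF that]] subdomain_subset[OF that] by auto
    show ?thesis
      unfolding basis_as_comb[OF assms(1)] basis_as_comb[OF assms(2)] h_inner_nodal_comb[OF W]
      by (rule sum_delta2) (use assms in auto)
  qed
  show "b_form D (\<phi>c y) (\<phi>c z) = b_entry D \<Omega> (frontier \<Omega>) y z"
    unfolding basis_as_comb[OF assms(1)] basis_as_comb[OF assms(2)] b_form_nodal_comb
    by (rule sum_delta2) (use assms in auto)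
qed

lemma local_subset_Y: "i < N \<Longrightarrow> set (GL i) \<subseteq> Y" "i < N \<Longrightarrow> set (IL i) \<subseteq> Y"
  using GL_subset IL_subset Y_eq by blast+

lemma b_sub_real:
  assumes "i < N" "z \<in> set (IL i)" shows "b_sub i y z \<in> \<real>"
proof -
  have "z \<in> set (nodes D)" "z \<in> \<Omega>"
    using assms subdomain_subset[OF assms(1)] by (auto simp: nodes_I_loc_def)
  then have "b_sub i z y \<in> \<real>" by (rule b_entry_real)
  then show ?thesis by (simp only: b_entry_commute)
qed

end

section \<open>Assembly of the local forms\<close>

context helmholtz
begin

text \<open>Entries belonging to nodes outside the closed subdomain vanish, so the local sums may
  run over all of Y. The parameters a and e cover the local form and the energy product at
  once.\<close>

lemma block_row:
  assumes i: "i < N" and xs: "set xs \<subseteq> Y"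
    and a: "\<And>y z. y \<in> Y \<Longrightarrow> z \<in> Y \<Longrightarrow> a (\<phi>c y) (\<phi>c z) = e y z"
    and e: "\<And>y z. y \<in> Y \<Longrightarrow> y \<notin> closure (sub i) \<Longrightarrow> e y z = 0"
  shows "form_mat D a xs (GL i) *\<^sub>v gather (GL i) c + form_mat D a xs (IL i) *\<^sub>v gather (IL i) c =
    gather xs (\<lambda>z. \<Sum>y\<in>Y. e y z * c y)"
proof -
  have row: "form_mat D a xs ys *\<^sub>v gather ys c = gather xs (\<lambda>z. \<Sum>y\<in>set ys. e y z * c y)"
    if "distinct ys" "set ys \<subseteq> Y" for ys
    unfolding form_mat_gather[OF that(1)] using that xs a
    by (intro gather_cong sum.cong) (auto simp: subset_iff)
  have "(\<Sum>y\<in>set (GL i). e y z * c y) + (\<Sum>y\<in>set (IL i). e y z * c y) = (\<Sum>y\<in>Y. e y z * c y)" for z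
  proof -
    have "(\<Sum>y\<in>set (GL i) \<union> set (IL i). e y z * c y) = (\<Sum>y\<in>Y. e y z * c y)"
      using local_subset_Y[OF i] e not_local_node[OF i] by (intro sum.mono_neutral_left) auto
    then show ?thesis using GL_IL_disjoint[OF i] by (simp add: sum.union_disjoint)
  qed
  then show ?thesis
    unfolding row[OF distinct_lists(1) local_subset_Y(1)[OF i]] row[OF distinct_lists(2) local_subset_Y(2)[OF i]]
      gather_add[symmetric] by simp
qed

lemma block_form:
  assumes i: "i < N"
    and a: "\<And>y z. y \<in> Y \<Longrightarrow> z \<in> Y \<Longrightarrow> a (\<phi>c y) (\<phi>c z) = e y z"
    and e: "\<And>y z. y \<in> Y \<Longrightarrow> y \<notin> closure (sub i) \<Longrightarrow> e y z = 0"
    and sym: "\<And>y z. e y z = e z y"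
  shows "(form_mat D a (GL i) (GL i) *\<^sub>v gather (GL i) c + form_mat D a (GL i) (IL i) *\<^sub>v gather (IL i) c) \<bullet>c gather (GL i) d
    + (form_mat D a (IL i) (GL i) *\<^sub>v gather (GL i) c + form_mat D a (IL i) (IL i) *\<^sub>v gather (IL i) c) \<bullet>c gather (IL i) d
    = (\<Sum>y\<in>Y. \<Sum>z\<in>Y. c y * cnj (d z) * e y z)"
proof -
  let ?f = "\<lambda>z. (\<Sum>y\<in>Y. e y z * c y) * cnj (d z)"
  have row: "form_mat D a xs (GL i) *\<^sub>v gather (GL i) c + form_mat D a xs (IL i) *\<^sub>v gather (IL i) c =
    gather xs (\<lambda>z. \<Sum>y\<in>Y. e y z * c y)" if "set xs \<subseteq> Y" for xs
    by (rule block_row[OF i that]) (fact a, fact e)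
  have "(\<Sum>z\<in>set (GL i). ?f z) + (\<Sum>z\<in>set (IL i). ?f z) = (\<Sum>z\<in>set (GL i) \<union> set (IL i). ?f z)"
    using GL_IL_disjoint[OF i] by (simp add: sum.union_disjoint)
  also have "\<dots> = (\<Sum>z\<in>Y. ?f z)"
  proof (rule sum.mono_neutral_left)
    show "\<forall>z\<in>Y - (set (GL i) \<union> set (IL i)). ?f z = 0"
      using e not_local_node[OF i] sym by auto
  qed (use local_subset_Y[OF i] in auto)
  also have "\<dots> = (\<Sum>z\<in>Y. \<Sum>y\<in>Y. c y * cnj (d z) * e y z)"
    unfolding sum_distrib_right by (simp only: mult_ac)
  also have "\<dots> = (\<Sum>y\<in>Y. \<Sum>z\<in>Y. c y * cnj (d z) * e y z)" by (rule sum.swap)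
  finally show ?thesis
    unfolding row[OF local_subset_Y(1)[OF i]] row[OF local_subset_Y(2)[OF i]]
      csp_gather[OF distinct_lists(1)] csp_gather[OF distinct_lists(2)] .
qed

abbreviation "cf \<equiv> nodal_val (nodes_all D)"
abbreviation "nVh \<equiv> dim_Vh D"
abbreviation "b_fe u w \<equiv> b_form D (fe_fun D u) (fe_fun D w)"
abbreviation "energy u \<equiv> h_norm D (fe_fun D u)"

lemma fe_fun_eq: "fe_fun D u = fe (cf u)"
proof
  fix x
  have "(\<Sum>l<length (nodes_all D). cf u (nodes_all D ! l) * complex_of_real (\<phi> (nodes_all D ! l) x)) = fe (cf u) x"
    unfolding nodal_comb_def by (rule sum_nth_distinct) simp
  then show "fe_fun D u x = fe (cf u) x"
    by (simp add: fe_fun_def dim_Vh_def nodal_val_nth)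
qed

lemma sum_over_subdomains:
  assumes "\<And>y z. y \<in> Y \<Longrightarrow> z \<in> Y \<Longrightarrow> e y z = (\<Sum>i<N. e_sub i y z)"
    and f: "\<And>i. i < N \<Longrightarrow> f i = (\<Sum>y\<in>Y. \<Sum>z\<in>Y. c y * cnj (d z) * e_sub i y z)"
  shows "(\<Sum>y\<in>Y. \<Sum>z\<in>Y. c y * cnj (d z) * e y z) = (\<Sum>i<N. f i :: complex)"
proof -
  have "(\<Sum>y\<in>Y. \<Sum>z\<in>Y. c y * cnj (d z) * e y z) = (\<Sum>y\<in>Y. \<Sum>z\<in>Y. \<Sum>i<N. c y * cnj (d z) * e_sub i y z)"
    by (intro sum.cong refl) (simp only: assms(1) sum_distrib_left)
  also have "\<dots> = (\<Sum>y\<in>Y. \<Sum>i<N. \<Sum>z\<in>Y. c y * cnj (d z) * e_sub i y z)"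
    by (rule sum.cong[OF refl], rule sum.swap)
  also have "\<dots> = (\<Sum>i<N. \<Sum>y\<in>Y. \<Sum>z\<in>Y. c y * cnj (d z) * e_sub i y z)"
    by (rule sum.swap)
  also have "\<dots> = (\<Sum>i<N. f i)"
    by (intro sum.cong refl f[symmetric]) simp
  finally show ?thesis .
qed

lemma b_sub_zero: "i < N \<Longrightarrow> y \<in> Y \<Longrightarrow> y \<notin> closure (sub i) \<Longrightarrow> b_sub i y z = 0"
  and h_sub_zero: "i < N \<Longrightarrow> y \<in> Y \<Longrightarrow> y \<notin> closure (sub i) \<Longrightarrow> h_sub i y z = 0"
  using entry_zero Y_subset by blast+

lemma B_mat_csp:
  assumes "dim_vec u = dim_Vh D" "dim_vec w = dim_Vh D"
  shows "(B_mat D *\<^sub>v u) \<bullet>c w = b_fe u w"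
proof -
  have u: "u = gather (nodes_all D) (cf u)" and w: "w = gather (nodes_all D) (cf w)"
    using assms gather_nodal_val[OF distinct_nodes_all] by (simp_all add: dim_Vh_def)
  have "(B_mat D *\<^sub>v u) \<bullet>c w = (\<Sum>z\<in>Y. (\<Sum>y\<in>Y. b_form D (\<phi>c y) (\<phi>c z) * cf u y) * cnj (cf w z))"
    by (subst u, subst w) (simp only: B_mat_def form_mat_gather[OF distinct_nodes_all] csp_gather[OF distinct_nodes_all])
  also have "\<dots> = (\<Sum>z\<in>Y. \<Sum>y\<in>Y. cf u y * cnj (cf w z) * b_entry D \<Omega> (frontier \<Omega>) y z)"
    unfolding sum_distrib_right by (intro sum.cong refl) (simp add: form_basis(3))
  also have "\<dots> = (\<Sum>y\<in>Y. \<Sum>z\<in>Y. cf u y * cnj (cf w z) * b_entry D \<Omega> (frontier \<Omega>) y z)"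
    by (rule sum.swap)
  finally show ?thesis by (simp only: fe_fun_eq b_form_nodal_comb)
qed

text \<open>A node inside \<open>sub i\<close> lies in no other closed subdomain, so its row of the
  global matrix receives a contribution from subdomain i only.\<close>

lemma R_loc_B_mat:
  assumes i: "i < N" and u: "dim_vec u = dim_Vh D"
  shows "R_loc D i *\<^sub>v (B_mat D *\<^sub>v u) = B_IG D i *\<^sub>v gather (GL i) (cf u) + B_II D i *\<^sub>v gather (IL i) (cf u)"
proof -
  have "B_mat D *\<^sub>v u = B_mat D *\<^sub>v gather (nodes_all D) (cf u)"
    using u gather_nodal_val[OF distinct_nodes_all, of u] by (simp add: dim_Vh_def)
  also have "\<dots> = gather (nodes_all D) (\<lambda>z. \<Sum>y\<in>Y. b_form D (\<phi>c y) (\<phi>c z) * cf u y)"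
    by (simp only: B_mat_def form_mat_gather[OF distinct_nodes_all])
  also have "\<dots> = gather (nodes_all D) (\<lambda>z. \<Sum>y\<in>Y. b_entry D \<Omega> (frontier \<Omega>) y z * cf u y)"
    by (intro gather_cong sum.cong refl) (simp add: form_basis(3))
  finally have B: "B_mat D *\<^sub>v u = gather (nodes_all D) (\<lambda>z. \<Sum>y\<in>Y. b_entry D \<Omega> (frontier \<Omega>) y z * cf u y)" .
  have "R_loc D i *\<^sub>v (B_mat D *\<^sub>v u) = gather (IL i) (\<lambda>z. \<Sum>y\<in>Y. b_entry D \<Omega> (frontier \<Omega>) y z * cf u y)"
    unfolding B R_loc_def
    by (subst restr_mat_vec, simp, rule gather_cong)
      (use local_subset_Y[OF i] in \<open>auto intro!: nodal_val_gather\<close>)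
  also have "\<dots> = gather (IL i) (\<lambda>z. \<Sum>y\<in>Y. b_sub i y z * cf u y)"
  proof (intro gather_cong sum.cong refl)
    fix y z assume z: "z \<in> set (IL i)" and y: "y \<in> Y"
    have zY: "z \<in> Y" using z local_subset_Y[OF i] by blast
    have "b_sub j y z = 0" if j: "j < N" "j \<noteq> i" for j
    proof -
      have "z \<in> sub i" using z by (simp add: nodes_I_loc_def)
      then have "z \<notin> closure (sub j)" using subdomain_Int_closure[OF i j(1)] j(2) by blast
      then show ?thesis using b_sub_zero[OF j(1) zY] b_entry_commute by metis
    qed
    then have "(\<Sum>j<N. b_sub j y z) = (\<Sum>j<N. if j = i then b_sub i y z else 0)"
      by (intro sum.cong) auto
    then show "b_entry D \<Omega> (frontier \<Omega>) y z * cf u y = b_sub i y z * cf u y"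
      using i by (simp add: b_entry_split(1)[OF y zY])
  qed
  also have "\<dots> = B_IG D i *\<^sub>v gather (GL i) (cf u) + B_II D i *\<^sub>v gather (IL i) (cf u)"
    unfolding B_IG_def B_II_def
    by (rule block_row[symmetric, OF i local_subset_Y(2)[OF i]]) (use form_basis(1) i b_sub_zero[OF i] in auto)
  finally show ?thesis .
qed

lemma h_norm_zero: "h_norm D (fe_fun D (0\<^sub>v nVh)) = 0"
proof -
  have "cf (0\<^sub>v nVh) = (\<lambda>y. 0)" by (simp add: dim_Vh_def fun_eq_iff)
  then have "h_inner D \<Omega> (fe_fun D (0\<^sub>v nVh)) (fe_fun D (0\<^sub>v nVh)) = 0"
    unfolding fe_fun_eq h_inner_comb by simp
  then show ?thesis unfolding h_inner_self by simp
qed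

lemma inf_sup_SUP:
  assumes "discrete_inf_sup D \<gamma>" "u \<in> carrier_vec nVh - {0\<^sub>v nVh}"
  shows "ereal \<gamma> \<le> (SUP v\<in>carrier_vec nVh - {0\<^sub>v nVh}. ereal (cmod (b_fe u v) / (energy u * energy v)))"
  using assms(1) unfolding discrete_inf_sup_def by (rule order_trans) (rule INF_lower[OF assms(2)])

text \<open>The inf-sup condition in dual-norm form. A test vector of zero energy does no harm,
  because its quotient is 0 by the convention on division by zero.\<close>

lemma inf_sup_bound:
  assumes inf_sup: "discrete_inf_sup D \<gamma>" and u: "u \<in> carrier_vec nVh" and C: "0 \<le> C"
    and le: "\<And>w. w \<in> carrier_vec nVh \<Longrightarrow> cmod (b_fe u w) \<le> C * energy w"
  shows "\<gamma> * energy u \<le> C"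
proof (cases "energy u = 0")
  case False
  then have pos: "energy u > 0" using h_norm_nonneg[of D "fe_fun D u"] by linarith
  have u0: "u \<in> carrier_vec nVh - {0\<^sub>v nVh}" using u False h_norm_zero by auto
  have "ereal \<gamma> \<le> ereal (C / energy u)"
  proof (rule order_trans[OF inf_sup_SUP[OF inf_sup u0]], rule SUP_least)
    fix w :: "cvec" assume "w \<in> carrier_vec nVh - {0\<^sub>v nVh}"
    then have w: "cmod (b_fe u w) \<le> C * energy w" using le by blast
    have "cmod (b_fe u w) / (energy u * energy w) \<le> C / energy u"
    proof (cases "energy w = 0")
      case True
      then show ?thesis using C pos by simp
    next
      case False
      then have "energy w > 0" using h_norm_nonneg[of D "fe_fun D w"] by linarith
      then show ?thesis using w pos by (simp add: field_simps)
    qed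
    then show "ereal (cmod (b_fe u w) / (energy u * energy w))
      \<le> ereal (C / energy u)" by simp
  qed
  then have "\<gamma> \<le> C / energy u" by simp
  then show ?thesis using pos by (simp add: field_simps)
qed (use C in simp)

text \<open>If the energy of u were 0, every quotient in the supremum would be a division by zero,
  hence 0, contradicting \<gamma> > 0.\<close>

lemma h_norm_pos:
  assumes inf_sup: "discrete_inf_sup D \<gamma>" and "0 < \<gamma>" and u: "u \<in> carrier_vec nVh - {0\<^sub>v nVh}"
  shows "0 < energy u"
proof (rule ccontr)
  assume "\<not> 0 < energy u"
  then have 0: "energy u = 0" using h_norm_nonneg[of D "fe_fun D u"] by linarith
  have "ereal \<gamma> \<le> ereal 0"
    by (rule order_trans[OF inf_sup_SUP[OF inf_sup u]], rule SUP_least) (simp add: 0)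
  then show False using assms(2) by simp
qed

end

section \<open>The coarse space\<close>

lemma offset_bound: "i < N \<Longrightarrow> r < k i \<Longrightarrow> (\<Sum>j<i. k j) + r < (\<Sum>j<N. k j)" for k :: "nat \<Rightarrow> nat"
proof -
  assume "i < N" "r < k i"
  then have "(\<Sum>j<i. k j) + r < (\<Sum>j<Suc i. k j)" by simp
  also have "\<dots> \<le> (\<Sum>j<N. k j)" using \<open>i < N\<close> by (intro sum_mono2) auto
  finally show ?thesis .
qed

text \<open>With \<open>offset_bound\<close> and \<open>offset_cover\<close> this identifies the
  pairs of block number and position in the block with positions in the concatenated vector.\<close>

lemma offset_unique:
  fixes k :: "nat \<Rightarrow> nat"
  assumes "r < k i" "s < k j" "(\<Sum>l<i. k l) + r = (\<Sum>l<j. k l) + s"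
  shows "i = j \<and> r = s"
proof -
  have "\<not> i < j" using offset_bound[of i j r k] assms by auto
  moreover have "\<not> j < i" using offset_bound[of j i s k] assms by auto
  ultimately have "i = j" by simp
  then show ?thesis using assms(3) by simp
qed

lemma offset_cover:
  fixes k :: "nat \<Rightarrow> nat"
  shows "c < (\<Sum>j<N. k j) \<Longrightarrow> \<exists>i<N. \<exists>r<k i. c = (\<Sum>j<i. k j) + r"
proof (induction N)
  case (Suc N)
  show ?case
  proof (cases "c < (\<Sum>j<N. k j)")
    case True
    then show ?thesis using Suc.IH less_Suc_eq by blast
  next
    case False
    then have "c - (\<Sum>j<N. k j) < k N" "c = (\<Sum>j<N. k j) + (c - (\<Sum>j<N. k j))" using Suc.prems by auto
    then show ?thesis by blast
  qed
qed simp

lemma dim_R_S [simp]: "dim_row (R_S D S i) = k_loc S i" "dim_col (R_S D S i) = dim_alpha D S"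
  by (simp_all add: R_S_def)

lemma real_R_S [simp]: "real_mat (R_S D S i)"
  by (auto simp: real_mat_def R_S_def)

lemma R_S_vec_index:
  assumes "i < num_sub D" "r < k_loc S i" "dim_vec a = dim_alpha D S"
  shows "(R_S D S i *\<^sub>v a) $ r = a $ ((\<Sum>j<i. k_loc S j) + r)"
proof -
  have "(R_S D S i *\<^sub>v a) $ r = (\<Sum>c<dim_alpha D S. if c = (\<Sum>j<i. k_loc S j) + r then a $ c else 0)"
    using assms by (simp add: R_S_def scalar_prod_def atLeast0LessThan if_distrib[where f="\<lambda>x. x * _"] cong: if_cong)
  then show ?thesis
    using offset_bound[of i "num_sub D" r "k_loc S"] assms by (simp add: dim_alpha_def del: index_mult_mat_vec)
qed

text \<open>The concatenation of the blocks \<open>a i\<close>; at each position at most one term of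
  the double sum is nonzero. It is a common right inverse of the matrices
  \<open>R_S\<close>.\<close>

definition join_alpha :: "'a::euclidean_space helmholtz_fem \<Rightarrow> spectral_data \<Rightarrow> (nat \<Rightarrow> cvec) \<Rightarrow> cvec" where
  "join_alpha D S a = Matrix.vec (dim_alpha D S)
     (\<lambda>c. \<Sum>i<num_sub D. \<Sum>r<k_loc S i. if c = (\<Sum>j<i. k_loc S j) + r then a i $ r else 0)"

lemma R_S_join_alpha:
  assumes "i < num_sub D" "dim_vec (a i) = k_loc S i"
  shows "R_S D S i *\<^sub>v join_alpha D S a = a i"
proof (rule eq_vecI)
  fix r assume "r < dim_vec (a i)"
  then have r: "r < k_loc S i" using assms by simp
  have "(R_S D S i *\<^sub>v join_alpha D S a) $ r = join_alpha D S a $ ((\<Sum>j<i. k_loc S j) + r)"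
    using assms(1) r by (rule R_S_vec_index) (simp add: join_alpha_def)
  also have "\<dots> = (\<Sum>i'<num_sub D. \<Sum>s<k_loc S i'. if (\<Sum>j<i. k_loc S j) + r = (\<Sum>j<i'. k_loc S j) + s then a i' $ s else 0)"
    using offset_bound[of i "num_sub D" r "k_loc S"] assms(1) r by (simp add: join_alpha_def dim_alpha_def)
  also have "\<dots> = (\<Sum>i'<num_sub D. if i' = i then a i $ r else 0)"
  proof (rule sum.cong[OF refl])
    fix i'
    have "(if (\<Sum>j<i. k_loc S j) + r = (\<Sum>j<i'. k_loc S j) + s then a i' $ s else 0) = (if s = r then (if i' = i then a i $ r else 0) else 0)"
      if "s < k_loc S i'" for s
      using offset_unique[of r "k_loc S" i s i', OF r that] by auto
    then have "(\<Sum>s<k_loc S i'. if (\<Sum>j<i. k_loc S j) + r = (\<Sum>j<i'. k_loc S j) + s then a i' $ s else 0)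
      = (\<Sum>s<k_loc S i'. if s = r then (if i' = i then a i $ r else 0) else 0)"
      by (intro sum.cong) auto
    also have "\<dots> = (if i' = i then a i $ r else 0)" using r by auto
    finally show "(\<Sum>s<k_loc S i'. if (\<Sum>j<i. k_loc S j) + r = (\<Sum>j<i'. k_loc S j) + s then a i' $ s else 0)
      = (if i' = i then a i $ r else 0)" .
  qed
  also have "\<dots> = a i $ r" using assms(1) by simp
  finally show "(R_S D S i *\<^sub>v join_alpha D S a) $ r = a i $ r" .
qed (use assms in simp)

lemma R_S_zero:
  assumes "dim_vec a = dim_alpha D S" "\<And>i. i < num_sub D \<Longrightarrow> R_S D S i *\<^sub>v a = 0\<^sub>v (k_loc S i)"
  shows "a = 0\<^sub>v (dim_alpha D S)"
proof (rule eq_vecI)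
  fix c assume "c < dim_vec (0\<^sub>v (dim_alpha D S) :: cvec)"
  then have "c < (\<Sum>j<num_sub D. k_loc S j)" by (simp add: dim_alpha_def)
  then obtain i r where ir: "i < num_sub D" "r < k_loc S i" "c = (\<Sum>j<i. k_loc S j) + r"
    using offset_cover by blast
  have "a $ c = (R_S D S i *\<^sub>v a) $ r" unfolding ir(3) using ir assms(1) by (intro R_S_vec_index[symmetric])
  then show "a $ c = 0\<^sub>v (dim_alpha D S) $ c" using assms(2)[OF ir(1)] ir(2) \<open>c < dim_vec _\<close> by simp
qed (use assms in simp)

locale helmholtz_spectral = helmholtz +
  fixes S :: spectral_data
  assumes spectral: "spectral_setting D S"
begin

abbreviation "R0 \<equiv> R0T D S"
abbreviation "nV0 \<equiv> dim_V0 D S"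
abbreviation "nA \<equiv> dim_alpha D S"

lemma eta_pos: "0 < eta S"
  using spectral by (simp add: spectral_setting_def)

lemma local_problem: assumes i: "i < N" shows "local_problem D S i"
proof
  have G: "GL i ! r \<in> Y" if "r < length (GL i)" for r
    using nth_mem[OF that] local_subset_Y(1)[OF i] by blast
  have I: "IL i ! r \<in> Y" if "r < length (IL i)" for r
    using nth_mem[OF that] local_subset_Y(2)[OF i] by blast
  show "B_GI D i = (B_IG D i)\<^sup>T"
    by (rule eq_matI) (auto simp: B_GI_def B_IG_def form_mat_def form_basis(1)[OF _ _ i] G I b_entry_commute)
  show "H_GI D i = (H_IG D i)\<^sup>T"
    by (rule eq_matI) (auto simp: H_GI_def H_IG_def form_mat_def form_basis(2)[OF _ _ i] G I h_entry_commute)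
  show "real_mat (B_IG D i)"
  proof (rule real_matI)
    fix r c assume "r < dim_row (B_IG D i)" "c < dim_col (B_IG D i)"
    then have rc: "r < length (IL i)" "c < length (GL i)" by (simp_all add: B_IG_def)
    then have "B_IG D i $$ (r,c) = b_sub i (GL i ! c) (IL i ! r)"
      by (simp add: B_IG_def form_mat_def form_basis(1)[OF _ _ i] G I)
    then show "B_IG D i $$ (r,c) \<in> \<real>" using b_sub_real[OF i] nth_mem[OF rc(1)] by simp
  qed
  show "real_mat (H_IG D i)"
  proof (rule real_matI)
    fix r c assume "r < dim_row (H_IG D i)" "c < dim_col (H_IG D i)"
    then have "H_IG D i $$ (r,c) = h_sub i (GL i ! c) (IL i ! r)"
      by (simp add: H_IG_def form_mat_def form_basis(2)[OF _ _ i] G I)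
    then show "H_IG D i $$ (r,c) \<in> \<real>" using h_entry_real by simp
  qed
  show "0 < beta S" "0 < eta S" using spectral by (simp_all add: spectral_setting_def)
  show "real_eigensystem (B_II D i) (H_II D i) (ev_int S i) (X_int S i)"
    "real_eigensystem (re_mat (B0_loc D S i)) (H0_loc D S i) (ev_one S i) (X_one S i)"
    "real_eigensystem
          ((Q_one_perp S i)\<^sup>T * C0_loc D S i * Q_one_perp S i)
          ((Q_one_perp S i)\<^sup>T * H0_loc D S i * Q_one_perp S i)
          (ev_two S i) (X_two S i)"
    using spectral i by (simp_all add: spectral_setting_def)
qed

abbreviation "uG i u \<equiv> gather (GL i) (cf u)"
abbreviation "uI i u \<equiv> gather (IL i) (cf u)"
text \<open>The local coarse coordinates of any u in V_h, whether or not u lies in the range of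
  \<open>R0\<close>.\<close>

abbreviation "red i u \<equiv> local_problem.coarse D S i (uG i u) (uI i u)"
abbreviation "ext i \<equiv> local_problem.extend D S i"
abbreviation "m i \<equiv> length (GL i) + k_loc S i"
abbreviation "hn i \<equiv> local_problem.h0_norm D S i"

lemma dim_red [simp]: "i < N \<Longrightarrow> dim_vec (red i u) = m i"
  by (simp add: local_problem.dim_coarse[OF local_problem])

lemma dim_ext [simp]: "i < N \<Longrightarrow> dim_vec (ext i a b) = length (IL i)"
  by (simp add: local_problem.dim_extend[OF local_problem])

lemma b_form_split: "b_fe u w = (\<Sum>i<N. local_problem.b_loc D i (uG i u) (uI i u) (uG i w) (uI i w))"
  unfolding fe_fun_eq b_form_nodal_comb
proof (rule sum_over_subdomains)
  fix i assume i: "i < N"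
  show "local_problem.b_loc D i (uG i u) (uI i u) (uG i w) (uI i w) =
      (\<Sum>y\<in>Y. \<Sum>z\<in>Y. cf u y * cnj (cf w z) * b_sub i y z)"
    unfolding local_problem.b_loc_def[OF local_problem[OF i]] B_GG_def B_GI_def B_IG_def B_II_def
    by (rule block_form[OF i]) (auto simp: form_basis(1)[OF _ _ i] b_sub_zero[OF i] intro: b_entry_commute)
qed (rule b_entry_split(1))

lemma h_inner_split:
  "h_inner D \<Omega> (fe_fun D u) (fe_fun D w) = (\<Sum>i<N. local_problem.h_loc D i (uG i u) (uI i u) (uG i w) (uI i w))"
  unfolding fe_fun_eq h_inner_comb
proof (rule sum_over_subdomains)
  fix i assume i: "i < N"
  show "local_problem.h_loc D i (uG i u) (uI i u) (uG i w) (uI i w) =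
      (\<Sum>y\<in>Y. \<Sum>z\<in>Y. cf u y * cnj (cf w z) * h_sub i y z)"
    unfolding local_problem.h_loc_def[OF local_problem[OF i]] H_GG_def H_GI_def H_IG_def H_II_def
    by (rule block_form[OF i]) (auto simp: form_basis(2)[OF _ _ i] h_sub_zero[OF i] intro: h_entry_commute)
qed (rule b_entry_split(2))

text \<open>The Schur complement inequality \<open>h_loc_energy\<close> summed over the subdomains;
  the local energies add up to the global one by \<open>h_inner_split\<close>.\<close>

lemma coarse_energy: "L2_set (\<lambda>i. hn i (red i u)) {..<N} \<le> energy u"
proof (rule power2_le_imp_le)
  have "(L2_set (\<lambda>i. hn i (red i u)) {..<N})\<^sup>2 = (\<Sum>i<N. (hn i (red i u))\<^sup>2)"
    by (simp add: L2_set_def sum_nonneg)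
  also have "\<dots> \<le> (\<Sum>i<N. Re (local_problem.h_loc D i (uG i u) (uI i u) (uG i u) (uI i u)))"
  proof (rule sum_mono)
    fix i assume "i \<in> {..<N}"
    then have i: "i < N" by simp
    show "(hn i (red i u))\<^sup>2 \<le> Re (local_problem.h_loc D i (uG i u) (uI i u) (uG i u) (uI i u))"
      using local_problem.h_loc_energy[OF local_problem[OF i], of "uG i u" "uI i u"]
        local_problem.h0_norm_square[OF local_problem[OF i] dim_red[OF i, of u]]
      by (simp del: of_real_power)
  qed
  also have "\<dots> = Re (h_inner D \<Omega> (fe_fun D u) (fe_fun D u))" by (simp add: h_inner_split)
  also have "\<dots> = (energy u)\<^sup>2" by (simp add: h_inner_self)
  finally show "(L2_set (\<lambda>i. hn i (red i u)) {..<N})\<^sup>2 \<le> (energy u)\<^sup>2" .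
qed (rule h_norm_nonneg)

abbreviation "RGS i \<equiv> R_GammaS D S i"

lemma dim_RGS [simp]: "dim_row (RGS i) = m i" "dim_col (RGS i) = dim_V0 D S"
  by (simp_all add: R_GammaS_def R_Gamma_def dim_V0_def)

lemma real_RGS [simp]: "real_mat (RGS i)"
  by (simp add: R_GammaS_def R_Gamma_def)

lemma RGS_vec:
  assumes "dim_vec a = length nGam" "dim_vec \<alpha> = dim_alpha D S"
  shows "RGS i *\<^sub>v (a @\<^sub>v \<alpha>) = gather (GL i) (nodal_val nGam a) @\<^sub>v (R_S D S i *\<^sub>v \<alpha>)"
proof -
  have z: "0\<^sub>m k nA *\<^sub>v \<alpha> = 0\<^sub>v k" "0\<^sub>m k (length nGam) *\<^sub>v a = 0\<^sub>v k" for k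
    using assms by (auto intro!: eq_vecI simp: scalar_prod_def)
  show ?thesis
    unfolding R_GammaS_def using assms
    by (subst four_block_mult_append) (simp_all add: R_Gamma_def restr_mat_vec z zero_vec_simps)
qed

lemma V0_cases:
  assumes "x \<in> carrier_vec nV0"
  obtains a \<alpha> where "x = a @\<^sub>v \<alpha>" "dim_vec a = length nGam" "dim_vec \<alpha> = dim_alpha D S"
proof -
  have "x = vec_first x (length nGam) @\<^sub>v vec_last x nA"
    using assms by (intro vec_first_last_append[symmetric]) (simp add: dim_V0_def)
  then show thesis using that by simp
qed

lemma nodes_I_sum:
  assumes z: "z \<in> set (IL i)" and i: "i < N"
  shows "(\<Sum>j<N. nodal_val (IL j) (f j) z) = nodal_val (IL i) (f i) z"
proof -
  have "(\<Sum>j<N. nodal_val (IL j) (f j) z) = (\<Sum>j<N. if j = i then nodal_val (IL i) (f i) z else 0)"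
    using IL_disjoint[OF i _ _ z] by (intro sum.cong refl) (auto intro!: nodal_val_notin)
  then show ?thesis using i by simp
qed

lemma dim_local [simp]:
  assumes "i < N"
  shows "dim_row (Q_S S i) = length (IL i)" "dim_col (Q_S S i) = k_loc S i"
    "dim_row (B_L D S i) = length (IL i)" "dim_col (B_L D S i) = length (IL i)"
    "dim_row (B_IG D i) = length (IL i)" "dim_col (B_IG D i) = length (GL i)"
    "dim_row (B0_loc D S i) = m i" "dim_col (B0_loc D S i) = m i"
    "dim_row (BP1_loc D S i) = m i" "dim_col (BP1_loc D S i) = m i"
    "dim_row (Q_L S i) = length (IL i)"
    "real_mat (B_L D S i)" "real_mat (B_IG D i)" "real_mat (Q_S S i)"
  using local_problem[OF assms]
  by (simp_all add: local_problem.dim_QS local_problem.dim_QL local_problem.dim_L local_problem.dim_blocks local_problem.dim_B0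
      local_problem.dim_BP1 local_problem.real_B_L local_problem.real_B_IG local_problem.real_Q)

lemma dim_R_I [simp]: "dim_row (R_I D i) = length (IL i)" "dim_col (R_I D i) = length nInt"
  "dim_row (R_Gamma D i) = length (GL i)" "dim_col (R_Gamma D i) = length nGam"
  "dim_row (R_loc D i) = length (IL i)" "dim_col (R_loc D i) = dim_Vh D"
  by (simp_all add: R_I_def R_Gamma_def R_loc_def dim_Vh_def)

lemma real_R_I [simp]: "real_mat (R_I D i)" "real_mat (R_Gamma D i)"
  by (simp_all add: R_I_def R_Gamma_def)

lemma dim_R0T [simp]: "dim_row R0 = dim_Vh D" "dim_col R0 = dim_V0 D S"
  by (simp_all add: R0T_def Let_def dim_Vh_def nodes_all_def dim_V0_def)

lemma real_R0T [simp]: "real_mat R0"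
  unfolding R0T_def Let_def
  by (intro real_mat_four_block real_mat_sum real_mat_mult real_mat_uminus) simp_all

lemma R0T_vec:
  assumes a: "dim_vec a = length nGam" and \<alpha>: "dim_vec \<alpha> = dim_alpha D S"
  shows "R0 *\<^sub>v (a @\<^sub>v \<alpha>) = a @\<^sub>v gather nInt (\<lambda>z. \<Sum>i<N. nodal_val (IL i)
    (ext i (gather (GL i) (nodal_val nGam a)) (R_S D S i *\<^sub>v \<alpha>)) z)"
proof -
  let ?F = "\<lambda>i. (R_I D i)\<^sup>T * (- (B_L D S i * B_IG D i * R_Gamma D i))"
  let ?E = "\<lambda>i. (R_I D i)\<^sup>T * (Q_S S i * R_S D S i)"
  let ?g = "\<lambda>i. gather (GL i) (nodal_val nGam a)"
  have z: "0\<^sub>m k nA *\<^sub>v \<alpha> = 0\<^sub>v k" for k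
    using \<alpha> by (auto intro!: eq_vecI simp: scalar_prod_def)
  have o: "1\<^sub>m (length nGam) *\<^sub>v a = a" using a by (intro one_mult_mat_vec carrier_vecI)
  have "mat_sum (length nInt) (length nGam) N ?F *\<^sub>v a + mat_sum (length nInt) nA N ?E *\<^sub>v \<alpha> =
      gather nInt (\<lambda>z. \<Sum>i<N. nodal_val (IL i) (ext i (?g i) (R_S D S i *\<^sub>v \<alpha>)) z)"
  proof (rule eq_vecI)
    fix r assume "r < dim_vec (gather nInt (\<lambda>z. \<Sum>i<N. nodal_val (IL i) (ext i (?g i) (R_S D S i *\<^sub>v \<alpha>)) z))"
    then have r: "r < length nInt" by simp
    have "(mat_sum (length nInt) (length nGam) N ?F *\<^sub>v a + mat_sum (length nInt) nA N ?E *\<^sub>v \<alpha>) $ r =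
        (mat_sum (length nInt) (length nGam) N ?F *\<^sub>v a) $ r + (mat_sum (length nInt) nA N ?E *\<^sub>v \<alpha>) $ r"
      using r by (intro index_add_vec(1)) simp
    also have "(mat_sum (length nInt) (length nGam) N ?F *\<^sub>v a) $ r = (\<Sum>i<N. (?F i *\<^sub>v a) $ r)"
      by (rule mat_sum_vec_index) (use a r in simp_all)
    also have "(mat_sum (length nInt) nA N ?E *\<^sub>v \<alpha>) $ r = (\<Sum>i<N. (?E i *\<^sub>v \<alpha>) $ r)"
      by (rule mat_sum_vec_index) (use \<alpha> r in simp_all)
    also have "(\<Sum>i<N. (?F i *\<^sub>v a) $ r) + (\<Sum>i<N. (?E i *\<^sub>v \<alpha>) $ r) =
        (\<Sum>i<N. nodal_val (IL i) (ext i (?g i) (R_S D S i *\<^sub>v \<alpha>)) (nInt ! r))"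
      unfolding sum.distrib[symmetric]
    proof (rule sum.cong[OF refl])
      fix i assume "i \<in> {..<N}"
      then have i: "i < N" by simp
      define p q where "p = - (B_L D S i *\<^sub>v (B_IG D i *\<^sub>v ?g i))" and "q = Q_S S i *\<^sub>v (R_S D S i *\<^sub>v \<alpha>)"
      have pq: "dim_vec p = length (IL i)" "dim_vec q = length (IL i)" using i by (simp_all add: p_def q_def)
      have "?F i *\<^sub>v a = (R_I D i)\<^sup>T *\<^sub>v p"
        using i a by (simp add: mult_mat_mat_vec mult_mat_uminus_vec p_def) (simp add: R_Gamma_def restr_mat_vec)
      then have F: "(?F i *\<^sub>v a) $ r = nodal_val (IL i) p (nInt ! r)"
        using pq r by (simp only: R_I_def restr_mat_transpose_vec gather_index)
      have "?E i *\<^sub>v \<alpha> = (R_I D i)\<^sup>T *\<^sub>v q"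
        using i \<alpha> by (simp add: mult_mat_mat_vec q_def)
      then have E: "(?E i *\<^sub>v \<alpha>) $ r = nodal_val (IL i) q (nInt ! r)"
        using pq r by (simp only: R_I_def restr_mat_transpose_vec gather_index)
      have "ext i (?g i) (R_S D S i *\<^sub>v \<alpha>) = p + q"
        unfolding local_problem.extend_def[OF local_problem[OF i]] p_def q_def
        using i by (intro eq_vecI) auto
      then show "(?F i *\<^sub>v a) $ r + (?E i *\<^sub>v \<alpha>) $ r = nodal_val (IL i) (ext i (?g i) (R_S D S i *\<^sub>v \<alpha>)) (nInt ! r)"
        using nodal_val_add[OF pq] unfolding F E by simp
    qed
    finally show "(mat_sum (length nInt) (length nGam) N ?F *\<^sub>v a + mat_sum (length nInt) nA N ?E *\<^sub>v \<alpha>) $ r =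
      gather nInt (\<lambda>z. \<Sum>i<N. nodal_val (IL i) (ext i (?g i) (R_S D S i *\<^sub>v \<alpha>)) z) $ r"
      using r by simp
  qed simp
  then show ?thesis
    unfolding R0T_def Let_def using a \<alpha>
    by (subst four_block_mult_append) (simp_all add: z o zero_vec_simps)
qed

text \<open>The form in which the estimates use \<open>R0\<close>: seen from one subdomain, it is
  the local extension of the restricted coarse vector.\<close>

lemma R0T_local:
  assumes x: "x \<in> carrier_vec nV0" and i: "i < N"
  shows "\<exists>\<alpha>. dim_vec \<alpha> = k_loc S i \<and> RGS i *\<^sub>v x = uG i (R0 *\<^sub>v x) @\<^sub>v \<alpha>
      \<and> uI i (R0 *\<^sub>v x) = ext i (uG i (R0 *\<^sub>v x)) \<alpha>"
proof -
  obtain a \<alpha> where a: "x = a @\<^sub>v \<alpha>" "dim_vec a = length nGam" "dim_vec \<alpha> = dim_alpha D S"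
    using V0_cases[OF x] .
  let ?f = "\<lambda>z. \<Sum>i<N. nodal_val (IL i) (ext i (gather (GL i) (nodal_val nGam a)) (R_S D S i *\<^sub>v \<alpha>)) z"
  have cf: "cf (R0 *\<^sub>v x) y = nodal_val nGam a y + nodal_val nInt (gather nInt ?f) y" for y
    unfolding a(1) R0T_vec[OF a(2,3)] nodes_all_def using a(2) by (intro nodal_val_append) simp_all
  have G: "uG i (R0 *\<^sub>v x) = gather (GL i) (nodal_val nGam a)"
    using GL_subset[OF i] node_sets_disjoint
    by (intro gather_cong) (auto simp: cf intro!: nodal_val_notin)
  have I: "uI i (R0 *\<^sub>v x) = ext i (gather (GL i) (nodal_val nGam a)) (R_S D S i *\<^sub>v \<alpha>)"
  proof -
    have "uI i (R0 *\<^sub>v x) = gather (IL i) (nodal_val (IL i) (ext i (gather (GL i) (nodal_val nGam a)) (R_S D S i *\<^sub>v \<alpha>)))"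
    proof (rule gather_cong)
      fix y assume y: "y \<in> set (IL i)"
      then have "y \<in> set nInt" "y \<notin> set nGam" using IL_subset[OF i] node_sets_disjoint by auto
      then show "cf (R0 *\<^sub>v x) y = nodal_val (IL i) (ext i (gather (GL i) (nodal_val nGam a)) (R_S D S i *\<^sub>v \<alpha>)) y"
        using nodes_I_sum[OF y i] by (simp add: cf nodal_val_notin nodal_val_gather)
    qed
    then show ?thesis using i by (simp add: gather_nodal_val)
  qed
  show "\<exists>\<alpha>. dim_vec \<alpha> = k_loc S i \<and> RGS i *\<^sub>v x = uG i (R0 *\<^sub>v x) @\<^sub>v \<alpha>
      \<and> uI i (R0 *\<^sub>v x) = ext i (uG i (R0 *\<^sub>v x)) \<alpha>"
    using G I RGS_vec[OF a(2,3)] a(1) by (intro exI[of _ "R_S D S i *\<^sub>v \<alpha>"]) simp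
qed

lemma red_R0T:
  assumes x: "x \<in> carrier_vec nV0" and i: "i < N"
  shows "red i (R0 *\<^sub>v x) = RGS i *\<^sub>v x"
proof -
  obtain \<alpha> where "dim_vec \<alpha> = k_loc S i" "RGS i *\<^sub>v x = uG i (R0 *\<^sub>v x) @\<^sub>v \<alpha>"
    "uI i (R0 *\<^sub>v x) = ext i (uG i (R0 *\<^sub>v x)) \<alpha>"
    using R0T_local[OF assms] by blast
  then show ?thesis
    using local_problem.coarse_extend[OF local_problem[OF i], of "uG i (R0 *\<^sub>v x)" \<alpha>] by simp
qed

text \<open>The test vector w is arbitrary in V_h. This lets the full inf-sup condition be applied
  to vectors in the range of \<open>R0\<close>.\<close>

lemma b_form_R0T_left:
  assumes x: "x \<in> carrier_vec nV0"
  shows "b_fe (R0 *\<^sub>v x) w = (\<Sum>i<N. (B0_loc D S i *\<^sub>v (RGS i *\<^sub>v x)) \<bullet>c red i w)"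
  unfolding b_form_split
proof (rule sum.cong[OF refl])
  fix i assume "i \<in> {..<N}"
  then have i: "i < N" by simp
  obtain \<alpha> where "dim_vec \<alpha> = k_loc S i" "RGS i *\<^sub>v x = uG i (R0 *\<^sub>v x) @\<^sub>v \<alpha>"
    "uI i (R0 *\<^sub>v x) = ext i (uG i (R0 *\<^sub>v x)) \<alpha>"
    using R0T_local[OF x i] by blast
  then show "local_problem.b_loc D i (uG i (R0 *\<^sub>v x)) (uI i (R0 *\<^sub>v x)) (uG i w) (uI i w) =
      (B0_loc D S i *\<^sub>v (RGS i *\<^sub>v x)) \<bullet>c red i w"
    using local_problem.b_loc_extend_left[OF local_problem[OF i], of "uG i (R0 *\<^sub>v x)" \<alpha> "uG i w" "uI i w"] by simp
qed

text \<open>The mirror image: the Q_L-components of the first argument drop out, so the coarse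
  residual of w depends on w only through \<open>red i w\<close>.\<close>

lemma b_form_R0T_right:
  assumes x: "x \<in> carrier_vec nV0"
  shows "b_fe w (R0 *\<^sub>v x) = (\<Sum>i<N. (B0_loc D S i *\<^sub>v red i w) \<bullet>c (RGS i *\<^sub>v x))"
  unfolding b_form_split
proof (rule sum.cong[OF refl])
  fix i assume "i \<in> {..<N}"
  then have i: "i < N" by simp
  obtain \<alpha> where "dim_vec \<alpha> = k_loc S i" "RGS i *\<^sub>v x = uG i (R0 *\<^sub>v x) @\<^sub>v \<alpha>"
    "uI i (R0 *\<^sub>v x) = ext i (uG i (R0 *\<^sub>v x)) \<alpha>"
    using R0T_local[OF x i] by blast
  then show "local_problem.b_loc D i (uG i w) (uI i w) (uG i (R0 *\<^sub>v x)) (uI i (R0 *\<^sub>v x)) =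
      (B0_loc D S i *\<^sub>v red i w) \<bullet>c (RGS i *\<^sub>v x)"
    using local_problem.b_loc_extend_right[OF local_problem[OF i], of "uG i w" "uI i w" "uG i (R0 *\<^sub>v x)" \<alpha>] by simp
qed

definition alpha_of :: "cvec \<Rightarrow> nat \<Rightarrow> cvec" where
  "alpha_of v i = (Q_S S i)\<^sup>T *\<^sub>v (H_II D i *\<^sub>v uI i v)"

text \<open>The component v_0 of the decomposition of v: nodal values on \<Gamma>, and in each
  interior the Q_S-coordinates.\<close>

definition coarse_part :: "cvec \<Rightarrow> cvec" where
  "coarse_part v = gather nGam (cf v) @\<^sub>v join_alpha D S (alpha_of v)"

lemma dim_join_alpha [simp]: "dim_vec (join_alpha D S a) = dim_alpha D S"
  by (simp add: join_alpha_def)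

lemma coarse_part_carrier [simp]: "coarse_part v \<in> carrier_vec nV0"
  by (rule carrier_vecI) (simp add: coarse_part_def dim_V0_def)

lemma gather_GL: "i < N \<Longrightarrow> gather (GL i) (nodal_val nGam (gather nGam c)) = gather (GL i) c"
  using GL_subset by (intro gather_cong nodal_val_gather) auto

lemma RGS_coarse_part: assumes i: "i < N" shows "RGS i *\<^sub>v coarse_part v = red i v"
proof -
  have "R_S D S i *\<^sub>v join_alpha D S (alpha_of v) = alpha_of v i"
    using i by (intro R_S_join_alpha) (simp_all add: alpha_of_def)
  then show ?thesis
    using i by (simp add: coarse_part_def RGS_vec gather_GL local_problem.coarse_def[OF local_problem[OF i]] alpha_of_def)
qed

section \<open>The coarse preconditioner: perturbation bound, stability, invertibility\<close>

lemma dim_BP1 [simp]: "dim_row (BP1 D S) = dim_V0 D S" "dim_col (BP1 D S) = dim_V0 D S"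
  by (simp_all add: BP1_def)

lemma BP1_csp:
  assumes "x \<in> carrier_vec nV0" "w \<in> carrier_vec nV0"
  shows "(BP1 D S *\<^sub>v x) \<bullet>c w = (\<Sum>i<N. (BP1_loc D S i *\<^sub>v (RGS i *\<^sub>v x)) \<bullet>c (RGS i *\<^sub>v w))"
proof -
  have d: "dim_vec x = dim_V0 D S" "dim_vec w = dim_V0 D S" using assms by auto
  have "(BP1 D S *\<^sub>v x) \<bullet>c w = (\<Sum>i<N. (((RGS i)\<^sup>T * BP1_loc D S i * RGS i) *\<^sub>v x) \<bullet>c w)"
    unfolding BP1_def by (rule mat_sum_csp) (simp_all add: d)
  also have "\<dots> = (\<Sum>i<N. (BP1_loc D S i *\<^sub>v (RGS i *\<^sub>v x)) \<bullet>c (RGS i *\<^sub>v w))"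
  proof (rule sum.cong[OF refl])
    fix i assume "i \<in> {..<N}"
    then have i: "i < N" by simp
    have "((RGS i)\<^sup>T *\<^sub>v (BP1_loc D S i *\<^sub>v (RGS i *\<^sub>v x))) \<bullet>c w = (BP1_loc D S i *\<^sub>v (RGS i *\<^sub>v x)) \<bullet>c (RGS i *\<^sub>v w)"
      using csp_adjoint[of "(RGS i)\<^sup>T" "BP1_loc D S i *\<^sub>v (RGS i *\<^sub>v x)" w] i d by simp
    then show "(((RGS i)\<^sup>T * BP1_loc D S i * RGS i) *\<^sub>v x) \<bullet>c w = (BP1_loc D S i *\<^sub>v (RGS i *\<^sub>v x)) \<bullet>c (RGS i *\<^sub>v w)"
      using i d by (simp add: mult_mat_mat_vec)
  qed
  finally show ?thesis .
qed

abbreviation "defect i x y \<equiv> (B0_loc D S i *\<^sub>v x) \<bullet>c y - (BP1_loc D S i *\<^sub>v x) \<bullet>c y"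

text \<open>The local bounds are combined by Cauchy-Schwarz over the subdomains. As the squared
  local \<open>H0\<close>-norms sum to at most the squared energy, no factor counting subdomains
  appears.\<close>

lemma sum_defect_le:
  "cmod (\<Sum>i<N. defect i (red i u) (red i w)) \<le> 2 * eta S * (energy u * energy w)"
proof -
  have "cmod (\<Sum>i<N. defect i (red i u) (red i w)) \<le> (\<Sum>i<N. 2 * eta S * (\<bar>hn i (red i u)\<bar> * \<bar>hn i (red i w)\<bar>))"
  proof (rule sum_norm_le)
    fix i assume "i \<in> {..<N}"
    then have i: "i < N" by simp
    show "cmod (defect i (red i u) (red i w)) \<le> 2 * eta S * (\<bar>hn i (red i u)\<bar> * \<bar>hn i (red i w)\<bar>)"
      using local_problem.B0_minus_BP1_le[OF local_problem[OF i] dim_red[OF i, of u] dim_red[OF i, of w]]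
        local_problem.h0_norm_nonneg[OF local_problem[OF i]]
      by (simp add: mult.assoc)
  qed
  also have "\<dots> = 2 * eta S * (\<Sum>i<N. \<bar>hn i (red i u)\<bar> * \<bar>hn i (red i w)\<bar>)"
    by (simp only: sum_distrib_left)
  also have "\<dots> \<le> 2 * eta S * (L2_set (\<lambda>i. hn i (red i u)) {..<N} * L2_set (\<lambda>i. hn i (red i w)) {..<N})"
    using eta_pos by (intro mult_left_mono L2_set_mult_ineq) simp
  also have "\<dots> \<le> 2 * eta S * (energy u * energy w)"
    using eta_pos by (intro mult_left_mono mult_mono coarse_energy) (simp_all add: h_norm_nonneg)
  finally show ?thesis .
qed

text \<open>
  The inf-sup condition for \<open>b\<close> tested on the range of \<open>R\<^sub>0\<^sup>T\<close>, where \<open>b\<close> reduces to the coarse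
  matrices: replacing these by the preconditioner costs \<open>2\<eta>\<close> on either side.
\<close>

lemma coarse_stability:
  assumes inf_sup: "discrete_inf_sup D \<gamma>" and x: "x \<in> carrier_vec nV0" and v: "v \<in> carrier_vec nVh"
    and eq: "\<And>w. w \<in> carrier_vec nV0 \<Longrightarrow> (BP1 D S *\<^sub>v x) \<bullet>c w = (\<Sum>i<N. defect i (red i v) (RGS i *\<^sub>v w))"
  shows "(\<gamma> - 2 * eta S) * energy (R0 *\<^sub>v x) \<le> 2 * eta S * energy v"
proof -
  let ?u = "R0 *\<^sub>v x"
  have u: "?u \<in> carrier_vec nVh" by (rule carrier_vecI) simp
  have "\<gamma> * energy ?u \<le> 2 * eta S * (energy ?u + energy v)"
  proof (rule inf_sup_bound[OF inf_sup u])
    show "0 \<le> 2 * eta S * (energy ?u + energy v)"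
      using eta_pos by (intro mult_nonneg_nonneg add_nonneg_nonneg h_norm_nonneg) simp_all
    fix w :: "cvec" assume "w \<in> carrier_vec nVh"
    \<comment> \<open>The equation \<open>eq\<close> speaks of coarse test vectors only. Inserting
      \<open>coarse_part w\<close> carries it to an arbitrary w, since both sides then see w only
      through \<open>red i w\<close>.\<close>
    have "(\<Sum>i<N. (BP1_loc D S i *\<^sub>v red i ?u) \<bullet>c red i w) = (BP1 D S *\<^sub>v x) \<bullet>c coarse_part w"
      unfolding BP1_csp[OF x coarse_part_carrier] by (intro sum.cong refl) (simp add: red_R0T[OF x] RGS_coarse_part)
    also have "\<dots> = (\<Sum>i<N. defect i (red i v) (red i w))"
      unfolding eq[OF coarse_part_carrier] by (intro sum.cong refl) (simp add: RGS_coarse_part)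
    finally have P: "(\<Sum>i<N. (BP1_loc D S i *\<^sub>v red i ?u) \<bullet>c red i w) = (\<Sum>i<N. defect i (red i v) (red i w))" .
    have "b_fe ?u w = (\<Sum>i<N. (B0_loc D S i *\<^sub>v red i ?u) \<bullet>c red i w)"
      unfolding b_form_R0T_left[OF x] by (intro sum.cong refl) (simp add: red_R0T[OF x])
    also have "\<dots> = (\<Sum>i<N. defect i (red i ?u) (red i w)) + (\<Sum>i<N. defect i (red i v) (red i w))"
      unfolding P[symmetric] by (simp only: sum.distrib[symmetric] diff_add_cancel)
    finally have "cmod (b_fe ?u w) \<le>
        2 * eta S * (energy ?u * energy w) + 2 * eta S * (energy v * energy w)"
      using norm_triangle_mono[OF sum_defect_le[of ?u w] sum_defect_le[of v w]] by simp
    then show "cmod (b_fe ?u w) \<le>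
        2 * eta S * (energy ?u + energy v) * energy w"
      by (simp add: algebra_simps)
  qed
  then show ?thesis by (simp add: algebra_simps)
qed

text \<open>The values on \<Gamma> are copied unchanged by \<open>R0\<close>, and the
  Q_S-coordinates are recovered from the extension by \<open>red\<close>.\<close>

lemma R0T_injective:
  assumes x: "x \<in> carrier_vec nV0" and 0: "R0 *\<^sub>v x = 0\<^sub>v nVh"
  shows "x = 0\<^sub>v nV0"
proof -
  obtain a \<alpha> where a: "x = a @\<^sub>v \<alpha>" "dim_vec a = length nGam" "dim_vec \<alpha> = dim_alpha D S"
    using V0_cases[OF x] .
  have cf0: "cf (R0 *\<^sub>v x) = (\<lambda>y. 0)" unfolding 0 by (simp add: dim_Vh_def fun_eq_iff)
  have z: "gather xs (\<lambda>y. 0) = 0\<^sub>v (length xs)" for xs :: "'a list" by (rule eq_vecI) simp_all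
  have a0: "a = 0\<^sub>v (length nGam)"
  proof (rule eq_vecI)
    fix r assume "r < dim_vec (0\<^sub>v (length nGam) :: cvec)"
    then have r: "r < length nGam" by simp
    then have "a $ r = (R0 *\<^sub>v x) $ r" unfolding a(1) R0T_vec[OF a(2,3)] using a(2) by simp
    also have "\<dots> = 0" unfolding 0 using r by (simp add: dim_Vh_def nodes_all_def)
    finally show "a $ r = 0\<^sub>v (length nGam) $ r" using r by simp
  qed (simp add: a)
  have "R_S D S i *\<^sub>v \<alpha> = 0\<^sub>v (k_loc S i)" if i: "i < N" for i
  proof -
    have "red i (R0 *\<^sub>v x) = 0\<^sub>v (length (GL i)) @\<^sub>v 0\<^sub>v (k_loc S i)"
      unfolding local_problem.coarse_def[OF local_problem[OF i]] cf0 z using i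
      by (simp add: mult_mat_zero_vec H_II_def)
    moreover have "red i (R0 *\<^sub>v x) = gather (GL i) (nodal_val nGam a) @\<^sub>v (R_S D S i *\<^sub>v \<alpha>)"
      by (rule trans[OF red_R0T[OF x i]]) (simp only: a(1) RGS_vec[OF a(2,3)])
    ultimately show ?thesis
      using append_vec_eq[of "0\<^sub>v (length (GL i))" "length (GL i)" "gather (GL i) (nodal_val nGam a)"]
      by (metis carrier_vecI dim_gather index_zero_vec(2))
  qed
  then have "\<alpha> = 0\<^sub>v nA" using R_S_zero a(3) by blast
  then show ?thesis unfolding a(1) a0 by (intro eq_vecI) (auto simp: dim_V0_def)
qed

text \<open>For a square matrix injectivity is enough. A kernel vector x has
  \<open>R0 *\<^sub>v x\<close> of zero energy by \<open>coarse_stability\<close> at v = 0, hence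
  zero by \<open>h_norm_pos\<close>, and \<open>R0\<close> is injective.\<close>

lemma BP1_inverse:
  assumes inf_sup: "discrete_inf_sup D \<gamma>" "0 < \<gamma>" "0 < \<gamma> - 2 * eta S"
  shows "inv_mat (BP1 D S) \<in> carrier_mat nV0 nV0" "BP1 D S * inv_mat (BP1 D S) = 1\<^sub>m nV0"
proof -
  have inj: "x = 0\<^sub>v nV0" if x: "x \<in> carrier_vec nV0" and 0: "BP1 D S *\<^sub>v x = 0\<^sub>v nV0" for x
  proof -
    let ?z = "0\<^sub>v nVh :: cvec"
    have r0: "red i ?z = 0\<^sub>v (m i)" if i: "i < N" for i
    proof -
      have "gather xs (cf ?z) = 0\<^sub>v (length xs)" for xs :: "'a list"
        by (rule eq_vecI) (simp_all add: dim_Vh_def)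
      then show ?thesis
        unfolding local_problem.coarse_def[OF local_problem[OF i]] using i
        by (simp add: mult_mat_zero_vec H_II_def) (auto intro!: eq_vecI)
    qed
    have "(\<gamma> - 2 * eta S) * energy (R0 *\<^sub>v x) \<le> 2 * eta S * energy ?z"
    proof (rule coarse_stability[OF inf_sup(1) x])
      fix w :: "cvec" assume w: "w \<in> carrier_vec nV0"
      have "(BP1 D S *\<^sub>v x) \<bullet>c w = 0" unfolding 0 using w csp_zero_left[of w] by simp
      moreover have "defect i (red i ?z) (RGS i *\<^sub>v w) = 0" if i: "i < N" for i
        unfolding r0[OF i] using i csp_zero_left[of "RGS i *\<^sub>v w"] by (simp add: mult_mat_zero_vec)
      ultimately show "(BP1 D S *\<^sub>v x) \<bullet>c w = (\<Sum>i<N. defect i (red i ?z) (RGS i *\<^sub>v w))" by simp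
    qed simp
    then have "energy (R0 *\<^sub>v x) \<le> 0"
      using inf_sup(3) by (simp add: h_norm_zero mult_le_0_iff)
    moreover have "R0 *\<^sub>v x \<in> carrier_vec nVh" by (rule carrier_vecI) simp
    ultimately have "R0 *\<^sub>v x = ?z" using h_norm_pos[OF inf_sup(1,2)] by fastforce
    then show ?thesis by (rule R0T_injective[OF x])
  qed
  have c: "BP1 D S \<in> carrier_mat nV0 nV0" by (rule carrier_matI) simp_all
  show "inv_mat (BP1 D S) \<in> carrier_mat nV0 nV0" "BP1 D S * inv_mat (BP1 D S) = 1\<^sub>m nV0"
    using inv_mat_of_injective[OF c] inj by blast+
qed

abbreviation "solver i \<equiv> (R_loc D i)\<^sup>T * (Q_L S i * inv_mat (B_i D S i) * (Q_L S i)\<^sup>T) * R_loc D i"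

text \<open>In each interior the local solver turns the residual of v into v minus the extension of
  its coarse coordinates; on \<Gamma> it contributes nothing, and there \<open>R0\<close> keeps the
  values of v.\<close>

lemma local_solve:
  assumes v: "v \<in> carrier_vec nVh"
  shows "mat_sum nVh nVh N
         solver *\<^sub>v (B_mat D *\<^sub>v v)
    + R0 *\<^sub>v coarse_part v = v" (is "?M *\<^sub>v _ + _ = v")
proof -
  define z where "z i = uI i v - ext i (uG i v) (alpha_of v i)" for i
  have dz: "dim_vec (z i) = length (IL i)" if "i < N" for i using that by (simp add: z_def)
  have dB: "dim_vec (B_mat D *\<^sub>v v) = dim_Vh D" by (simp add: B_mat_def dim_Vh_def)
  have "?M *\<^sub>v (B_mat D *\<^sub>v v) = gather (nodes_all D) (\<lambda>y. \<Sum>i<N. nodal_val (IL i) (z i) y)"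
  proof (rule eq_vecI)
    fix r assume "r < dim_vec (gather (nodes_all D) (\<lambda>y. \<Sum>i<N. nodal_val (IL i) (z i) y))"
    then have r: "r < length (nodes_all D)" by simp
    have "(?M *\<^sub>v (B_mat D *\<^sub>v v)) $ r = (\<Sum>i<N. (solver i *\<^sub>v (B_mat D *\<^sub>v v)) $ r)"
      by (rule mat_sum_vec_index) (use r dB in \<open>simp_all add: dim_Vh_def\<close>)
    also have "\<dots> = (\<Sum>i<N. nodal_val (IL i) (z i) (nodes_all D ! r))"
    proof (rule sum.cong[OF refl])
      fix i assume "i \<in> {..<N}"
      then have i: "i < N" by simp
      have "B_L D S i *\<^sub>v (R_loc D i *\<^sub>v (B_mat D *\<^sub>v v)) = z i"
        using local_problem.B_L_residual[OF local_problem[OF i], of "uG i v" "uI i v"] v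
        by (simp add: R_loc_B_mat[OF i] z_def alpha_of_def)
      then have "((R_loc D i)\<^sup>T * B_L D S i * R_loc D i) *\<^sub>v (B_mat D *\<^sub>v v) = (R_loc D i)\<^sup>T *\<^sub>v z i"
        using i dB by (simp add: mult_mat_mat_vec)
      then show "(solver i *\<^sub>v (B_mat D *\<^sub>v v)) $ r =
          nodal_val (IL i) (z i) (nodes_all D ! r)"
        unfolding B_L_def[symmetric] R_loc_def using dz[OF i] r
        by (simp add: restr_mat_transpose_vec del: index_mult_mat_vec)
    qed
    finally show "(?M *\<^sub>v (B_mat D *\<^sub>v v)) $ r = gather (nodes_all D) (\<lambda>y. \<Sum>i<N. nodal_val (IL i) (z i) y) $ r"
      using r by simp
  qed (simp add: dim_Vh_def)
  moreover have R: "gather (nodes_all D) (cf (R0 *\<^sub>v coarse_part v)) = R0 *\<^sub>v coarse_part v"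
    using gather_nodal_val[OF distinct_nodes_all, of "R0 *\<^sub>v coarse_part v"] by (simp add: dim_Vh_def)
  moreover have "gather (nodes_all D) (\<lambda>y. (\<Sum>i<N. nodal_val (IL i) (z i) y) + cf (R0 *\<^sub>v coarse_part v) y) = gather (nodes_all D) (cf v)"
  proof (rule gather_cong)
    fix y assume y: "y \<in> Y"
    let ?f = "\<lambda>z. \<Sum>i<N. nodal_val (IL i) (ext i (uG i v) (alpha_of v i)) z"
    have "R0 *\<^sub>v coarse_part v = gather nGam (cf v) @\<^sub>v gather nInt ?f"
    proof -
      have "(\<Sum>i<N. nodal_val (IL i) (ext i (gather (GL i) (nodal_val nGam (gather nGam (cf v)))) (R_S D S i *\<^sub>v join_alpha D S (alpha_of v))) z) = ?f z" for z
        by (intro sum.cong refl) (simp add: gather_GL R_S_join_alpha alpha_of_def)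
      then show ?thesis unfolding coarse_part_def by (subst R0T_vec) simp_all
    qed
    then have c: "cf (R0 *\<^sub>v coarse_part v) y = nodal_val nGam (gather nGam (cf v)) y + nodal_val nInt (gather nInt ?f) y"
      by (simp only: nodes_all_def) (rule nodal_val_append, simp_all)
    show "(\<Sum>i<N. nodal_val (IL i) (z i) y) + cf (R0 *\<^sub>v coarse_part v) y = cf v y"
    proof (cases "y \<in> set nGam")
      case True
      then have "y \<notin> set nInt" using node_sets_disjoint by blast
      moreover from this have "y \<notin> set (IL i)" if "i < N" for i using IL_subset[OF that] by blast
      ultimately show ?thesis using True by (simp add: c nodal_val_notin nodal_val_gather)
    next
      case False
      then have y': "y \<in> set nInt" using y Y_eq by blast
      then obtain i where i: "i < N" "y \<in> set (IL i)" using nInt_cover by blast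
      have "nodal_val (IL i) (z i) y + nodal_val (IL i) (ext i (uG i v) (alpha_of v i)) y = nodal_val (IL i) (uI i v) y"
      proof -
        have "z i + ext i (uG i v) (alpha_of v i) = uI i v"
          unfolding z_def using dim_ext[OF i(1)] by (intro eq_vecI) auto
        then show ?thesis
          using nodal_val_add[of "z i" "IL i" "ext i (uG i v) (alpha_of v i)" y] dz[OF i(1)] i(1) by simp
      qed
      then show ?thesis
        using False y' i by (simp add: c nodal_val_notin nodal_val_gather nodes_I_sum[OF i(2,1)])
    qed
  qed
  ultimately have "?M *\<^sub>v (B_mat D *\<^sub>v v) + R0 *\<^sub>v coarse_part v = gather (nodes_all D) (cf v)"
    by (simp only: gather_add R)
  also have "\<dots> = v" using v by (intro gather_nodal_val) (simp_all add: dim_Vh_def)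
  finally show ?thesis .
qed

theorem preconditioned_error:
  assumes inf_sup: "discrete_inf_sup D \<gamma>" "0 < \<gamma>" "0 < \<gamma> - 2 * eta S" and v: "v \<in> carrier_vec nVh"
  obtains e where "dim_vec e = dim_Vh D" "P1_inv D S *\<^sub>v (B_mat D *\<^sub>v v) = v + e"
    "(\<gamma> - 2 * eta S) * energy e \<le> 2 * eta S * energy v"
proof -
  note inv = BP1_inverse[OF inf_sup]
  let ?g = "R0\<^sup>T *\<^sub>v (B_mat D *\<^sub>v v)"
  let ?M = "mat_sum nVh nVh N
         solver"
  \<comment> \<open>The coarse residual of v equals B_0 applied to \<open>coarse_part v\<close>, so
    x measures the effect of solving with \<open>BP1\<close> in place of B_0.\<close>
  define x where "x = inv_mat (BP1 D S) *\<^sub>v ?g - coarse_part v"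
  have di: "dim_row (inv_mat (BP1 D S)) = dim_V0 D S" "dim_col (inv_mat (BP1 D S)) = dim_V0 D S" using inv(1) by auto
  have dr: "dim_vec (coarse_part v) = dim_V0 D S" using coarse_part_carrier[of v] by (rule carrier_vecD)
  have dB: "dim_vec (B_mat D *\<^sub>v v) = dim_Vh D" "dim_vec v = dim_Vh D" using v by (simp_all add: B_mat_def dim_Vh_def)
  have x: "x \<in> carrier_vec nV0" by (rule carrier_vecI) (simp add: x_def dr)
  have "P1_inv D S *\<^sub>v (B_mat D *\<^sub>v v) = R0 *\<^sub>v (inv_mat (BP1 D S) *\<^sub>v ?g) + ?M *\<^sub>v (B_mat D *\<^sub>v v)"
    unfolding P1_inv_def using di dB by (subst add_mat_mult_vec) (simp_all add: mult_mat_mat_vec)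
  also have "R0 *\<^sub>v (inv_mat (BP1 D S) *\<^sub>v ?g) = R0 *\<^sub>v x + R0 *\<^sub>v coarse_part v"
  proof -
    have "inv_mat (BP1 D S) *\<^sub>v ?g = x + coarse_part v"
      unfolding x_def by (intro eq_vecI) (simp_all add: dr di del: index_mult_mat_vec)
    then show ?thesis using x dr by (simp add: mult_mat_add_vec)
  qed
  also have "R0 *\<^sub>v x + R0 *\<^sub>v coarse_part v + ?M *\<^sub>v (B_mat D *\<^sub>v v) =
      (?M *\<^sub>v (B_mat D *\<^sub>v v) + R0 *\<^sub>v coarse_part v) + R0 *\<^sub>v x"
    by (intro eq_vecI) (simp_all add: ac_simps del: index_mult_mat_vec)
  also have "\<dots> = v + R0 *\<^sub>v x" unfolding local_solve[OF v] ..
  finally have P: "P1_inv D S *\<^sub>v (B_mat D *\<^sub>v v) = v + R0 *\<^sub>v x" .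
  have "(\<gamma> - 2 * eta S) * energy (R0 *\<^sub>v x) \<le> 2 * eta S * energy v"
  proof (rule coarse_stability[OF inf_sup(1) x v])
    fix w :: "cvec" assume w: "w \<in> carrier_vec nV0"
    then have dw: "dim_vec w = dim_V0 D S" by simp
    have "BP1 D S *\<^sub>v (inv_mat (BP1 D S) *\<^sub>v ?g) = (BP1 D S * inv_mat (BP1 D S)) *\<^sub>v ?g"
      using di by (intro mult_mat_mat_vec[symmetric]) simp_all
    also have "\<dots> = ?g" unfolding inv(2) by (intro one_mult_mat_vec carrier_vecI) simp
    finally have "BP1 D S *\<^sub>v x = ?g - BP1 D S *\<^sub>v coarse_part v"
      unfolding x_def using di dr by (simp add: mult_mat_minus_vec)
    then have "(BP1 D S *\<^sub>v x) \<bullet>c w = ?g \<bullet>c w - (BP1 D S *\<^sub>v coarse_part v) \<bullet>c w"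
      using dw by (simp add: csp_minus_left)
    \<comment> \<open>Moving the transpose turns the coarse residual into b tested on the range of
      \<open>R0\<close>, where \<open>b_form_R0T_right\<close> replaces it by the local coarse
      matrices.\<close>
    also have "?g \<bullet>c w = (B_mat D *\<^sub>v v) \<bullet>c (R0 *\<^sub>v w)"
      using csp_adjoint[of "R0\<^sup>T" "B_mat D *\<^sub>v v" w] dB dw by simp
    also have "\<dots> = b_fe v (R0 *\<^sub>v w)"
      by (rule B_mat_csp) (simp_all add: dB)
    also have "\<dots> = (\<Sum>i<N. (B0_loc D S i *\<^sub>v red i v) \<bullet>c (RGS i *\<^sub>v w))"
      by (rule b_form_R0T_right[OF w])
    also have "(BP1 D S *\<^sub>v coarse_part v) \<bullet>c w = (\<Sum>i<N. (BP1_loc D S i *\<^sub>v red i v) \<bullet>c (RGS i *\<^sub>v w))"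
      unfolding BP1_csp[OF coarse_part_carrier w] by (intro sum.cong refl) (simp add: RGS_coarse_part)
    finally show "(BP1 D S *\<^sub>v x) \<bullet>c w = (\<Sum>i<N. defect i (red i v) (RGS i *\<^sub>v w))"
      by (simp only: sum_subtractf)
  qed
  then show thesis using that[of "R0 *\<^sub>v x"] P by simp
qed

end

theorem theorem4p7:
  fixes D :: "'a::euclidean_space helmholtz_fem"
    and S :: spectral_data
    and h \<sigma> k\<^sub>0 \<gamma> \<gamma>\<^sub>1 :: real
  assumes setting: "helmholtz_setting D h \<sigma>"
    and wavenumber: "0 < k\<^sub>0" "k\<^sub>0 \<le> wavenumber D"
    and inf_sup: "0 < \<gamma>" "discrete_inf_sup D \<gamma>"
    and spectral: "spectral_setting D S"
    and gamma1: "\<gamma>\<^sub>1 = \<gamma> - 2 * eta S" "0 < \<gamma>\<^sub>1"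
  shows "(\<forall>v \<in> carrier_vec (dim_Vh D) - {0\<^sub>v (dim_Vh D)}.
            h_norm D (fe_fun D (P1_inv D S *\<^sub>v (B_mat D *\<^sub>v v))) / h_norm D (fe_fun D v)
              \<le> 1 + C_stab (eta S) \<gamma>\<^sub>1) \<and>
         (C_stab (eta S) \<gamma>\<^sub>1 < 1 \<longrightarrow>
            (\<forall>v \<in> carrier_vec (dim_Vh D) - {0\<^sub>v (dim_Vh D)}.
               cmod (h_inner D (Omega D) (fe_fun D v)
                       (fe_fun D (P1_inv D S *\<^sub>v (B_mat D *\<^sub>v v))))
                 / (h_norm D (fe_fun D v))\<^sup>2
               \<ge> 1 - C_stab (eta S) \<gamma>\<^sub>1))"
proof -
  interpret helmholtz_spectral D h \<sigma> S
    by unfold_locales (fact setting, fact spectral)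
  let ?C = "C_stab (eta S) \<gamma>\<^sub>1"
  \<comment> \<open>Stated without quotients; division by the energy comes last, once
    \<open>h_norm_pos\<close> has made it positive.\<close>
  have main: "h_norm D (fe_fun D (P1_inv D S *\<^sub>v (B_mat D *\<^sub>v v))) \<le> (1 + ?C) * h_norm D (fe_fun D v) \<and>
      (1 - ?C) * (h_norm D (fe_fun D v))\<^sup>2 \<le>
        cmod (h_inner D (Omega D) (fe_fun D v) (fe_fun D (P1_inv D S *\<^sub>v (B_mat D *\<^sub>v v))))"
    if v: "v \<in> carrier_vec (dim_Vh D)" for v
  proof -
    let ?n = "h_norm D (fe_fun D v)"
    obtain e where e: "dim_vec e = dim_Vh D" "P1_inv D S *\<^sub>v (B_mat D *\<^sub>v v) = v + e"
        "(\<gamma> - 2 * eta S) * h_norm D (fe_fun D e) \<le> 2 * eta S * ?n"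
      using preconditioned_error[OF inf_sup(2,1) gamma1(2)[unfolded gamma1(1)] v] .
    \<comment> \<open>The origin of \<open>C_stab\<close>: the perturbation factor 2 \<eta> divided
      by the stability constant that is left after the perturbation.\<close>
    have ne: "h_norm D (fe_fun D e) \<le> ?C * ?n"
      using e(3)[folded gamma1(1)] gamma1(2) by (simp add: C_stab_def pos_le_divide_eq mult.commute)
    have add: "fe_fun D (v + e) = nodal_comb D (\<lambda>y. cf v y + cf e y)"
    proof -
      have "cf (v + e) = (\<lambda>y. cf v y + cf e y)"
        using v e(1) by (intro ext nodal_val_add) (simp_all add: dim_Vh_def)
      then show ?thesis by (simp only: fe_fun_eq)
    qed
    have "h_norm D (fe_fun D (v + e)) \<le> ?n + h_norm D (fe_fun D e)"
      unfolding add unfolding fe_fun_eq by (rule h_norm_triangle)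
    then have 1: "h_norm D (fe_fun D (v + e)) \<le> (1 + ?C) * ?n" using ne by (simp add: algebra_simps)
    let ?s = "h_inner D (Omega D) (fe_fun D v) (fe_fun D e)"
    have "h_inner D (Omega D) (fe_fun D v) (fe_fun D (v + e)) = complex_of_real (?n\<^sup>2) + ?s"
      unfolding add h_inner_self[symmetric] unfolding fe_fun_eq by (rule h_inner_add_right)
    moreover have "cmod ?s \<le> ?n * h_norm D (fe_fun D e)"
      unfolding fe_fun_eq by (rule h_inner_Cauchy_Schwarz)
    moreover have "?n * h_norm D (fe_fun D e) \<le> ?n * (?C * ?n)"
      by (intro mult_left_mono ne h_norm_nonneg)
    \<comment> \<open>The reverse triangle inequality: the product of v with itself is the squared
      energy, and the correction e can lower the modulus by at most \<open>cmod ?s\<close>.\<close>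
    moreover have "?n\<^sup>2 - cmod ?s \<le> cmod (complex_of_real (?n\<^sup>2) + ?s)"
      using norm_diff_ineq[of "complex_of_real (?n\<^sup>2)" ?s] by (simp del: of_real_power)
    ultimately have 2: "(1 - ?C) * ?n\<^sup>2 \<le> cmod (h_inner D (Omega D) (fe_fun D v) (fe_fun D (v + e)))"
      by (simp add: algebra_simps power2_eq_square)
    show ?thesis unfolding e(2) using 1 2 by blast
  qed
  show ?thesis
  proof (intro conjI ballI impI)
    fix v :: "cvec" assume v: "v \<in> carrier_vec (dim_Vh D) - {0\<^sub>v (dim_Vh D)}"
    have pos: "0 < h_norm D (fe_fun D v)" by (rule h_norm_pos[OF inf_sup(2,1) v])
    show "h_norm D (fe_fun D (P1_inv D S *\<^sub>v (B_mat D *\<^sub>v v))) / h_norm D (fe_fun D v) \<le> 1 + ?C"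
      using main[of v] v pos by (simp add: pos_divide_le_eq)
    show "cmod (h_inner D (Omega D) (fe_fun D v) (fe_fun D (P1_inv D S *\<^sub>v (B_mat D *\<^sub>v v)))) / (h_norm D (fe_fun D v))\<^sup>2 \<ge> 1 - ?C"
      using main[of v] v pos by (simp add: pos_le_divide_eq)
  qed
qed

end
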